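(* Let $L$ be an even lattice of odd rank $g$ with determinant $\Delta$ and dual lattice $L'$. Let $\alpha,\beta\in L'/L$ and let $m,n$ be integers satisfying $\frac{m}{2\Delta}\in\mathbb Z+q(\alpha)$ and $\frac{n}{2\Delta}\in\mathbb Z+q(\beta)$. Write $m=m_0v^2$ with $m_0,v\in\mathbb Z$, where $(-1)^{(g-1)/2}m_0$ is a fundamental discriminant. If $(v,\Delta)=1$ then for every integer $c\ge 1$ $$S_{\alpha,\beta}(m,n,c)\ll_L 2^{\omega(c)}\,\tau((v,c))\,(m_0n,c)^{\frac12}\,c^{\frac12},$$ where the implied constant depends only on $L$.
   Context: Lattices. An even lattice $L$ of rank $g$ is a free $\mathbb Z$-module of rank $g$ with a nondegenerate symmetric bilinear form $\langle\cdot,\cdot\rangle:L\times L\to\mathbb Z$ such that $\langle x,x\rangle\in2\mathbb Z$ for all $x$; put $q(x)=\frac12\langle x,x\rangle$, and extend both to $L\otimes\mathbb Q$. The dual lattice is $L'=\{x\in L\otimes\mathbb Q:\langle x,y\rangle\in\mathbb Z\ \forall y\in L\}$. $\Delta$ is the determinant of a Gram matrix of $L$ (possibly negative), so $|L'/L|=|\Delta|$. On $L'/L$, $q$ and $\langle\cdot,\cdot\rangle$ are well defined modulo $1$. $(b^+,b^-)$ is the signature of $L$, $g=b^++b^-$. Notation. $e_c(x)=e^{2\pi ix/c}$; $i^s=e^{\pi is/2}$ for real $s$; $(x,y)$ is the greatest common divisor; $\omega(c)$ is the number of distinct primes dividing $c$; $\tau(c)$ is the number of positive divisors of $c$. Fundamental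 discriminant: an integer $D$ such that either $D\equiv1\pmod 4$ is squarefree (including $D=1$), or $4\mid D$ with $D/4\equiv2,3\pmod4$ squarefree. Weil representation coefficients. For $\gamma=\begin{pmatrix}a&b\\c&d\end{pmatrix}\in\mathrm{SL}_2(\mathbb Z)$ with $c>0$ let $\tilde\gamma=(\gamma,\sqrt{cz+d})$ be its lift to the metaplectic group (principal branch), and $$\rho_{\alpha\beta}(\tilde\gamma)=\frac{i^{(b^--b^+)/2}}{c^{(b^++b^-)/2}\sqrt{|L'/L|}}\sum_{r\in L/cL}e_c\big(aq(\alpha+r)-\langle\beta,\alpha+r\rangle+dq(\beta)\big)$$ (computed with any representatives of $\alpha,\beta$ in $L'$). Kloosterman sums. Fix a half-integer $k$ (i.e. $2k\in\mathbb Z$) with $\sigma:=k+\frac12(b^--b^+)\in\mathbb Z$. For $c\in\mathbb Z^+$, $\frac{m}{2\Delta}\in\mathbb Z+q(\alpha)$ and $\frac{n}{2\Delta}\in\mathbb Z+q(\beta)$, $$S_{\alpha,\beta}(m,n,c)=e^{-\pi ik/2}\sum_{d\in(\mathbb Z/c\mathbb Z)^\times}\overline{\rho_{\alpha\beta}(\tilde\gamma)}\,e_{2\Delta c}(ma+nd),$$ where $\gamma=\begin{pmatrix}a&b\\c&d\end{pmatrix}\in\mathrm{SL}_2(\mathbb Z)$ is any matrix with bottom row $(c\ d)$; the sum does not depend on the choices made. *)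

theory Defs
  imports Complex_Main
    "HOL-Computational_Algebra.Squarefree"
    "HOL-Number_Theory.Totient"
    "Jordan_Normal_Form.Determinant"
begin

definition (in vector_space) lattice_basis :: "'b set \<Rightarrow> 'b list \<Rightarrow> bool" where
  "lattice_basis L bs \<longleftrightarrow>
     distinct bs \<and> independent (set bs) \<and> span (set bs) = UNIV \<and>
     L = range (\<lambda>z :: 'b \<Rightarrow> int. \<Sum>b\<in>set bs. scale (of_int (z b)) b)"

definition coset_rel :: "'a :: ab_group_add set \<Rightarrow> ('a \<times> 'a) set" where
  "coset_rel H = {(x, y). y - x \<in> H}"

(* The ambient rational vector space plays the role of L tensor Q: a Z-basis of L is a Q-basis
   of it, and form is the Q-bilinear extension of the form on L. *)
locale even_lattice = vector_space scale
  for scale :: "rat \<Rightarrow> 'v :: ab_group_add \<Rightarrow> 'v" +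
  fixes L :: "'v set"
    and form :: "'v \<Rightarrow> 'v \<Rightarrow> rat"
  assumes free: "\<exists>bs. lattice_basis L bs"
    and form_add_left: "form (x + y) z = form x z + form y z"
    and form_scale_left: "form (scale a x) y = a * form x y"
    and form_sym: "form x y = form y x"
    and form_integral: "\<lbrakk>x \<in> L; y \<in> L\<rbrakk> \<Longrightarrow> form x y \<in> \<int>"
    and form_even: "x \<in> L \<Longrightarrow> \<exists>j :: int. form x x = 2 * of_int j"
    and form_nondegenerate: "\<lbrakk>x \<in> L; \<And>y. y \<in> L \<Longrightarrow> form x y = 0\<rbrakk> \<Longrightarrow> x = 0"
begin

definition q :: "'v \<Rightarrow> rat" where
  "q x = form x x / 2"

definition dual_lattice :: "'v set" where
  "dual_lattice = {x. \<forall>y\<in>L. form x y \<in> \<int>}"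

definition some_basis :: "'v list" where
  "some_basis = (SOME bs. lattice_basis L bs)"

definition lattice_rank :: nat where
  "lattice_rank = length some_basis"

(* The entries are integers already; the floor only converts them from rat to int.
   The determinant does not depend on the basis. *)
definition lattice_det :: int where
  "lattice_det = det (mat lattice_rank lattice_rank
     (\<lambda>(i, j). \<lfloor>form (some_basis ! i) (some_basis ! j)\<rfloor>))"

(* The signature is computed over Q instead of R: a rational form can be diagonalised over Q,
   so the maximal dimensions of definite subspaces agree. *)
definition sig_pos :: nat where
  "sig_pos = Max {dim W | W. subspace W \<and> (\<forall>x\<in>W. x \<noteq> 0 \<longrightarrow> form x x > 0)}"

definition sig_neg :: nat where
  "sig_neg = Max {dim W | W. subspace W \<and> (\<forall>x\<in>W. x \<noteq> 0 \<longrightarrow> form x x < 0)}"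

end

definition e_frac :: "real \<Rightarrow> real \<Rightarrow> complex" where
  "e_frac c x = cis (2 * pi * x / c)"

definition i_pow :: "real \<Rightarrow> complex" where
  "i_pow s = cis (pi * s / 2)"

context even_lattice
begin

(* The argument (a, b, c, d) with c > 0 stands for the lift of the matrix with rows (a b) and
   (c d) given by the principal branch. The arguments alpha, beta are representatives in the
   dual lattice of classes modulo L. The summand depends on r only modulo cL. *)
definition weil_coeff :: "'v \<Rightarrow> 'v \<Rightarrow> int \<times> int \<times> int \<times> int \<Rightarrow> complex" where
  "weil_coeff \<alpha> \<beta> = (\<lambda>(a, b, c, d).
     i_pow ((real sig_neg - real sig_pos) / 2)
     / of_real (real_of_int c powr ((real sig_pos + real sig_neg) / 2)
                * sqrt (real (card (dual_lattice // coset_rel L))))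
     * (\<Sum>R \<in> L // coset_rel (scale (of_int c) ` L).
          let r = (SOME r. r \<in> R) in
          e_frac (real_of_int c)
            (of_rat (of_int a * q (\<alpha> + r) - form \<beta> (\<alpha> + r) + of_int d * q \<beta>))))"

(* totatives c represents the units modulo c. The chosen matrix is an arbitrary element of
   SL_2(Z) with bottom row (c d). *)
definition kloosterman :: "real \<Rightarrow> 'v \<Rightarrow> 'v \<Rightarrow> int \<Rightarrow> int \<Rightarrow> nat \<Rightarrow> complex" where
  "kloosterman k \<alpha> \<beta> m n c =
     cis (- pi * k / 2) *
     (\<Sum>d \<in> totatives c.
        let (a, b) = (SOME (a, b). a * int d - b * int c = 1) in
        cnj (weil_coeff \<alpha> \<beta> (a, b, int c, int d))
        * e_frac (of_int (2 * lattice_det * int c)) (of_int (m * a + n * int d)))"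

end

definition fundamental_discriminant :: "int \<Rightarrow> bool" where
  "fundamental_discriminant D \<longleftrightarrow>
     (D mod 4 = 1 \<and> squarefree D) \<or>
     (4 dvd D \<and> (D div 4) mod 4 \<in> {2, 3} \<and> squarefree (D div 4))"

definition num_prime_divisors :: "nat \<Rightarrow> nat" where
  "num_prime_divisors c = card {p. prime p \<and> p dvd c}"

definition num_divisors :: "nat \<Rightarrow> nat" where
  "num_divisors c = card {d. d dvd c}"

end

theory Submission
  imports Defs "HOL-Number_Theory.Euler_Criterion"
begin

text \<open>
  Up to a factor of modulus at most \<open>c powr (- g / 2)\<close>, the sum \<open>S(m, n, c)\<close> equals
  \<open>T(c) = \<Sum>d \<Sum>r e (X / c)\<close>, where \<open>X = a (m / 2\<Delta> - q (\<alpha> + r)) + \<langle>\<beta>, r\<rangle> + d (n / 2\<Delta> - q \<beta>)\<close> is an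
  integer and \<open>a d \<equiv> 1\<close> modulo \<open>c\<close>. By the Chinese remainder theorem \<open>T\<close>, twisted by units, is
  multiplicative in \<open>c\<close>.

  At a prime power \<open>p ^ k\<close> with \<open>p\<close> not dividing \<open>\<Delta>\<close> (so \<open>p\<close> is odd, as \<open>\<Delta>\<close> is even in odd rank),
  completing the square and diagonalising the form produces a product of \<open>g\<close> Gauss sums, that is, a constant
  of modulus \<open>p powr (g k / 2)\<close> times the \<open>k\<close>-th power of the Legendre symbol of \<open>a\<close>. What remains is a
  one-dimensional Kloosterman sum with that character. After removing the common power \<open>p ^ s\<close> of \<open>m\<close> and
  \<open>n\<close> it is evaluated by stationary phase when \<open>k - s \<ge> 2\<close>, and as a Salie, Gauss or Ramanujan sum when
  \<open>k - s = 1\<close>. The only case that would need Weil's bound has \<open>k\<close> even and \<open>s = k - 1\<close> equal to the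
  exponent of \<open>p\<close> in \<open>m = m\<^sub>0 v\<^sup>2\<close>; then \<open>p\<close> divides \<open>m\<^sub>0\<close> and the trivial bound suffices.

  If all primes dividing \<open>c\<close> divide \<open>\<Delta>\<close>, write \<open>c = e s\<^sup>2\<close> with \<open>e\<close> squarefree, hence \<open>e dvd \<Delta>\<close>. Moving
  \<open>d\<close> multiplicatively by \<open>1 + 2 J\<close> with \<open>J = 2 \<Delta> e s y\<close> and averaging over \<open>y\<close> restricts the sum to
  \<open>2 (n d\<^sup>2 - m) \<equiv> 0\<close> modulo \<open>s\<close>. As \<open>m\<close> is almost prime to \<open>s\<close>, a bounded number of residues modulo
  \<open>s\<close> survives, and each lattice sum is at most \<open>sqrt (\<bar>\<Delta>\<bar> c) ^ g\<close>.
\<close>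


section \<open>Additive characters and quadratic Gauss sums\<close>

text \<open>The lattice sums have size about c^(g / 2), which the normalisation of the Weil
  coefficients absorbs, so all the saving must come from the sum over d. For odd g the character of
  a has exponent k instead of being trivial: this makes the remaining sum for odd k = s + 1 a Salie
  sum, which is explicit, while for even k = s + 1 a true Kloosterman sum modulo p could remain; the
  square v^2 inside m is what excludes it. At primes dividing \<Delta>, among them 2, no
  diagonalisation is available, yet their exponents in c are unbounded. There the lattice sum is
  only bounded in modulus, and moving d alone must give the factor c^(1/2) with a constant depending
  on \<Delta>. The coprimality of v and \<Delta> serves here: it keeps gcd(s, 2 m) below 8
  |\<Delta>|. Splitting c by the Chinese remainder theorem multiplies the phase by units. They are
  carried as a twist w, in which every local bound is uniform, so that \<alpha>, \<beta>, m and n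
  stay fixed. Each prime not dividing \<Delta> costs a factor 2, and these factors make up
  2^omega(c).\<close>

definition ee :: "rat \<Rightarrow> complex" where
  "ee x = cis (2 * pi * of_rat x)"

lemma ee_add: "ee (x + y) = ee x * ee y"
  by (simp add: ee_def of_rat_add cis_mult ring_distribs)

lemma ee_0 [simp]: "ee 0 = 1"
  by (simp add: ee_def)

lemma norm_ee [simp]: "norm (ee x) = 1"
  by (simp add: ee_def)

lemma cnj_ee: "cnj (ee x) = ee (- x)"
  by (simp add: ee_def of_rat_minus cis_cnj)

lemma ee_eq_1_iff: "ee x = 1 \<longleftrightarrow> x \<in> \<int>"
proof
  assume "ee x = 1"
  then have "cos (2 * pi * of_rat x) = 1"
    by (simp add: ee_def complex_eq_iff)
  then obtain n :: int where "2 * pi * of_rat x = of_int n * 2 * pi"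
    by (auto simp: cos_one_2pi_int)
  then have "(of_rat x :: real) = of_rat (of_int n)"
    by simp
  then have "x = of_int n"
    by (simp only: of_rat_eq_iff)
  then show "x \<in> \<int>" by simp
next
  assume "x \<in> \<int>"
  then obtain n :: int where "x = of_int n" by (auto elim: Ints_cases)
  then show "ee x = 1" by (simp add: ee_def cis_multiple_2pi)
qed

lemma ee_cong: "x - y \<in> \<int> \<Longrightarrow> ee x = ee y"
  using ee_add[of "x - y" y] ee_eq_1_iff[of "x - y"] by simp

lemma ee_sum: "finite I \<Longrightarrow> ee (\<Sum>i\<in>I. f i) = (\<Prod>i\<in>I. ee (f i))"
  by (induction I rule: finite_induct) (simp_all add: ee_add)

text \<open>Phases are rational numbers, so \<open>cong\<close> does not apply to them. This is its
  replacement: only the difference has to be an integral multiple of \<open>c\<close>, and each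
  application exhibits the cofactor \<open>z\<close>.\<close>

lemma ee_scaled_cong:
  assumes "c \<noteq> 0" "x - y = of_int c * z" "z \<in> \<int>"
  shows "ee (of_int w * x / of_int c) = ee (of_int w * y / of_int c)"
proof (rule ee_cong)
  have "of_int w * x / of_int c - of_int w * y / of_int c = of_int w * (x - y) / of_int c"
    by (simp add: diff_divide_distrib right_diff_distrib)
  also have "\<dots> = of_int w * z"
    using assms by simp
  also have "\<dots> \<in> \<int>"
    using assms by (intro Ints_mult) auto
  finally show "of_int w * x / of_int c - of_int w * y / of_int c \<in> \<int>" .
qed

definition ec :: "int \<Rightarrow> int \<Rightarrow> complex" where
  "ec c x = ee (of_int x / of_int c)"

lemma ec_add: "ec c (x + y) = ec c x * ec c y"
  by (simp add: ec_def add_divide_distrib ee_add)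

lemma ec_0 [simp]: "ec c 0 = 1"
  by (simp add: ec_def)

lemma norm_ec [simp]: "norm (ec c x) = 1"
  by (simp add: ec_def)

lemma cnj_ec: "cnj (ec c x) = ec c (- x)"
  by (simp add: ec_def cnj_ee)

lemma ec_cong:
  assumes "[x = y] (mod c)"
  shows "ec c x = ec c y"
proof (cases "c = 0")
  case False
  from assms obtain k where "x - y = c * k"
    by (auto simp: cong_iff_dvd_diff)
  then have "(of_int x / of_int c - of_int y / of_int c :: rat) = of_int k"
    using False by (simp add: field_simps flip: of_int_mult of_int_diff)
  then show ?thesis
    unfolding ec_def by (intro ee_cong) simp
qed (use assms in \<open>simp add: cong_0\<close>)

lemma ec_eq_1_iff: "c \<noteq> 0 \<Longrightarrow> ec c x = 1 \<longleftrightarrow> c dvd x"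
  unfolding ec_def ee_eq_1_iff
proof
  assume "c \<noteq> 0" "(of_int x / of_int c :: rat) \<in> \<int>"
  then obtain k :: int where "(of_int x / of_int c :: rat) = of_int k"
    by (auto elim: Ints_cases)
  with \<open>c \<noteq> 0\<close> have "(of_int x :: rat) = of_int (c * k)"
    by (simp add: field_simps)
  then show "c dvd x"
    by (simp only: of_int_eq_iff dvd_triv_left)
qed (auto elim!: dvdE)

lemma ec_mult_cancel: "k \<noteq> 0 \<Longrightarrow> ec (k * c) (k * x) = ec c x"
  by (simp add: ec_def)

text \<open>By counting, injectivity modulo \<open>c\<close> on an index set of \<open>c\<close>
  elements already gives a complete residue system. Shifts, multiplication by units and expansions s
  + A z are all instances.\<close>

lemma sum_residues_reindex:
  fixes f :: "int \<Rightarrow> 'b :: comm_monoid_add" and \<psi> :: "'a \<Rightarrow> int"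
  assumes "c > 0" and per: "\<And>x y. [x = y] (mod c) \<Longrightarrow> f x = f y"
    and X: "finite X" "card X = nat c"
    and inj: "\<And>x y. x \<in> X \<Longrightarrow> y \<in> X \<Longrightarrow> [\<psi> x = \<psi> y] (mod c) \<Longrightarrow> x = y"
  shows "(\<Sum>x\<in>X. f (\<psi> x)) = (\<Sum>y\<in>{0..<c}. f y)"
proof -
  have inj': "inj_on (\<lambda>x. \<psi> x mod c) X"
    using inj by (auto simp: inj_on_def cong_def)
  moreover have "(\<lambda>x. \<psi> x mod c) ` X = {0..<c}"
    using \<open>c > 0\<close> X card_image[OF inj'] by (intro card_subset_eq) auto
  ultimately have "bij_betw (\<lambda>x. \<psi> x mod c) X {0..<c}"
    by (simp add: bij_betw_def)
  then have "(\<Sum>x\<in>X. f (\<psi> x mod c)) = (\<Sum>y\<in>{0..<c}. f y)"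
    by (rule sum.reindex_bij_betw)
  also have "(\<Sum>x\<in>X. f (\<psi> x mod c)) = (\<Sum>x\<in>X. f (\<psi> x))"
    by (intro sum.cong per) (auto simp: cong_def)
  finally show ?thesis by simp
qed

lemma sum_residues_shift:
  fixes f :: "int \<Rightarrow> 'b :: comm_monoid_add"
  assumes "c > 0" "\<And>x y. [x = y] (mod c) \<Longrightarrow> f x = f y"
  shows "(\<Sum>y\<in>{0..<c}. f (y + h)) = (\<Sum>y\<in>{0..<c}. f y)"
proof (rule sum_residues_reindex)
  fix x y assume "x \<in> {0..<c}" "y \<in> {0..<c}" "[x + h = y + h] (mod c)"
  then show "x = y"
    by (simp add: cong_add_rcancel) (simp add: cong_def)
qed (use assms in auto)

lemma sum_residues_scale:
  fixes f :: "int \<Rightarrow> 'b :: comm_monoid_add"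
  assumes "c > 0" "\<And>x y. [x = y] (mod c) \<Longrightarrow> f x = f y" "coprime u c"
  shows "(\<Sum>y\<in>{0..<c}. f (u * y)) = (\<Sum>y\<in>{0..<c}. f y)"
proof (rule sum_residues_reindex)
  fix x y assume "x \<in> {0..<c}" "y \<in> {0..<c}" "[u * x = u * y] (mod c)"
  then show "x = y"
    using cong_mult_lcancel[OF assms(3), of x y] by (auto simp: cong_def)
qed (use assms in auto)

lemma sum_ec_linear:
  assumes "c > 0"
  shows "(\<Sum>y\<in>{0..<c}. ec c (h * y)) = (if c dvd h then of_int c else 0)"
proof (cases "c dvd h")
  case True
  have "(\<Sum>y\<in>{0..<c}. ec c (h * y)) = (\<Sum>y\<in>{0..<c}. 1)"
    using assms True by (intro sum.cong) (auto simp: ec_eq_1_iff)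
  then show ?thesis using True assms by simp
next
  case False
  have "(\<Sum>y\<in>{0..<c}. ec c (h * (y + 1))) = (\<Sum>y\<in>{0..<c}. ec c (h * y))"
    using assms by (intro sum_residues_shift ec_cong cong_scalar_left)
  then have "ec c h * (\<Sum>y\<in>{0..<c}. ec c (h * y)) = (\<Sum>y\<in>{0..<c}. ec c (h * y))"
    by (simp add: ring_distribs ec_add sum_distrib_left mult.commute)
  moreover have "ec c h \<noteq> 1"
    using False assms by (simp add: ec_eq_1_iff)
  ultimately show ?thesis
    using False by simp
qed

section \<open>Quadratic Gauss sums to a general modulus\<close>

definition gauss :: "int \<Rightarrow> int \<Rightarrow> int \<Rightarrow> complex" where
  "gauss c x y = (\<Sum>t\<in>{0..<c}. ec c (x * t\<^sup>2 + y * t))"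

lemma cong_quadratic: "[t = t'] (mod c) \<Longrightarrow> [x * t\<^sup>2 + y * t = x * t'\<^sup>2 + y * t'] (mod c)" for c :: int
  by (intro cong_add cong_mult cong_pow cong_refl)

lemma gauss_cong:
  assumes "[x = x'] (mod c)" "[y = y'] (mod c)"
  shows "gauss c x y = gauss c x' y'"
  unfolding gauss_def
  by (rule sum.cong[OF refl]) (intro ec_cong cong_add cong_mult assms cong_refl)

text \<open>In the double sum for the squared modulus put t = h + s: the exponent becomes linear in
  s with coefficient 2 x h. As 2 x is a unit modulo the odd number \<open>c\<close>, only h = 0
  survives.\<close>

lemma norm_gauss:
  assumes "c > 0" "odd c" "coprime x c"
  shows "norm (gauss c x y) = sqrt (of_int c)"
proof -
  have "of_real ((norm (gauss c x y))\<^sup>2) = gauss c x y * cnj (gauss c x y)"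
    by (rule complex_norm_square)
  also have "\<dots> = (\<Sum>s\<in>{0..<c}. \<Sum>t\<in>{0..<c}. ec c (x * t\<^sup>2 + y * t) * ec c (- (x * s\<^sup>2 + y * s)))"
    by (subst sum.swap) (simp add: gauss_def cnj_ec sum_product cnj_sum)
  also have "\<dots> = (\<Sum>s\<in>{0..<c}. \<Sum>h\<in>{0..<c}. ec c (x * (h + s)\<^sup>2 + y * (h + s)) * ec c (- (x * s\<^sup>2 + y * s)))"
  proof (rule sum.cong[OF refl])
    fix s
    show "(\<Sum>t\<in>{0..<c}. ec c (x * t\<^sup>2 + y * t) * ec c (- (x * s\<^sup>2 + y * s))) =
        (\<Sum>h\<in>{0..<c}. ec c (x * (h + s)\<^sup>2 + y * (h + s)) * ec c (- (x * s\<^sup>2 + y * s)))"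
      using assms(1) ec_cong[OF cong_quadratic]
      by (subst sum_residues_shift[where h = s and f = "\<lambda>t. ec c (x * t\<^sup>2 + y * t) * ec c (- (x * s\<^sup>2 + y * s))"]) auto
  qed
  also have "\<dots> = (\<Sum>s\<in>{0..<c}. \<Sum>h\<in>{0..<c}. ec c (x * h\<^sup>2 + y * h) * ec c ((2 * x * h) * s))"
    by (intro sum.cong refl) (simp add: algebra_simps power2_eq_square flip: ec_add)
  also have "\<dots> = (\<Sum>h\<in>{0..<c}. ec c (x * h\<^sup>2 + y * h) * (\<Sum>s\<in>{0..<c}. ec c ((2 * x * h) * s)))"
    by (subst sum.swap) (simp add: sum_distrib_left)
  also have "\<dots> = (\<Sum>h\<in>{0..<c}. if h = 0 then of_int c else 0)"
  proof (intro sum.cong refl)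
    fix h assume h: "h \<in> {0..<c}"
    have "coprime (2 * x) c"
      using assms by (simp add: coprime_commute)
    then have "c dvd 2 * x * h \<longleftrightarrow> c dvd h"
      by (simp add: coprime_commute coprime_dvd_mult_right_iff)
    also have "\<dots> \<longleftrightarrow> h = 0"
      using h by (auto dest: zdvd_imp_le)
    finally show "ec c (x * h\<^sup>2 + y * h) * (\<Sum>s\<in>{0..<c}. ec c ((2 * x * h) * s)) = (if h = 0 then of_int c else 0)"
      using assms(1) by (subst sum_ec_linear) auto
  qed
  also have "\<dots> = of_real (of_int c)"
    using assms(1) by simp
  finally have "(norm (gauss c x y))\<^sup>2 = of_int c"
    by (simp only: of_real_eq_iff)
  then show ?thesis
    using real_sqrt_unique[of "norm (gauss c x y)" "of_int c"] by simp
qed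

lemma gauss_complete_square:
  assumes "c > 0" "[4 * x * z = 1] (mod c)"
  shows "gauss c x y = ec c (- (z * y\<^sup>2)) * gauss c x 0"
proof -
  \<comment> \<open>Since \<open>z\<close> inverts 4 x, the shift by 2 z y is the usual y / (2 x) of
    completing the square; it leaves the constant term z y^2.\<close>
  have "gauss c x 0 = (\<Sum>t\<in>{0..<c}. ec c (x * (t + 2 * z * y)\<^sup>2 + 0 * (t + 2 * z * y)))"
    unfolding gauss_def using assms(1)
    by (intro sum_residues_shift[where f = "\<lambda>t. ec c (x * t\<^sup>2 + 0 * t)", symmetric] ec_cong cong_quadratic)
  also have "\<dots> = (\<Sum>t\<in>{0..<c}. ec c (z * y\<^sup>2) * ec c (x * t\<^sup>2 + y * t))"
  proof (intro sum.cong refl)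
    fix t
    have "[(4 * x * z) * (y * t + z * y\<^sup>2) + x * t\<^sup>2 = 1 * (y * t + z * y\<^sup>2) + x * t\<^sup>2] (mod c)"
      using assms(2) by (intro cong_add cong_mult cong_refl)
    also have "(4 * x * z) * (y * t + z * y\<^sup>2) + x * t\<^sup>2 = x * (t + 2 * z * y)\<^sup>2"
      by (simp add: power2_eq_square algebra_simps)
    also have "1 * (y * t + z * y\<^sup>2) + x * t\<^sup>2 = z * y\<^sup>2 + (x * t\<^sup>2 + y * t)"
      by simp
    finally have "ec c (x * (t + 2 * z * y)\<^sup>2) = ec c (z * y\<^sup>2 + (x * t\<^sup>2 + y * t))"
      by (rule ec_cong)
    then show "ec c (x * (t + 2 * z * y)\<^sup>2 + 0 * (t + 2 * z * y)) = ec c (z * y\<^sup>2) * ec c (x * t\<^sup>2 + y * t)"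
      by (simp add: ec_add)
  qed
  also have "\<dots> = ec c (z * y\<^sup>2) * gauss c x y"
    by (simp add: gauss_def sum_distrib_left)
  finally have "ec c (- (z * y\<^sup>2)) * gauss c x 0 = (ec c (- (z * y\<^sup>2)) * ec c (z * y\<^sup>2)) * gauss c x y"
    by simp
  then show ?thesis
    by (simp flip: ec_add)
qed

lemma gauss_square:
  assumes "c > 0" "coprime u c"
  shows "gauss c (x * u\<^sup>2) 0 = gauss c x 0"
proof -
  have "gauss c x 0 = (\<Sum>t\<in>{0..<c}. ec c (x * (u * t)\<^sup>2 + 0 * (u * t)))"
    unfolding gauss_def using assms by (intro sum_residues_scale[where f = "\<lambda>t. ec c (x * t\<^sup>2 + 0 * t)", symmetric] ec_cong cong_quadratic)
  then show ?thesis
    by (simp add: gauss_def power_mult_distrib mult.assoc)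
qed

section \<open>Sums over pairs of inverse residues\<close>

text \<open>The inverse \<open>a\<close> is stored along with \<open>d\<close>, so that sums in both
  variables can be permuted, swapped and split without choosing inverses. For \<open>c = 1\<close>
  the only pair is (0, 0).\<close>

definition unit_pairs :: "int \<Rightarrow> (int \<times> int) set" where
  "unit_pairs c = {(d, a). d \<in> {0..<c} \<and> a \<in> {0..<c} \<and> [a * d = 1] (mod c)}"

lemma finite_unit_pairs [simp]: "finite (unit_pairs c)"
  by (rule finite_subset[of _ "{0..<c} \<times> {0..<c}"]) (auto simp: unit_pairs_def)

lemma unit_pairs_mod:
  "c > 0 \<Longrightarrow> [a * d = 1] (mod c) \<Longrightarrow> (d mod c, a mod c) \<in> unit_pairs c"
  by (auto simp: unit_pairs_def cong_def mod_mult_eq)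

lemma cong_inverse_unique:
  fixes a a' d c :: int
  assumes "[a * d = 1] (mod c)" "[a' * d' = 1] (mod c)" "[d = d'] (mod c)"
  shows "[a = a'] (mod c)"
proof -
  have "[a * d' = 1] (mod c)"
    using assms by (metis cong_scalar_left cong_sym cong_trans)
  then have "[(a * d') * a' = 1 * a'] (mod c)"
    by (intro cong_mult cong_refl)
  moreover have "[a * (a' * d') = a * 1] (mod c)"
    using assms by (intro cong_mult cong_refl)
  ultimately show ?thesis
    by (simp add: ac_simps) (metis cong_sym cong_trans)
qed

lemma coprime_of_cong_inverse:
  fixes a d c :: int
  assumes "[a * d = 1] (mod c)"
  shows "coprime a c" "coprime d c"
  using assms by (auto simp: coprime_iff_invertible_int cong_sym_eq mult.commute)

lemma inj_on_fst_unit_pairs: "inj_on fst (unit_pairs c)"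
proof (rule inj_onI, clarsimp)
  fix d a a' assume "(d, a) \<in> unit_pairs c" "(d, a') \<in> unit_pairs c"
  then show "a = a'"
    using cong_inverse_unique[of a d c a' d] by (auto simp: unit_pairs_def cong_def)
qed

lemma card_unit_pairs_le: "c > 0 \<Longrightarrow> card (unit_pairs c) \<le> nat c"
proof -
  assume "c > 0"
  have "fst ` unit_pairs c \<subseteq> {0..<c}"
    by (auto simp: unit_pairs_def)
  then have "card (unit_pairs c) \<le> card {0..<c}"
    by (intro card_inj_on_le[OF inj_on_fst_unit_pairs]) auto
  then show ?thesis by simp
qed

lemma unit_pairs_scale:
  fixes F :: "int \<Rightarrow> int \<Rightarrow> 'b :: comm_monoid_add"
  assumes "c > 0" and u: "[u' * u = 1] (mod c)"
    and per: "\<And>d d' a a'. [d = d'] (mod c) \<Longrightarrow> [a = a'] (mod c) \<Longrightarrow> F d a = F d' a'"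
  shows "(\<Sum>(d, a)\<in>unit_pairs c. F (d * u) (a * u')) = (\<Sum>(d, a)\<in>unit_pairs c. F d a)"
proof (rule sum.reindex_bij_witness
    [of _ "\<lambda>(d, a). (d * u' mod c, a * u mod c)" "\<lambda>(d, a). (d * u mod c, a * u' mod c)"])
  have *: "x * u * u' mod c = x mod c" for x
    using cong_mult[OF cong_refl u, of x] by (simp add: cong_def ac_simps)
  have **: "[a * u * (d * u') = 1] (mod c)" if "[a * d = 1] (mod c)" for a d
    using cong_mult[OF that u] by (simp add: ac_simps)
  fix z :: "int \<times> int"
  obtain d a where z: "z = (d, a)" by fastforce
  assume z': "z \<in> unit_pairs c"
  then have da: "[a * d = 1] (mod c)" "d mod c = d" "a mod c = a"
    by (auto simp: z unit_pairs_def)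
  show "(case case z of (d, a) \<Rightarrow> (d * u mod c, a * u' mod c) of (d, a) \<Rightarrow> (d * u' mod c, a * u mod c)) = z"
    using da *[of d] *[of a] by (simp add: z mod_mult_left_eq mod_mult_right_eq ac_simps)
  show "(case case z of (d, a) \<Rightarrow> (d * u' mod c, a * u mod c) of (d, a) \<Rightarrow> (d * u mod c, a * u' mod c)) = z"
    using da *[of d] *[of a] by (simp add: z mod_mult_left_eq mod_mult_right_eq ac_simps)
  show "(case z of (d, a) \<Rightarrow> (d * u mod c, a * u' mod c)) \<in> unit_pairs c"
    using **[of d a] da(1) by (simp add: z, intro unit_pairs_mod \<open>c > 0\<close>) (simp add: ac_simps)
  show "(case z of (d, a) \<Rightarrow> (d * u' mod c, a * u mod c)) \<in> unit_pairs c"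
    using **[of a d] da(1) by (simp add: z, intro unit_pairs_mod \<open>c > 0\<close>) (simp add: ac_simps)
  show "(case case z of (d, a) \<Rightarrow> (d * u mod c, a * u' mod c) of (d, a) \<Rightarrow> F d a) =
      (case z of (d, a) \<Rightarrow> F (d * u) (a * u'))"
    by (auto simp: z cong_def intro!: per)
qed

lemma unit_pairs_swap:
  "(\<Sum>(d, a)\<in>unit_pairs c. F a d) = (\<Sum>(d, a)\<in>unit_pairs c. F d a)"
  by (rule sum.reindex_bij_witness[of _ prod.swap prod.swap]) (auto simp: unit_pairs_def mult.commute)

lemma cong_modulus_mult_iff:
  fixes x y c1 c2 :: int
  assumes "coprime c1 c2"
  shows "[x = y] (mod c1 * c2) \<longleftrightarrow> [x = y] (mod c1) \<and> [x = y] (mod c2)"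
  using assms by (auto simp: cong_iff_dvd_diff intro: divides_mult dvd_mult_left dvd_mult_right)

lemma unit_pairs_crt:
  fixes F G :: "int \<Rightarrow> int \<Rightarrow> 'b :: comm_semiring_1"
  assumes "c1 > 0" "c2 > 0" and cop: "coprime c1 c2"
    and F: "\<And>d d' a a'. [d = d'] (mod c1) \<Longrightarrow> [a = a'] (mod c1) \<Longrightarrow> F d a = F d' a'"
    and G: "\<And>d d' a a'. [d = d'] (mod c2) \<Longrightarrow> [a = a'] (mod c2) \<Longrightarrow> G d a = G d' a'"
  shows "(\<Sum>(d, a)\<in>unit_pairs (c1 * c2). F d a * G d a) =
    (\<Sum>(d, a)\<in>unit_pairs c1. F d a) * (\<Sum>(d, a)\<in>unit_pairs c2. G d a)"
proof -
  define \<pi> where "\<pi> = (\<lambda>(d, a). ((d mod c1, a mod c1), (d mod c2, a mod c2)))"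
  have "bij_betw \<pi> (unit_pairs (c1 * c2)) (unit_pairs c1 \<times> unit_pairs c2)"
    unfolding bij_betw_def
  proof
    show "inj_on \<pi> (unit_pairs (c1 * c2))"
    proof (rule inj_onI, clarify)
      fix d a d' a' assume *: "(d, a) \<in> unit_pairs (c1 * c2)" "(d', a') \<in> unit_pairs (c1 * c2)"
        and "\<pi> (d, a) = \<pi> (d', a')"
      then have "[d = d'] (mod c1)" "[d = d'] (mod c2)" "[a = a'] (mod c1)" "[a = a'] (mod c2)"
        by (auto simp: \<pi>_def cong_def)
      then have "[d = d'] (mod c1 * c2)" "[a = a'] (mod c1 * c2)"
        by (simp_all add: cong_modulus_mult_iff[OF cop])
      then show "d = d' \<and> a = a'"
        using * by (auto simp: unit_pairs_def cong_def)
    qed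
    show "\<pi> ` unit_pairs (c1 * c2) = unit_pairs c1 \<times> unit_pairs c2"
    proof
      show "\<pi> ` unit_pairs (c1 * c2) \<subseteq> unit_pairs c1 \<times> unit_pairs c2"
      proof clarify
        fix x1 x2 y1 y2 d a assume *: "((x1, x2), (y1, y2)) = \<pi> (d, a)" "(d, a) \<in> unit_pairs (c1 * c2)"
        then have "[a * d = 1] (mod c1)" "[a * d = 1] (mod c2)"
          by (auto simp: unit_pairs_def cong_modulus_mult_iff[OF cop])
        then show "(x1, x2) \<in> unit_pairs c1 \<and> (y1, y2) \<in> unit_pairs c2"
          using * assms(1,2) unit_pairs_mod by (auto simp: \<pi>_def)
      qed
      show "unit_pairs c1 \<times> unit_pairs c2 \<subseteq> \<pi> ` unit_pairs (c1 * c2)"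
      proof clarify
        fix d1 a1 d2 a2 assume *: "(d1, a1) \<in> unit_pairs c1" "(d2, a2) \<in> unit_pairs c2"
        obtain d where d: "[d = d1] (mod c1)" "[d = d2] (mod c2)"
          using binary_chinese_remainder_int[OF cop] by blast
        obtain a where a: "[a = a1] (mod c1)" "[a = a2] (mod c2)"
          using binary_chinese_remainder_int[OF cop] by blast
        have "[a * d = a1 * d1] (mod c1)" "[a * d = a2 * d2] (mod c2)"
          using a d by (auto intro: cong_mult)
        moreover have "[a1 * d1 = 1] (mod c1)" "[a2 * d2 = 1] (mod c2)"
          using * by (auto simp: unit_pairs_def)
        ultimately have "[a * d = 1] (mod c1 * c2)"
          by (simp add: cong_modulus_mult_iff[OF cop]) (metis cong_trans)
        then have "(d mod (c1 * c2), a mod (c1 * c2)) \<in> unit_pairs (c1 * c2)"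
          using assms(1,2) by (intro unit_pairs_mod) auto
        moreover have "\<pi> (d mod (c1 * c2), a mod (c1 * c2)) = ((d1, a1), (d2, a2))"
          using a d * by (simp add: \<pi>_def unit_pairs_def cong_def mod_mod_cancel)
        ultimately show "((d1, a1), (d2, a2)) \<in> \<pi> ` unit_pairs (c1 * c2)"
          by (metis image_eqI)
      qed
    qed
  qed
  then have "(\<Sum>z\<in>unit_pairs (c1 * c2). (\<lambda>((d, a), (d', a')). F d a * G d' a') (\<pi> z)) =
      (\<Sum>((d, a), (d', a'))\<in>unit_pairs c1 \<times> unit_pairs c2. F d a * G d' a')"
    by (rule sum.reindex_bij_betw)
  also have "(\<Sum>z\<in>unit_pairs (c1 * c2). (\<lambda>((d, a), (d', a')). F d a * G d' a') (\<pi> z)) =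
      (\<Sum>(d, a)\<in>unit_pairs (c1 * c2). F d a * G d a)"
  proof (rule sum.cong[OF refl])
    fix z :: "int \<times> int"
    obtain d a where z: "z = (d, a)" by fastforce
    have "F (d mod c1) (a mod c1) = F d a" "G (d mod c2) (a mod c2) = G d a"
      by (auto intro!: F G simp: cong_def)
    then show "(\<lambda>((d, a), (d', a')). F d a * G d' a') (\<pi> z) = (case z of (d, a) \<Rightarrow> F d a * G d a)"
      by (simp add: \<pi>_def z)
  qed
  also have "(\<Sum>((d, a), (d', a'))\<in>unit_pairs c1 \<times> unit_pairs c2. F d a * G d' a') =
      (\<Sum>(d, a)\<in>unit_pairs c1. F d a) * (\<Sum>(d, a)\<in>unit_pairs c2. G d a)"
    by (simp add: sum_product sum.cartesian_product case_prod_unfold)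
  finally show ?thesis .
qed

lemma coprime_prime_power_iff:
  fixes p d :: int
  assumes "prime p" "k > 0"
  shows "coprime d (p ^ k) \<longleftrightarrow> \<not> p dvd d"
proof -
  have "coprime d p \<longleftrightarrow> \<not> p dvd d"
    using coprime_common_divisor[of d p p] prime_imp_coprime[OF \<open>prime p\<close>, of d] \<open>prime p\<close>
    by (auto simp: coprime_commute)
  then show ?thesis
    using \<open>k > 0\<close> by (simp add: coprime_power_right_iff)
qed

text \<open>Every unit modulo p has p ^ (k - 1) lifts, labelled by \<open>d div p\<close>; the
  second component gets no label of its own since the first determines it.\<close>

lemma unit_pairs_prime_power:
  fixes F :: "int \<Rightarrow> int \<Rightarrow> complex"
  assumes p: "prime p" and k: "k > 0"
    and per: "\<And>d d' a a'. [d = d'] (mod p) \<Longrightarrow> [a = a'] (mod p) \<Longrightarrow> F d a = F d' a'"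
  shows "(\<Sum>(d, a)\<in>unit_pairs (p ^ k). F d a) = of_int (p ^ (k - 1)) * (\<Sum>(d, a)\<in>unit_pairs p. F d a)"
proof -
  have p0: "p > 0" using p by (simp add: prime_gt_0_int)
  have pk: "p ^ k = p * p ^ (k - 1)" using k by (cases k) auto
  define \<pi> where "\<pi> = (\<lambda>(d, a). ((d mod p, a mod p), d div p))"
  have "bij_betw \<pi> (unit_pairs (p ^ k)) (unit_pairs p \<times> {0..<p ^ (k - 1)})"
    unfolding bij_betw_def
  proof
    show "inj_on \<pi> (unit_pairs (p ^ k))"
    proof (rule inj_onI, clarify)
      fix d a d' a' assume *: "(d, a) \<in> unit_pairs (p ^ k)" "(d', a') \<in> unit_pairs (p ^ k)"
        and "\<pi> (d, a) = \<pi> (d', a')"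
      then have "d = d'"
        by (auto simp: \<pi>_def) (metis mult_div_mod_eq)
      then show "d = d' \<and> a = a'"
        using * inj_onD[OF inj_on_fst_unit_pairs, of "(d, a)" "(d', a')"] by auto
    qed
    show "\<pi> ` unit_pairs (p ^ k) = unit_pairs p \<times> {0..<p ^ (k - 1)}"
    proof
      show "\<pi> ` unit_pairs (p ^ k) \<subseteq> unit_pairs p \<times> {0..<p ^ (k - 1)}"
      proof clarify
        fix x1 x2 y d a assume *: "((x1, x2), y) = \<pi> (d, a)" "(d, a) \<in> unit_pairs (p ^ k)"
        then have "[a * d = 1] (mod p)"
          using cong_modulus_mult[of "a * d" 1 p "p ^ (k - 1)"] by (auto simp: unit_pairs_def pk)
        moreover have d: "0 \<le> d" "d < p * p ^ (k - 1)"
          using * pk by (auto simp: unit_pairs_def)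
        then have "p * (d div p) < p * p ^ (k - 1)"
          using mult_div_mod_eq[of p d] pos_mod_sign[OF p0, of d] by linarith
        then have "d div p < p ^ (k - 1)" "0 \<le> d div p"
          using p0 d by (simp_all add: pos_imp_zdiv_nonneg_iff)
        ultimately show "(x1, x2) \<in> unit_pairs p \<and> y \<in> {0..<p ^ (k - 1)}" 
          using * unit_pairs_mod[OF p0] by (auto simp: \<pi>_def)
      qed
      show "unit_pairs p \<times> {0..<p ^ (k - 1)} \<subseteq> \<pi> ` unit_pairs (p ^ k)"
      proof clarify
        fix d0 a0 z assume *: "(d0, a0) \<in> unit_pairs p" "z \<in> {0..<p ^ (k - 1)}"
        define d where "d = d0 + p * z"
        have "coprime d0 p"
          using * coprime_of_cong_inverse by (auto simp: unit_pairs_def)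
        moreover have "[d0 = d] (mod p)"
          by (simp add: d_def cong_def)
        ultimately have "coprime d (p ^ k)"
          using cong_imp_coprime by auto
        then obtain a where a: "[d * a = 1] (mod p ^ k)"
          using cong_solve_coprime_int by blast
        have d_eq: "d mod p = d0" "d div p = z"
          using * p0 by (auto simp: d_def unit_pairs_def)
        have dlt: "d \<in> {0..<p ^ k}"
        proof -
          have "d0 + p * z < p + p * z" using * by (auto simp: unit_pairs_def)
          also have "p + p * z = p * (z + 1)" by (simp add: algebra_simps)
          also have "\<dots> \<le> p * p ^ (k - 1)" using * p0 by (intro mult_left_mono) auto
          finally show ?thesis using * p0 by (auto simp: d_def pk unit_pairs_def)
        qed
        have "[d * a = 1] (mod p)"
          using a cong_modulus_mult[of "d * a" 1 p "p ^ (k - 1)"] by (simp add: pk)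
        then have "[a = a0] (mod p)"
          using * d_eq by (intro cong_inverse_unique[of a d p a0 d0]) (auto simp: unit_pairs_def mult.commute cong_def)
        then have "a mod p = a0"
          using * by (simp add: cong_def unit_pairs_def)
        moreover have "a mod p ^ k mod p = a mod p"
          using k by (intro mod_mod_cancel) auto
        moreover have "d mod p ^ k = d" using dlt by simp
        moreover have "(d mod p ^ k, a mod p ^ k) \<in> unit_pairs (p ^ k)"
          using a p0 by (intro unit_pairs_mod) (auto simp: mult.commute)
        ultimately show "((d0, a0), z) \<in> \<pi> ` unit_pairs (p ^ k)"
          using d_eq by (intro image_eqI[of _ _ "(d, a mod p ^ k)"]) (auto simp: \<pi>_def)
      qed
    qed
  qed
  then have "(\<Sum>z\<in>unit_pairs (p ^ k). (\<lambda>((d, a), _). F d a) (\<pi> z)) =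
      (\<Sum>((d, a), _)\<in>unit_pairs p \<times> {0..<p ^ (k - 1)}. F d a)"
    by (rule sum.reindex_bij_betw)
  also have "(\<Sum>z\<in>unit_pairs (p ^ k). (\<lambda>((d, a), _). F d a) (\<pi> z)) =
      (\<Sum>(d, a)\<in>unit_pairs (p ^ k). F d a)"
  proof (rule sum.cong[OF refl])
    fix z :: "int \<times> int"
    obtain d a where z: "z = (d, a)" by fastforce
    have "F (d mod p) (a mod p) = F d a"
      by (auto intro!: per simp: cong_def)
    then show "(\<lambda>((d, a), _). F d a) (\<pi> z) = (case z of (d, a) \<Rightarrow> F d a)"
      by (simp add: \<pi>_def z)
  qed
  also have "(\<Sum>((d, a), _)\<in>unit_pairs p \<times> {0..<p ^ (k - 1)}. F d a) =
      (\<Sum>(d, a)\<in>unit_pairs p. of_int (p ^ (k - 1)) * F d a)"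
    using p0 by (subst sum.cartesian_product[symmetric]) (simp add: case_prod_unfold)
  finally show ?thesis
    by (simp add: sum_distrib_left case_prod_unfold)
qed

lemma sum_totatives_eq_unit_pairs:
  fixes F :: "int \<Rightarrow> int \<Rightarrow> complex"
  assumes c: "c > 0"
    and per: "\<And>d d' a a'. [d = d'] (mod int c) \<Longrightarrow> [a = a'] (mod int c) \<Longrightarrow> F d a = F d' a'"
    and A: "\<And>d. d \<in> totatives c \<Longrightarrow> [A d * int d = 1] (mod int c)"
  shows "(\<Sum>d\<in>totatives c. F (int d) (A d)) = (\<Sum>(d, a)\<in>unit_pairs (int c). F d a)"
proof -
  define \<pi> where "\<pi> = (\<lambda>d. (int d mod int c, A d mod int c))"
  have "bij_betw \<pi> (totatives c) (unit_pairs (int c))"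
    unfolding bij_betw_def
  proof
    show "inj_on \<pi> (totatives c)"
    proof (rule inj_onI)
      fix d d' assume *: "d \<in> totatives c" "d' \<in> totatives c" "\<pi> d = \<pi> d'"
      then have "d mod c = d' mod c"
        by (simp add: \<pi>_def flip: zmod_int)
      moreover have "0 < d" "d \<le> c" "0 < d'" "d' \<le> c"
        using * by (auto simp: totatives_def)
      ultimately show "d = d'"
        by (metis le_neq_implies_less mod_less mod_self not_gr_zero)
    qed
    show "\<pi> ` totatives c = unit_pairs (int c)"
    proof
      show "\<pi> ` totatives c \<subseteq> unit_pairs (int c)"
        using A c by (auto simp: \<pi>_def intro!: unit_pairs_mod)
      show "unit_pairs (int c) \<subseteq> \<pi> ` totatives c"
      proof clarify
        fix d a assume *: "(d, a) \<in> unit_pairs (int c)"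
        \<comment> \<open>Totatives lie between 1 and \<open>c\<close>, residues between 0 and c -
          1. The residue 0 is a unit only for \<open>c = 1\<close>, where the totative is
          \<open>c\<close> itself.\<close>
        define e where "e = (if d = 0 then c else nat d)"
        have cop: "coprime d (int c)"
          using * coprime_of_cong_inverse by (auto simp: unit_pairs_def)
        have e: "[int e = d] (mod int c)"
          using * by (auto simp: e_def unit_pairs_def cong_def)
        have "coprime (int e) (int c)"
          using cop e by (metis cong_imp_coprime cong_sym)
        then have "e \<in> totatives c"
          using * c by (auto simp: totatives_def e_def unit_pairs_def)
        moreover from A[OF this] have "[A e = a] (mod int c)"
          using * e by (intro cong_inverse_unique[of _ "int e" _ a d]) (auto simp: unit_pairs_def)
        then have "\<pi> e = (d, a)"
          using * e by (auto simp: \<pi>_def cong_def unit_pairs_def)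
        ultimately show "(d, a) \<in> \<pi> ` totatives c"
          by (metis image_eqI)
      qed
    qed
  qed
  then have "(\<Sum>d\<in>totatives c. (\<lambda>(d, a). F d a) (\<pi> d)) = (\<Sum>(d, a)\<in>unit_pairs (int c). F d a)"
    by (rule sum.reindex_bij_betw)
  also have "(\<Sum>d\<in>totatives c. (\<lambda>(d, a). F d a) (\<pi> d)) = (\<Sum>d\<in>totatives c. F (int d) (A d))"
    by (intro sum.cong refl) (auto simp: \<pi>_def cong_def intro!: per)
  finally show ?thesis .
qed

section \<open>Gauss sums modulo prime powers\<close>

text \<open>Euler's criterion gives the identity modulo \<open>p\<close>. Both sides lie between -1
  and 1, so they differ by at most 2, and \<open>p > 2\<close> forces equality.\<close>

lemma legendre_mult:
  fixes p :: int
  assumes "prime p" "p > 2"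
  shows "Legendre (a * b) p = Legendre a p * Legendre b p"
proof -
  define n where "n = nat p"
  have p: "p = int n" "prime n" "n > 2"
    using assms by (auto simp: n_def prime_nat_iff_prime)
  have "[Legendre (a * b) p = (a * b) ^ ((n - 1) div 2)] (mod p)"
    unfolding p(1) by (rule euler_criterion) (use p in auto)
  also have "(a * b) ^ ((n - 1) div 2) = a ^ ((n - 1) div 2) * b ^ ((n - 1) div 2)"
    by (rule power_mult_distrib)
  also have "[\<dots> = Legendre a p * Legendre b p] (mod p)"
    unfolding p(1) by (intro cong_mult cong_sym[OF euler_criterion]) (use p in auto)
  finally have "p dvd Legendre (a * b) p - Legendre a p * Legendre b p"
    by (simp add: cong_iff_dvd_diff)
  moreover have "\<bar>Legendre (a * b) p - Legendre a p * Legendre b p\<bar> \<le> 2"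
    by (auto simp: Legendre_def)
  ultimately show ?thesis
    using \<open>p > 2\<close> zdvd_imp_le[of p "\<bar>Legendre (a * b) p - Legendre a p * Legendre b p\<bar>"]
    by (cases "Legendre (a * b) p - Legendre a p * Legendre b p = 0") auto
qed

lemma legendre_cong: "[a = b] (mod p) \<Longrightarrow> Legendre a p = Legendre b p"
  by (simp add: Legendre_def QuadRes_def cong_def)

lemma legendre_cases: "\<not> p dvd a \<Longrightarrow> Legendre a p = 1 \<or> Legendre a p = -1"
  by (auto simp: Legendre_def cong_0_iff)

lemma legendre_sq: "\<not> p dvd a \<Longrightarrow> Legendre a p * Legendre a p = 1"
  using legendre_cases by force

text \<open>Summing over all x including 0 counts the t with p | t^2 and gives p; the term x = 0
  alone already contributes p.\<close>

lemma gauss_sum_over_coefficients: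
  assumes "prime p"
  shows "(\<Sum>x\<in>{1..<p}. gauss p x 0) = 0"
proof -
  have p: "p > 0" using assms by (simp add: prime_gt_0_int)
  have "(\<Sum>x\<in>{0..<p}. gauss p x 0) = (\<Sum>t\<in>{0..<p}. \<Sum>x\<in>{0..<p}. ec p (t\<^sup>2 * x))"
    unfolding gauss_def by (subst sum.swap) (simp add: mult.commute)
  also have "\<dots> = (\<Sum>t\<in>{0..<p}. if t = 0 then of_int p else 0)"
  proof (rule sum.cong[OF refl])
    fix t assume t: "t \<in> {0..<p}"
    have "p dvd t\<^sup>2 \<longleftrightarrow> p dvd t"
      using assms by (simp add: prime_dvd_power_iff)
    also have "\<dots> \<longleftrightarrow> t = 0"
      using t by (auto simp: dvd_eq_mod_eq_0)
    finally have "p dvd t\<^sup>2 \<longleftrightarrow> t = 0" .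
    then show "(\<Sum>x\<in>{0..<p}. ec p (t\<^sup>2 * x)) = (if t = 0 then of_int p else 0)"
      using p by (subst sum_ec_linear) auto
  qed
  also have "\<dots> = of_int p"
    using p by simp
  also have "{0..<p} = insert 0 {1..<p}"
    using p by auto
  finally show ?thesis
    using p by (simp add: gauss_def)
qed

text \<open>Multiplication by a nonresidue permutes the residues and reverses the sign. The
  nonresidue is a parameter because the application has one at hand.\<close>

lemma sum_legendre:
  assumes p: "prime p" "p > 2" and nonres: "Legendre \<nu> p = -1"
  shows "(\<Sum>x\<in>{1..<p}. Legendre x p) = 0"
proof -
  have "coprime p \<nu>"
    using nonres p by (intro prime_imp_coprime) (auto simp: Legendre_def cong_0_iff)
  then have "(\<Sum>x\<in>{0..<p}. Legendre (\<nu> * x) p) = (\<Sum>x\<in>{0..<p}. Legendre x p)"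
    using p by (intro sum_residues_scale legendre_cong) (auto simp: coprime_commute)
  then have "(\<Sum>x\<in>{0..<p}. Legendre x p) = 0"
    by (simp add: legendre_mult[OF p] nonres sum_negf)
  moreover have "{0..<p} = insert 0 {1..<p}"
    using p by auto
  moreover have "Legendre 0 p = 0"
    by (simp add: Legendre_def)
  ultimately show ?thesis
    by simp
qed

text \<open>\<open>gauss p y 0\<close> depends only on the quadratic class of y. The two classes
  have the same size and the sum over all y vanishes, so the two values are opposite; neither of
  them is computed.\<close>

lemma gauss_prime:
  assumes p: "prime p" "p > 2" and x: "\<not> p dvd x"
  shows "gauss p x 0 = of_int (Legendre x p) * gauss p 1 0"
proof -
  have res: "gauss p (y * r) 0 = gauss p y 0" if r: "Legendre r p = 1" for y r
  proof -
    have "\<not> p dvd r"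
      using r by (auto simp: Legendre_def cong_0_iff)
    obtain u where u: "[u\<^sup>2 = r] (mod p)"
      using r by (auto simp: Legendre_def QuadRes_def split: if_splits)
    then have "\<not> p dvd u\<^sup>2"
      using \<open>\<not> p dvd r\<close> cong_dvd_iff by blast
    then have "\<not> p dvd u"
      by (auto simp: power2_eq_square)
    then have "coprime u p"
      using p prime_imp_coprime coprime_commute by blast
    have "gauss p (y * r) 0 = gauss p (y * u\<^sup>2) 0"
      using u by (intro gauss_cong cong_mult cong_refl) (rule cong_sym)
    also have "\<dots> = gauss p y 0"
      using p \<open>coprime u p\<close> by (intro gauss_square) auto
    finally show ?thesis .
  qed
  show ?thesis
  proof (cases "Legendre x p = 1")
    case True
    then show ?thesis
      using res[of x 1] by simp
  next
    case False
    then have nonres: "Legendre x p = -1"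
      using legendre_cases[OF x] by simp
    \<comment> \<open>A function of the quadratic class is a constant plus a multiple of the
      Legendre symbol; 1 and x represent the two classes.\<close>
    have eq: "2 * gauss p y 0 = (gauss p 1 0 + gauss p x 0) + of_int (Legendre y p) * (gauss p 1 0 - gauss p x 0)"
      if y: "y \<in> {1..<p}" for y
    proof (cases "Legendre y p = 1")
      case True
      then show ?thesis
        using res[of y 1] by simp
    next
      case False
      have "\<not> p dvd y"
        using y by (auto dest: zdvd_imp_le)
      then have "Legendre y p = -1"
        using False legendre_cases by blast
      then have "Legendre (x * y) p = 1" "Legendre (x * x) p = 1"
        by (simp_all add: legendre_mult[OF p] nonres)
      then have "gauss p y 0 = gauss p x 0"
        using res[of "x * y" x] res[of "x * x" y] by (simp add: ac_simps)
      then show ?thesis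
        using \<open>Legendre y p = -1\<close> by simp
    qed
    have "0 = 2 * (\<Sum>y\<in>{1..<p}. gauss p y 0)"
      by (simp add: gauss_sum_over_coefficients[OF p(1)])
    also have "\<dots> = (\<Sum>y\<in>{1..<p}. (gauss p 1 0 + gauss p x 0) + of_int (Legendre y p) * (gauss p 1 0 - gauss p x 0))"
      by (simp add: sum_distrib_left eq)
    also have "\<dots> = of_int (p - 1) * (gauss p 1 0 + gauss p x 0)
        + of_int (\<Sum>y\<in>{1..<p}. Legendre y p) * (gauss p 1 0 - gauss p x 0)"
      using p by (simp add: sum.distrib sum_distrib_right)
    also have "\<dots> = of_int (p - 1) * (gauss p 1 0 + gauss p x 0)"
      by (simp add: sum_legendre[OF p nonres])
    finally have "gauss p 1 0 + gauss p x 0 = 0"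
      using p by (simp del: of_int_diff)
    then show ?thesis
      by (simp add: nonres add_eq_0_iff)
  qed
qed

lemma sum_residues_split:
  fixes f :: "int \<Rightarrow> 'b :: comm_monoid_add"
  assumes "A > 0" "B > 0" and per: "\<And>x y. [x = y] (mod A * B) \<Longrightarrow> f x = f y"
  shows "(\<Sum>t\<in>{0..<A * B}. f t) = (\<Sum>s\<in>{0..<A}. \<Sum>z\<in>{0..<B}. f (s + A * z))"
proof -
  have "(\<Sum>x\<in>{0..<A} \<times> {0..<B}. f ((\<lambda>(s, z). s + A * z) x)) = (\<Sum>t\<in>{0..<A * B}. f t)"
  proof (rule sum_residues_reindex)
    fix x y assume xy: "x \<in> {0..<A} \<times> {0..<B}" "y \<in> {0..<A} \<times> {0..<B}"
      and c: "[(\<lambda>(s, z). s + A * z) x = (\<lambda>(s, z). s + A * z) y] (mod A * B)"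
    obtain s z s' z' where [simp]: "x = (s, z)" "y = (s', z')" by fastforce
    have "[s + A * z = s' + A * z'] (mod A)"
      using c cong_modulus_mult[of "s + A * z" "s' + A * z'" A B] by simp
    then have "s = s'"
      using xy by (auto simp: cong_def)
    moreover have "A * B dvd A * (z - z')"
      using c \<open>s = s'\<close> by (simp add: cong_iff_dvd_diff right_diff_distrib)
    then have "[z = z'] (mod B)"
      using assms by (simp add: cong_iff_dvd_diff)
    then have "z = z'"
      using xy by (auto simp: cong_def)
    ultimately show "x = y" by simp
  qed (use assms per in \<open>auto simp: nat_mult_distrib\<close>)
  then show ?thesis
    by (simp add: sum.cartesian_product case_prod_unfold)
qed

text \<open>Write t = s + p^(k+1) z. The term quadratic in z drops out, the linear one is a
  character sum forcing p | s, and for s divisible by p the factor p^2 cancels against the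
  modulus.\<close>

lemma gauss_prime_power_step:
  assumes p: "prime p" "p > 2" and x: "\<not> p dvd x"
  shows "gauss (p ^ (k + 2)) x 0 = of_int p * gauss (p ^ k) x 0"
proof -
  have p0: "p > 0" "p \<noteq> 0" using p by auto
  have pw: "p ^ (k + 2) = p ^ (k + 1) * p" "p ^ (k + 1) = p * p ^ k"
    by simp_all
  have "gauss (p ^ (k + 2)) x 0 =
      (\<Sum>s\<in>{0..<p ^ (k + 1)}. \<Sum>z\<in>{0..<p}. ec (p ^ (k + 2)) (x * (s + p ^ (k + 1) * z)\<^sup>2 + 0 * (s + p ^ (k + 1) * z)))"
    unfolding gauss_def pw(1)
    by (rule sum_residues_split[OF _ _ ec_cong[OF cong_quadratic]]) (use p0 in auto)
  also have "\<dots> = (\<Sum>s\<in>{0..<p ^ (k + 1)}. \<Sum>z\<in>{0..<p}. ec (p ^ (k + 2)) (x * s\<^sup>2) * ec p (2 * x * s * z))"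
  proof (intro sum.cong refl)
    fix s z
    have "x * (s + p ^ (k + 1) * z)\<^sup>2 + 0 * (s + p ^ (k + 1) * z) - (x * s\<^sup>2 + p ^ (k + 1) * (2 * x * s * z))
        = p ^ (k + 2) * (x * p ^ k * z\<^sup>2)"
      by (simp add: power2_eq_square algebra_simps)
    then have "ec (p ^ (k + 2)) (x * (s + p ^ (k + 1) * z)\<^sup>2 + 0 * (s + p ^ (k + 1) * z))
        = ec (p ^ (k + 2)) (x * s\<^sup>2 + p ^ (k + 1) * (2 * x * s * z))"
      by (intro ec_cong) (metis cong_iff_dvd_diff dvd_triv_left)
    also have "\<dots> = ec (p ^ (k + 2)) (x * s\<^sup>2) * ec p (2 * x * s * z)"
      unfolding ec_add pw(1) using p0 by (subst ec_mult_cancel) auto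
    finally show "ec (p ^ (k + 2)) (x * (s + p ^ (k + 1) * z)\<^sup>2 + 0 * (s + p ^ (k + 1) * z))
        = ec (p ^ (k + 2)) (x * s\<^sup>2) * ec p (2 * x * s * z)" .
  qed
  also have "\<dots> = (\<Sum>s\<in>{0..<p * p ^ k}. if p dvd s then of_int p * ec (p ^ (k + 2)) (x * s\<^sup>2) else 0)"
    unfolding pw(2)
  proof (rule sum.cong[OF refl])
    fix s
    have "\<not> p dvd 2"
      using p zdvd_imp_le[of p 2] by auto
    then have "p dvd 2 * x * s \<longleftrightarrow> p dvd s"
      using p x by (auto simp: prime_dvd_mult_iff)
    then show "(\<Sum>z\<in>{0..<p}. ec (p ^ (k + 2)) (x * s\<^sup>2) * ec p (2 * x * s * z)) =
        (if p dvd s then of_int p * ec (p ^ (k + 2)) (x * s\<^sup>2) else 0)"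
      using p0 by (subst sum_distrib_left[symmetric], subst sum_ec_linear) auto
  qed
  also have "\<dots> = (\<Sum>s\<in>{0..<p}. \<Sum>z\<in>{0..<p ^ k}. if p dvd s + p * z then of_int p * ec (p ^ (k + 2)) (x * (s + p * z)\<^sup>2) else 0)"
  proof (rule sum_residues_split)
    \<comment> \<open>Periodicity modulo p^(k+1) holds only thanks to the condition p | s, which
      makes x s^2 well defined modulo the larger number p^(k+2).\<close>
    fix s s' assume *: "[s = s'] (mod p * p ^ k)"
    then obtain j where "s - s' = p * p ^ k * j"
      by (auto simp: cong_iff_dvd_diff elim: dvdE)
    then have j: "s = s' + p * p ^ k * j"
      by simp
    then have dv: "p dvd s \<longleftrightarrow> p dvd s'"
      by (simp add: mult.assoc dvd_add_left_iff)
    show "(if p dvd s then of_int p * ec (p ^ (k + 2)) (x * s\<^sup>2) else 0) =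
        (if p dvd s' then of_int p * ec (p ^ (k + 2)) (x * s'\<^sup>2) else 0)"
    proof (cases "p dvd s'")
      case True
      then obtain r where r: "s' = p * r" by blast
      have "x * s\<^sup>2 - x * s'\<^sup>2 = p ^ (k + 2) * (x * (2 * r * j + p ^ k * j\<^sup>2))"
        unfolding j r by (simp add: power2_eq_square algebra_simps)
      then have "ec (p ^ (k + 2)) (x * s\<^sup>2) = ec (p ^ (k + 2)) (x * s'\<^sup>2)"
        by (intro ec_cong) (metis cong_iff_dvd_diff dvd_triv_left)
      then show ?thesis using dv by simp
    qed (use dv in simp)
  qed (use p0 in auto)
  also have "\<dots> = (\<Sum>s\<in>{0..<p}. if s = 0 then \<Sum>z\<in>{0..<p ^ k}. of_int p * ec (p ^ k) (x * z\<^sup>2) else 0)"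
  proof (rule sum.cong[OF refl])
    fix s assume "s \<in> {0..<p}"
    then have "p dvd s + p * z \<longleftrightarrow> s = 0" for z
      by (auto simp: dvd_add_left_iff dest: zdvd_imp_le)
    moreover have "ec (p ^ (k + 2)) (x * (p * z)\<^sup>2) = ec (p ^ k) (x * z\<^sup>2)" for z
      using ec_mult_cancel[of "p\<^sup>2" "p ^ k" "x * z\<^sup>2"] p0
      by (simp add: power_mult_distrib ac_simps power2_eq_square)
    ultimately show "(\<Sum>z\<in>{0..<p ^ k}. if p dvd s + p * z then of_int p * ec (p ^ (k + 2)) (x * (s + p * z)\<^sup>2) else 0)
        = (if s = 0 then \<Sum>z\<in>{0..<p ^ k}. of_int p * ec (p ^ k) (x * z\<^sup>2) else 0)"
      by simp
  qed
  also have "\<dots> = of_int p * gauss (p ^ k) x 0"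
    using p0 by (simp add: gauss_def sum_distrib_left)
  finally show ?thesis .
qed

text \<open>The recursion has step two and the symbol squares to 1, so the cases k = 0 and k = 1
  decide everything.\<close>

lemma gauss_prime_power:
  assumes p: "prime p" "p > 2" and x: "\<not> p dvd x"
  shows "gauss (p ^ k) x 0 = of_int (Legendre x p) ^ k * gauss (p ^ k) 1 0"
proof (induction k rule: induct_nat_012)
  case 0
  show ?case by (simp add: gauss_def ec_def ee_eq_1_iff[THEN iffD2])
next
  case 1
  show ?case using gauss_prime[OF assms] by simp
next
  case (ge2 k)
  have one: "\<not> p dvd 1"
    using p by auto
  have "(of_int (Legendre x p) :: complex) * of_int (Legendre x p) = 1"
    using legendre_sq[OF x] by (simp flip: of_int_mult)
  then show ?case
    using gauss_prime_power_step[OF p x, of k] gauss_prime_power_step[OF p one, of k] ge2(1)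
    by simp
qed

lemma unit_pairs_sum_prime:
  fixes f :: "int \<Rightarrow> complex"
  assumes "prime p"
  shows "(\<Sum>(d, a)\<in>unit_pairs p. f d) = (\<Sum>d\<in>{1..<p}. f d)"
proof -
  have p: "p > 1" using assms by (simp add: prime_gt_1_int)
  have "fst ` unit_pairs p = {1..<p}"
  proof
    show "fst ` unit_pairs p \<subseteq> {1..<p}"
    proof clarify
      fix d a assume *: "(d, a) \<in> unit_pairs p"
      then have "d \<noteq> 0"
        using p by (auto simp: unit_pairs_def cong_def)
      then show "fst (d, a) \<in> {1..<p}"
        using * by (auto simp: unit_pairs_def)
    qed
    show "{1..<p} \<subseteq> fst ` unit_pairs p"
    proof
      fix d assume d: "d \<in> {1..<p}"
      then have "\<not> p dvd d" by (auto dest: zdvd_imp_le)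
      then have "coprime d p"
        using assms prime_imp_coprime coprime_commute by blast
      then obtain a where "[a * d = 1] (mod p)"
        using cong_solve_coprime_int by (metis mult.commute)
      then have "(d mod p, a mod p) \<in> unit_pairs p"
        using p by (intro unit_pairs_mod) auto
      then show "d \<in> fst ` unit_pairs p"
        using d by (force simp: image_iff)
    qed
  qed
  then show ?thesis
    using sum.reindex[OF inj_on_fst_unit_pairs[of p], of f] by (simp add: case_prod_unfold comp_def)
qed

lemma ramanujan_sum_prime:
  assumes "prime p"
  shows "(\<Sum>(d, a)\<in>unit_pairs p. ec p (h * d)) = (if p dvd h then of_int p else 0) - 1"
proof -
  have p: "p > 0" using assms by (simp add: prime_gt_0_int)
  have "{0..<p} = insert 0 {1..<p}"
    using p by auto
  then have "(\<Sum>d\<in>{0..<p}. ec p (h * d)) = 1 + (\<Sum>d\<in>{1..<p}. ec p (h * d))"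
    by simp
  then show ?thesis
    using sum_ec_linear[OF p, of h] by (simp add: unit_pairs_sum_prime[OF assms])
qed

section \<open>Kloosterman and Salie sums modulo prime powers\<close>

lemma card_le_2_of_plus_minus:
  fixes S :: "int set" and q :: int
  assumes S: "S \<subseteq> {0..<q}" and pm: "\<And>x y. x \<in> S \<Longrightarrow> y \<in> S \<Longrightarrow> q dvd x - y \<or> q dvd x + y"
  shows "card S \<le> 2"
proof (cases "S = {}")
  case False
  then obtain y where y: "y \<in> S" by blast
  have "S \<subseteq> {y, (- y) mod q}"
  proof
    fix x assume x: "x \<in> S"
    from pm[OF x y] have "[x = y] (mod q) \<or> [x = - y] (mod q)"
      by (simp add: cong_iff_dvd_diff)
    moreover have "x mod q = x" "y mod q = y"
      using S x y by auto
    ultimately show "x \<in> {y, (- y) mod q}"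
      by (auto simp: cong_def)
  qed
  then have "card S \<le> card {y, (- y) mod q}"
    by (intro card_mono) auto
  also have "\<dots> \<le> 2"
    by (simp add: card_insert_if)
  finally show ?thesis .
qed simp

lemma prime_power_dvd_mult_cases:
  fixes p x y :: int
  assumes "prime p" "p ^ t dvd x * y" "\<not> (p dvd x \<and> p dvd y)"
  shows "p ^ t dvd x \<or> p ^ t dvd y"
proof (cases "p dvd x")
  case True
  then have "coprime (p ^ t) y"
    using assms by (simp add: prime_imp_coprime)
  then show ?thesis
    using assms(2) by (simp add: coprime_dvd_mult_left_iff)
next
  case False
  then have "coprime (p ^ t) x"
    using assms by (simp add: prime_imp_coprime)
  then show ?thesis
    using assms(2) by (simp add: coprime_dvd_mult_right_iff)
qed

text \<open>Two roots satisfy p^t | (x - y) (x + y), and p cannot divide both factors, for then p |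
  2 x and hence p | m. So all roots agree up to sign modulo p^t.\<close>

lemma card_quadratic_roots:
  fixes p :: int
  assumes p: "prime p" "p > 2" and n: "\<not> p dvd n" and m: "\<not> p dvd m"
  shows "card {y \<in> {0..<p ^ t}. [n * y\<^sup>2 = m] (mod p ^ t)} \<le> 2"
proof (cases "t = 0")
  case True
  have "{y \<in> {0..<p ^ t}. [n * y\<^sup>2 = m] (mod p ^ t)} \<subseteq> {0}"
    using True by auto
  then have "card {y \<in> {0..<p ^ t}. [n * y\<^sup>2 = m] (mod p ^ t)} \<le> card {0::int}"
    by (intro card_mono) auto
  then show ?thesis by simp
next
  case False
  show ?thesis
  proof (rule card_le_2_of_plus_minus)
    fix x y assume x: "x \<in> {y \<in> {0..<p ^ t}. [n * y\<^sup>2 = m] (mod p ^ t)}"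
      and y: "y \<in> {y \<in> {0..<p ^ t}. [n * y\<^sup>2 = m] (mod p ^ t)}"
    have "[n * x\<^sup>2 = n * y\<^sup>2] (mod p ^ t)"
      using x y by (auto intro: cong_trans cong_sym)
    then have "p ^ t dvd n * ((x - y) * (x + y))"
      by (simp add: cong_iff_dvd_diff algebra_simps power2_eq_square)
    moreover have "coprime (p ^ t) n"
      using p n by (simp add: prime_imp_coprime)
    ultimately have "p ^ t dvd (x - y) * (x + y)"
      by (simp add: coprime_dvd_mult_right_iff)
    moreover have "\<not> (p dvd x - y \<and> p dvd x + y)"
    proof
      assume *: "p dvd x - y \<and> p dvd x + y"
      have "p dvd (x - y) + (x + y)"
        by (rule dvd_add) (use * in blast)+
      then have "p dvd 2 * x"
        by simp
      moreover have "\<not> p dvd 2"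
        using p zdvd_imp_le[of p 2] by auto
      ultimately have "p dvd n * x\<^sup>2"
        using p by (simp add: prime_dvd_mult_iff prime_dvd_power_iff)
      moreover have "[n * x\<^sup>2 = m] (mod p)"
        using x False by (auto intro: cong_dvd_modulus simp: dvd_power)
      ultimately show False
        using m cong_dvd_iff by blast
    qed
    ultimately show "p ^ t dvd x - y \<or> p ^ t dvd x + y"
      using p by (intro prime_power_dvd_mult_cases)
  qed auto
qed

lemma card_residues_lift:
  fixes A B :: int
  assumes "A > 0" "B > 0" "finite S"
  shows "card {d \<in> {0..<A * B}. d mod A \<in> S} \<le> card S * nat B"
proof -
  define \<pi> where "\<pi> = (\<lambda>d. (d mod A, d div A))"
  have "inj_on \<pi> {d \<in> {0..<A * B}. d mod A \<in> S}"
    by (rule inj_onI) (auto simp: \<pi>_def, metis mult_div_mod_eq)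
  moreover have "\<pi> ` {d \<in> {0..<A * B}. d mod A \<in> S} \<subseteq> S \<times> {0..<B}"
  proof clarify
    fix x y d assume *: "(x, y) = \<pi> d" "d \<in> {0..<A * B}" "d mod A \<in> S"
    have "A * (d div A) \<le> d"
      using mult_div_mod_eq[of A d] pos_mod_sign[OF \<open>A > 0\<close>, of d] by linarith
    also have "d < A * B"
      using * by simp
    finally have "A * (d div A) < A * B" .
    then have "d div A < B" "0 \<le> d div A"
      using * \<open>A > 0\<close> by (auto simp: pos_imp_zdiv_nonneg_iff)
    then show "x \<in> S \<and> y \<in> {0..<B}"
      using * by (simp add: \<pi>_def)
  qed
  ultimately have "card {d \<in> {0..<A * B}. d mod A \<in> S} \<le> card (S \<times> {0..<B})"
    using assms by (intro card_inj_on_le[of \<pi>]) auto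
  then show ?thesis by (simp add: card_cartesian_product)
qed

text \<open>For such y the quotient |D| y / c is an integer between 0 and |D| - 1 that determines
  y.\<close>

lemma card_kernel:
  fixes c D :: int
  assumes "c > 0" "D \<noteq> 0"
  shows "card {y \<in> {0..<c}. c dvd D * y} \<le> nat \<bar>D\<bar>"
proof -
  have "inj_on (\<lambda>y. \<bar>D\<bar> * y div c) {y \<in> {0..<c}. c dvd D * y}"
  proof (rule inj_onI)
    fix y y' assume y: "y \<in> {y \<in> {0..<c}. c dvd D * y}" "y' \<in> {y \<in> {0..<c}. c dvd D * y}"
      and eq: "\<bar>D\<bar> * y div c = \<bar>D\<bar> * y' div c"
    have "c dvd \<bar>D\<bar> * y" "c dvd \<bar>D\<bar> * y'"
      using y by (auto simp: abs_if)
    then have "\<bar>D\<bar> * y = \<bar>D\<bar> * y'"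
      using eq by (metis dvd_div_mult_self)
    then show "y = y'" using assms by simp
  qed
  moreover have "(\<lambda>y. \<bar>D\<bar> * y div c) ` {y \<in> {0..<c}. c dvd D * y} \<subseteq> {0..<\<bar>D\<bar>}"
  proof
    fix x assume "x \<in> (\<lambda>y. \<bar>D\<bar> * y div c) ` {y \<in> {0..<c}. c dvd D * y}"
    then obtain y where y: "x = \<bar>D\<bar> * y div c" "0 \<le> y" "y < c" "c dvd D * y"
      by auto
    have "c dvd \<bar>D\<bar> * y"
      using y by (auto simp: abs_if)
    then have "x * c = \<bar>D\<bar> * y"
      by (simp add: y)
    moreover have "\<bar>D\<bar> * y < \<bar>D\<bar> * c" "0 \<le> \<bar>D\<bar> * y"
      using y assms by auto
    ultimately have "x * c < \<bar>D\<bar> * c" "0 \<le> x * c"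
      by simp_all
    then show "x \<in> {0..<\<bar>D\<bar>}"
      using assms by (simp add: zero_le_mult_iff)
  qed
  ultimately have "card {y \<in> {0..<c}. c dvd D * y} \<le> card {0..<\<bar>D\<bar>}"
    by (rule card_inj_on_le) simp
  then show ?thesis by simp
qed

text \<open>Salie's evaluation by Fourier inversion. Inserting x^2 next to \<open>M * a\<close>
  gives a function F of x whose Fourier transform is made of Gauss sums: the Legendre symbol they
  produce cancels the one in front, and a Ramanujan sum in N - \<mu> y^2 is left. Inversion at x = 1
  gives the constant K times the sum of \<open>ec p y\<close> over the roots of y^2 = 4 M N, at most
  two terms.\<close>

lemma norm_salie_aux:
  fixes p :: int
  assumes p: "prime p" "p > 2" and M: "\<not> p dvd M"
  shows "norm (\<Sum>(d, a)\<in>unit_pairs p. of_int (Legendre a p) * ec p (M * a + N * d)) \<le> 2 * sqrt (of_int p)"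
proof -
  have p0: "p > 0" using p by simp
  have p2: "\<not> p dvd 2" using p zdvd_imp_le[of p 2] by auto
  have p4: "\<not> p dvd 4 * M"
    using p p2 M prime_dvd_mult_iff[of p 2 2] by (auto simp: prime_dvd_mult_iff)
  then have "coprime (4 * M) p"
    using p prime_imp_coprime coprime_commute by blast
  then obtain \<mu> where \<mu>: "[4 * M * \<mu> = 1] (mod p)"
    using cong_solve_coprime_int by blast
  have \<mu>': "\<not> p dvd \<mu>"
    using \<mu> p by (metis cong_dvd_iff dvd_mult not_prime_unit)
  define F where "F = (\<lambda>x. \<Sum>(d, a)\<in>unit_pairs p. of_int (Legendre a p) * ec p (M * a * x\<^sup>2 + N * d))"
  define K :: complex where "K = of_int (Legendre M p) * gauss p 1 0"
  define R where "R = {y \<in> {0..<p}. p dvd N - \<mu> * y\<^sup>2}"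
  have transform: "(\<Sum>x\<in>{0..<p}. F x * ec p (- (y * x))) = K * ((if p dvd N - \<mu> * y\<^sup>2 then of_int p else 0) - 1)" for y
  proof -
    have "(\<Sum>x\<in>{0..<p}. F x * ec p (- (y * x))) =
        (\<Sum>x\<in>{0..<p}. \<Sum>(d, a)\<in>unit_pairs p. of_int (Legendre a p) * ec p (N * d) * ec p (M * a * x\<^sup>2 + (- y) * x))"
      unfolding F_def sum_distrib_right
    proof (intro sum.cong refl, clarify)
      fix x d a
      have "ec p (M * a * x\<^sup>2 + N * d) * ec p (- (y * x)) = ec p (N * d) * ec p (M * a * x\<^sup>2 + (- y) * x)"
        unfolding ec_add[symmetric] by (simp add: algebra_simps)
      then show "of_int (Legendre a p) * ec p (M * a * x\<^sup>2 + N * d) * ec p (- (y * x)) =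
          of_int (Legendre a p) * ec p (N * d) * ec p (M * a * x\<^sup>2 + (- y) * x)"
        by simp
    qed
    also have "\<dots> = (\<Sum>(d, a)\<in>unit_pairs p. of_int (Legendre a p) * ec p (N * d) * gauss p (M * a) (- y))"
      by (subst sum.swap) (simp add: gauss_def sum_distrib_left case_prod_unfold)
    also have "\<dots> = (\<Sum>(d, a)\<in>unit_pairs p. K * ec p ((N - \<mu> * y\<^sup>2) * d))"
    proof (rule sum.cong[OF refl], clarify)
      fix d a assume "(d, a) \<in> unit_pairs p"
      then have ad: "[a * d = 1] (mod p)" by (simp add: unit_pairs_def)
      then have a: "\<not> p dvd a"
        using p by (metis cong_dvd_iff dvd_mult2 not_prime_unit)
      then have Ma: "\<not> p dvd M * a"
        using M p by (simp add: prime_dvd_mult_iff)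
      have "[(4 * M * \<mu>) * (a * d) = 1 * 1] (mod p)"
        using \<mu> ad by (rule cong_mult)
      then have "[4 * (M * a) * (\<mu> * d) = 1] (mod p)"
        by (simp add: ac_simps)
      then have "gauss p (M * a) (- y) = ec p (- (\<mu> * d * y\<^sup>2)) * gauss p (M * a) 0"
        using gauss_complete_square[OF p0, of "M * a" "\<mu> * d" "- y"] by simp
      also have "gauss p (M * a) 0 = of_int (Legendre a p) * K"
        using gauss_prime[OF p Ma] by (simp add: legendre_mult[OF p] K_def)
      finally have "of_int (Legendre a p) * ec p (N * d) * gauss p (M * a) (- y) =
          of_int (Legendre a p * Legendre a p) * K * (ec p (N * d) * ec p (- (\<mu> * d * y\<^sup>2)))"
        by (simp add: ac_simps)
      also have "\<dots> = K * ec p ((N - \<mu> * y\<^sup>2) * d)"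
        unfolding legendre_sq[OF a] by (simp add: algebra_simps flip: ec_add)
      finally show "of_int (Legendre a p) * ec p (N * d) * gauss p (M * a) (- y) = K * ec p ((N - \<mu> * y\<^sup>2) * d)" .
    qed
    also have "\<dots> = K * (\<Sum>(d, a)\<in>unit_pairs p. ec p ((N - \<mu> * y\<^sup>2) * d))"
      by (simp add: sum_distrib_left case_prod_unfold)
    finally show ?thesis
      by (simp only: ramanujan_sum_prime[OF p(1)])
  qed
  \<comment> \<open>At x = 1 the function F is the sum to be bounded. The constant -1 in the
    Ramanujan sums contributes a complete sum of \<open>ec p y\<close>, which is 0.\<close>
  have "of_int p * F 1 = (\<Sum>x\<in>{0..<p}. if x = 1 then of_int p * F x else 0)"
    using p by simp
  also have "\<dots> = (\<Sum>x\<in>{0..<p}. F x * (\<Sum>y\<in>{0..<p}. ec p ((1 - x) * y)))"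
  proof (rule sum.cong[OF refl])
    fix x assume x: "x \<in> {0..<p}"
    have "p dvd 1 - x \<longleftrightarrow> x = 1"
      using x p by (auto simp: mod_eq_dvd_iff[symmetric])
    then show "(if x = 1 then of_int p * F x else 0) = F x * (\<Sum>y\<in>{0..<p}. ec p ((1 - x) * y))"
      using p0 by (simp add: sum_ec_linear)
  qed
  also have "\<dots> = (\<Sum>y\<in>{0..<p}. ec p y * (\<Sum>x\<in>{0..<p}. F x * ec p (- (y * x))))"
    unfolding sum_distrib_left
  proof (subst sum.swap, intro sum.cong refl)
    fix x y
    have "ec p ((1 - x) * y) = ec p y * ec p (- (y * x))"
      unfolding ec_add[symmetric] by (simp add: algebra_simps)
    then show "F x * ec p ((1 - x) * y) = ec p y * (F x * ec p (- (y * x)))"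
      by simp
  qed
  also have "\<dots> = (\<Sum>y\<in>{0..<p}. (if y \<in> R then of_int p * K * ec p y else 0) - K * ec p (1 * y))"
    unfolding transform by (intro sum.cong refl) (auto simp: R_def algebra_simps)
  also have "\<dots> = (\<Sum>y\<in>R. of_int p * K * ec p y) - K * (\<Sum>y\<in>{0..<p}. ec p (1 * y))"
  proof -
    have "{0..<p} \<inter> R = R"
      by (auto simp: R_def)
    then show ?thesis
      unfolding sum_subtractf sum_distrib_left by (simp flip: sum.inter_restrict)
  qed
  also have "(\<Sum>y\<in>{0..<p}. ec p (1 * y)) = 0"
    using p by (subst sum_ec_linear) auto
  finally have "of_int p * F 1 = of_int p * (K * (\<Sum>y\<in>R. ec p y))"
    by (simp add: sum_distrib_left ac_simps)
  then have F1: "F 1 = K * (\<Sum>y\<in>R. ec p y)"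
    using p0 by simp
  have "card R \<le> 2"
  proof (rule card_le_2_of_plus_minus)
    fix x y assume "x \<in> R" "y \<in> R"
    then have "p dvd N - \<mu> * y\<^sup>2" "p dvd N - \<mu> * x\<^sup>2"
      by (auto simp: R_def)
    then have "p dvd (N - \<mu> * y\<^sup>2) - (N - \<mu> * x\<^sup>2)"
      by (rule dvd_diff)
    also have "(N - \<mu> * y\<^sup>2) - (N - \<mu> * x\<^sup>2) = \<mu> * ((x - y) * (x + y))"
      by (simp add: algebra_simps power2_eq_square)
    finally show "p dvd x - y \<or> p dvd x + y"
      using p \<mu>' by (simp add: prime_dvd_mult_iff)
  qed (auto simp: R_def)
  have "norm K = sqrt (of_int p)"
    using norm_gauss[of p 1 0] p legendre_cases[OF M] prime_odd_int[of p] by (auto simp: K_def norm_mult)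
  moreover have "norm (\<Sum>y\<in>R. ec p y) \<le> real (card R)"
    using norm_sum[of "ec p" R] by simp
  ultimately have "norm (F 1) \<le> sqrt (of_int p) * real (card R)"
    using p0 unfolding F1 norm_mult by (simp only: mult_left_mono real_sqrt_ge_zero of_int_0_le_iff)
  also have "\<dots> \<le> sqrt (of_int p) * 2"
    using \<open>card R \<le> 2\<close> p0 by (intro mult_left_mono) auto
  finally show ?thesis
    by (simp add: F_def mult.commute)
qed

text \<open>If p divides M, it does not divide N. Since a and d are inverse to each other, their
  Legendre symbols agree, and exchanging them exchanges M and N.\<close>

lemma norm_salie:
  fixes p :: int
  assumes p: "prime p" "p > 2" and MN: "\<not> (p dvd M \<and> p dvd N)"
  shows "norm (\<Sum>(d, a)\<in>unit_pairs p. of_int (Legendre a p) * ec p (M * a + N * d)) \<le> 2 * sqrt (of_int p)"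
proof (cases "p dvd M")
  case False
  then show ?thesis by (rule norm_salie_aux[OF p])
next
  case True
  have "(\<Sum>(d, a)\<in>unit_pairs p. of_int (Legendre a p) * ec p (M * a + N * d)) =
      (\<Sum>(d, a)\<in>unit_pairs p. of_int (Legendre d p) * ec p (M * a + N * d))"
  proof (rule sum.cong[OF refl], clarify)
    fix d a assume "(d, a) \<in> unit_pairs p"
    then have ad: "[a * d = 1] (mod p)" by (simp add: unit_pairs_def)
    have "\<not> p dvd a" "\<not> p dvd d"
      using p ad by (metis cong_dvd_iff dvd_mult2 not_prime_unit, metis ad cong_dvd_iff dvd_mult not_prime_unit p(1))
    moreover have "Legendre a p * Legendre d p = 1"
    proof -
      have "Legendre a p * Legendre d p = Legendre 1 p"
        using legendre_cong[OF ad] by (simp add: legendre_mult[OF p])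
      also have "Legendre 1 p = 1"
        using p by (auto simp: Legendre_def QuadRes_def cong_0_iff intro: exI[of _ 1])
      finally show ?thesis .
    qed
    ultimately have "Legendre a p = Legendre d p"
      using legendre_cases[of p a] legendre_cases[of p d] by auto
    then show "of_int (Legendre a p) * ec p (M * a + N * d) = of_int (Legendre d p) * ec p (M * a + N * d)"
      by simp
  qed
  also have "\<dots> = (\<Sum>(d, a)\<in>unit_pairs p. of_int (Legendre a p) * ec p (N * a + M * d))"
    by (subst unit_pairs_swap[symmetric]) (simp add: add.commute)
  finally show ?thesis
    using norm_salie_aux[OF p, of N M] True MN by simp
qed

text \<open>This is the average over the perturbation y in the stationary phase argument, with u for
  N d - M a. For e = 0 the quadratic term disappears modulo p^t and a plain character sum remains;
  for e = 1 it survives modulo p and contributes a Gauss sum, whence the square root.\<close>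

lemma norm_stationary_phase_integral:
  fixes p :: int
  assumes p: "prime p" "p > 2" and e: "e \<le> 1" and t: "t \<ge> 1"
    and v: "p ^ t dvd u \<Longrightarrow> \<not> p dvd v"
  shows "norm (\<Sum>y\<in>{0..<p ^ (t + e)}. ec (p ^ (t + e)) (y * u + p ^ t * y\<^sup>2 * v))
    = (if p ^ t dvd u then of_int (p ^ t) * sqrt (of_int (p ^ e)) else 0)"
proof (cases "e = 0")
  case True
  have p0: "p ^ t > 0" using p by simp
  have "ec (p ^ t) (y * u + p ^ t * y\<^sup>2 * v) = ec (p ^ t) (u * y)" for y
    by (intro ec_cong) (simp add: cong_iff_dvd_diff algebra_simps)
  then show ?thesis
    using True sum_ec_linear[OF p0, of u] p by (simp add: norm_power)
next
  case False
  then have e: "e = 1" using e by simp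
  have p0: "p > 0" using p by simp
  have pw: "p ^ (t + e) = p * p ^ t" by (simp add: e)
  have "(\<Sum>y\<in>{0..<p ^ (t + e)}. ec (p ^ (t + e)) (y * u + p ^ t * y\<^sup>2 * v)) =
      (\<Sum>s\<in>{0..<p}. \<Sum>z\<in>{0..<p ^ t}. ec (p * p ^ t) ((s + p * z) * u + p ^ t * (s + p * z)\<^sup>2 * v))"
    unfolding pw
  proof (rule sum_residues_split)
    fix x y :: int assume "[x = y] (mod p * p ^ t)"
    then show "ec (p * p ^ t) (x * u + p ^ t * x\<^sup>2 * v) = ec (p * p ^ t) (y * u + p ^ t * y\<^sup>2 * v)"
      by (intro ec_cong cong_add cong_mult cong_pow cong_refl)
  qed (use p0 in auto)
  also have "\<dots> = (\<Sum>s\<in>{0..<p}. \<Sum>z\<in>{0..<p ^ t}. ec (p * p ^ t) (s * u + p ^ t * s\<^sup>2 * v) * ec (p ^ t) (u * z))"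
  proof (intro sum.cong refl)
    fix s z
    have "(s + p * z) * u + p ^ t * (s + p * z)\<^sup>2 * v - (s * u + p ^ t * s\<^sup>2 * v + p * (u * z)) =
        (p * p ^ t) * (2 * s * z * v + p * z\<^sup>2 * v)"
      by (simp add: algebra_simps power2_eq_square)
    then have "ec (p * p ^ t) ((s + p * z) * u + p ^ t * (s + p * z)\<^sup>2 * v) =
        ec (p * p ^ t) (s * u + p ^ t * s\<^sup>2 * v + p * (u * z))"
      by (intro ec_cong) (metis cong_iff_dvd_diff dvd_triv_left)
    also have "\<dots> = ec (p * p ^ t) (s * u + p ^ t * s\<^sup>2 * v) * ec (p ^ t) (u * z)"
      using p0 by (simp add: ec_add ec_mult_cancel)
    finally show "ec (p * p ^ t) ((s + p * z) * u + p ^ t * (s + p * z)\<^sup>2 * v) =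
        ec (p * p ^ t) (s * u + p ^ t * s\<^sup>2 * v) * ec (p ^ t) (u * z)" .
  qed
  also have "\<dots> = (if p ^ t dvd u then of_int (p ^ t) * (\<Sum>s\<in>{0..<p}. ec (p * p ^ t) (s * u + p ^ t * s\<^sup>2 * v)) else 0)"
    unfolding sum_distrib_left[symmetric] sum_ec_linear[OF zero_less_power[OF p0]]
    by (simp add: sum_distrib_left ac_simps)
  finally have *: "(\<Sum>y\<in>{0..<p ^ (t + e)}. ec (p ^ (t + e)) (y * u + p ^ t * y\<^sup>2 * v)) =
      (if p ^ t dvd u then of_int (p ^ t) * (\<Sum>s\<in>{0..<p}. ec (p * p ^ t) (s * u + p ^ t * s\<^sup>2 * v)) else 0)" .
  show ?thesis
  proof (cases "p ^ t dvd u")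
    case True
    then obtain w where w: "u = p ^ t * w" by blast
    have "ec (p * p ^ t) (s * u + p ^ t * s\<^sup>2 * v) = ec p (v * s\<^sup>2 + w * s)" for s
      using ec_mult_cancel[of "p ^ t" p "v * s\<^sup>2 + w * s"] p0 by (simp add: w algebra_simps)
    then have "(\<Sum>s\<in>{0..<p}. ec (p * p ^ t) (s * u + p ^ t * s\<^sup>2 * v)) = gauss p v w"
      by (simp add: gauss_def)
    moreover have "coprime v p"
      using v[OF True] p prime_imp_coprime coprime_commute by blast
    ultimately show ?thesis
      using True norm_gauss[of p v w] p prime_odd_int[of p] unfolding * by (simp add: norm_mult norm_power e)
  qed (simp add: *)
qed

text \<open>Multiplying N d = M a by d gives N d^2 = M modulo p^t, with at most two roots, each
  having p^(k - t) lifts. A stationary point forces p to divide both or neither of M and N, hence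
  neither.\<close>

lemma card_stationary_points:
  fixes p :: int
  assumes p: "prime p" "p > 2" and t: "1 \<le> t" "t \<le> k"
    and MN: "\<not> (p dvd M \<and> p dvd N)"
  shows "card {(d, a) \<in> unit_pairs (p ^ k). p ^ t dvd N * d - M * a} \<le> 2 * nat (p ^ (k - t))"
    and "(d, a) \<in> unit_pairs (p ^ k) \<Longrightarrow> p ^ t dvd N * d - M * a \<Longrightarrow> \<not> p dvd M * a"
proof -
  have pt: "p dvd p ^ t" "p dvd p ^ k" "p ^ t dvd p ^ k"
    using t by (auto intro: le_imp_power_dvd)
  have nondvd: "\<not> p dvd d \<and> \<not> p dvd a" if "(d, a) \<in> unit_pairs (p ^ k)" for d a
  proof -
    have "[a * d = 1] (mod p)"
      using that pt cong_dvd_modulus by (auto simp: unit_pairs_def)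
    then show ?thesis
      using p by (metis cong_dvd_iff dvd_mult dvd_mult2 not_prime_unit)
  qed
  have MN': "\<not> p dvd M" "\<not> p dvd N" if "(d, a) \<in> unit_pairs (p ^ k)" "p ^ t dvd N * d - M * a" for d a
  proof -
    have "p dvd N * d - M * a"
      using that pt dvd_trans by blast
    then have "p dvd N * d \<longleftrightarrow> p dvd M * a"
      using cong_dvd_iff[of "N * d" "M * a" p] by (simp add: cong_iff_dvd_diff)
    then have "p dvd N \<longleftrightarrow> p dvd M"
      using nondvd[OF that(1)] p by (simp add: prime_dvd_mult_iff)
    then show "\<not> p dvd M" "\<not> p dvd N"
      using MN by auto
  qed
  show "\<not> p dvd M * a" if "(d, a) \<in> unit_pairs (p ^ k)" "p ^ t dvd N * d - M * a"
    using MN'[OF that] nondvd[OF that(1)] p by (simp add: prime_dvd_mult_iff)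
  define D where "D = {(d, a) \<in> unit_pairs (p ^ k). p ^ t dvd N * d - M * a}"
  show "card {(d, a) \<in> unit_pairs (p ^ k). p ^ t dvd N * d - M * a} \<le> 2 * nat (p ^ (k - t))"
    unfolding D_def[symmetric]
  proof (cases "D = {}")
    case False
    then have MN'': "\<not> p dvd M" "\<not> p dvd N"
      using MN' by (auto simp: D_def)
    define S where "S = {y \<in> {0..<p ^ t}. [N * y\<^sup>2 = M] (mod p ^ t)}"
    have "D \<subseteq> unit_pairs (p ^ k)"
      by (auto simp: D_def)
    then have "card D = card (fst ` D)"
      using inj_on_subset[OF inj_on_fst_unit_pairs] card_image by metis
    also have "\<dots> \<le> card {d \<in> {0..<p ^ t * p ^ (k - t)}. d mod p ^ t \<in> S}"
    proof (rule card_mono)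
      show "fst ` D \<subseteq> {d \<in> {0..<p ^ t * p ^ (k - t)}. d mod p ^ t \<in> S}"
      proof
        fix x assume "x \<in> fst ` D"
        then obtain d a where x: "x = d" and *: "(d, a) \<in> D"
          by auto
        then have da: "(d, a) \<in> unit_pairs (p ^ k)" "p ^ t dvd N * d - M * a"
          by (auto simp: D_def)
        then have ad: "[a * d = 1] (mod p ^ t)"
          using pt cong_dvd_modulus by (auto simp: unit_pairs_def)
        have "[d mod p ^ t = d] (mod p ^ t)"
          by simp
        then have "[N * (d mod p ^ t)\<^sup>2 = N * d\<^sup>2] (mod p ^ t)"
          by (intro cong_mult cong_pow cong_refl)
        also have "N * d\<^sup>2 = N * d * d"
          by (simp add: power2_eq_square)
        also have "[N * d * d = M * a * d] (mod p ^ t)"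
          using da by (intro cong_scalar_right) (simp add: cong_iff_dvd_diff)
        also have "[M * a * d = M * 1] (mod p ^ t)"
          using cong_scalar_left[OF ad, of M] by (simp add: mult.assoc)
        finally have "d mod p ^ t \<in> S"
          using p by (simp add: S_def)
        moreover have "d \<in> {0..<p ^ t * p ^ (k - t)}"
          using da t by (auto simp: unit_pairs_def simp flip: power_add)
        ultimately show "x \<in> {d \<in> {0..<p ^ t * p ^ (k - t)}. d mod p ^ t \<in> S}"
          by (simp add: x)
      qed
    qed (rule finite_subset[of _ "{0..<p ^ t * p ^ (k - t)}"], auto)
    also have "\<dots> \<le> card S * nat (p ^ (k - t))"
      using p by (intro card_residues_lift finite_subset[of S "{0..<p ^ t}"]) (auto simp: S_def)
    also have "\<dots> \<le> 2 * nat (p ^ (k - t))"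
      unfolding S_def by (intro mult_right_mono card_quadratic_roots p MN'') auto
    finally show "card D \<le> 2 * nat (p ^ (k - t))" .
  qed simp
qed

text \<open>Replace d by d (1 + p^t y) with t half of k - s, rounded down; f depends only on a
  modulo p and does not notice. Averaging over y leaves the stationary points: 2 p^(k - t) of them,
  times p^t sqrt(p^e), divided by p^(t + e), is 2 p^((k + s) / 2).\<close>

lemma norm_kloosterman_prime_power:
  fixes p :: int
  assumes p: "prime p" "p > 2" and sk: "s + 2 \<le> k"
    and MN: "\<not> (p dvd M \<and> p dvd N)"
    and f: "\<And>a a'. [a = a'] (mod p) \<Longrightarrow> f a = f a'"
    and f1: "\<And>a. norm (f a :: complex) \<le> 1"
  shows "norm (\<Sum>(d, a)\<in>unit_pairs (p ^ k). f a * ec (p ^ k) (p ^ s * M * a + p ^ s * N * d))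
    \<le> 2 * sqrt (of_int (p ^ (k + s)))"
proof -
  define l where "l = k - s"
  define t where "t = l div 2"
  define e where "e = l mod 2"
  have l0: "l = t + t + e" "e \<le> 1" "l \<ge> 2" "k = s + l"
    unfolding t_def e_def using sk by (presburger, simp, simp_all add: l_def)
  then have l: "l = t + t + e" "t \<ge> 1" "e \<le> 1" "l \<ge> 2" "k = s + l" "t \<le> k" "l \<le> t + t + t"
    by linarith+
  have p0: "p > 0" using p by simp
  have pt: "p dvd p ^ t" "p dvd p ^ l" "p ^ l dvd p ^ k"
    using l by (auto intro: le_imp_power_dvd)
  define S where "S = (\<Sum>(d, a)\<in>unit_pairs (p ^ k). f a * ec (p ^ l) (M * a + N * d))"
  define W where "W = (\<lambda>d a. \<Sum>y\<in>{0..<p ^ (t + e)}. ec (p ^ (t + e)) (y * (N * d - M * a) + p ^ t * y\<^sup>2 * (M * a)))"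
  have S: "S = (\<Sum>(d, a)\<in>unit_pairs (p ^ k). f a * ec (p ^ k) (p ^ s * M * a + p ^ s * N * d))"
    unfolding S_def
  proof (rule sum.cong[OF refl], clarify)
    fix d a
    show "f a * ec (p ^ l) (M * a + N * d) = f a * ec (p ^ k) (p ^ s * M * a + p ^ s * N * d)"
      using ec_mult_cancel[of "p ^ s" "p ^ l" "M * a + N * d"] p0
      by (simp add: l(5) power_add algebra_simps)
  qed
  have shift: "S = (\<Sum>(d, a)\<in>unit_pairs (p ^ k). f a * ec (p ^ l) (M * a + N * d)
      * ec (p ^ (t + e)) (y * (N * d - M * a) + p ^ t * y\<^sup>2 * (M * a)))" for y
  proof -
    define z where "z = p ^ t * y"
    have pz: "p dvd z"
      using pt by (simp add: z_def)
    have "[1 + z = 1] (mod p)"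
      using pz by (simp add: cong_iff_dvd_diff)
    then have "coprime (1 + z) (p ^ k)"
      using cong_imp_coprime[of 1 "1 + z" p] by (auto simp: cong_sym)
    then obtain u' where "[(1 + z) * u' = 1] (mod p ^ k)"
      using cong_solve_coprime_int by blast
    then have u': "[u' * (1 + z) = 1] (mod p ^ k)"
      by (simp add: mult.commute)
    \<comment> \<open>The inequality 3 t >= l follows from l >= 2. So 1 - z + z^2 inverts 1 + z
      modulo p^l; its quadratic term must be kept because 2 t < l for odd l.\<close>
    have "p ^ l dvd z ^ 3"
    proof -
      have "p ^ l dvd p ^ (t + t + t)"
        using l by (intro le_imp_power_dvd)
      then show ?thesis
        by (auto simp: z_def power_mult_distrib power_add power3_eq_cube ac_simps intro: dvd_mult2)
    qed
    moreover have "(1 - z + z\<^sup>2) * (1 + z) - 1 = z ^ 3"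
      by (simp add: algebra_simps power2_eq_square power3_eq_cube)
    ultimately have "[(1 - z + z\<^sup>2) * (1 + z) = 1] (mod p ^ l)"
      by (simp add: cong_iff_dvd_diff)
    moreover have "[u' * (1 + z) = 1] (mod p ^ l)"
      using u' pt cong_dvd_modulus by blast
    ultimately have u'_eq: "[u' = 1 - z + z\<^sup>2] (mod p ^ l)"
      by (intro cong_inverse_unique[of u' "1 + z" "p ^ l" _ "1 + z"] cong_refl)
    have "[u' = 1] (mod p)"
    proof -
      have "[u' = 1 - z + z\<^sup>2] (mod p)"
        using u'_eq pt cong_dvd_modulus by blast
      also have "[1 - z + z\<^sup>2 = 1] (mod p)"
        using pz by (simp add: cong_iff_dvd_diff dvd_diff power2_eq_square)
      finally show ?thesis .
    qed
    have "S = (\<Sum>(d, a)\<in>unit_pairs (p ^ k). f (a * u') * ec (p ^ l) (M * (a * u') + N * (d * (1 + z))))"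
      unfolding S_def
    proof (rule unit_pairs_scale[symmetric])
      fix d d' a a' assume *: "[d = d'] (mod p ^ k)" "[a = a'] (mod p ^ k)"
      have "[d = d'] (mod p ^ l)" "[a = a'] (mod p ^ l)" "[a = a'] (mod p)"
        using * pt cong_dvd_modulus dvd_trans by blast+
      then show "f a * ec (p ^ l) (M * a + N * d) = f a' * ec (p ^ l) (M * a' + N * d')"
        by (intro arg_cong2[where f = "(*)"] f ec_cong cong_add cong_mult cong_refl)
    qed (use p0 u' in auto)
    also have "\<dots> = (\<Sum>(d, a)\<in>unit_pairs (p ^ k). f a * ec (p ^ l) (M * a + N * d)
      * ec (p ^ (t + e)) (y * (N * d - M * a) + p ^ t * y\<^sup>2 * (M * a)))"
    proof (rule sum.cong[OF refl], clarify)
      fix d a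
      have "f (a * u') = f (a * 1)"
        using \<open>[u' = 1] (mod p)\<close> by (intro f cong_mult cong_refl)
      moreover have "ec (p ^ l) (M * (a * u') + N * (d * (1 + z))) =
          ec (p ^ l) (M * (a * (1 - z + z\<^sup>2)) + N * (d * (1 + z)))"
        using u'_eq by (intro ec_cong cong_add cong_mult cong_refl)
      moreover have "M * (a * (1 - z + z\<^sup>2)) + N * (d * (1 + z)) =
          (M * a + N * d) + p ^ t * (y * (N * d - M * a) + p ^ t * y\<^sup>2 * (M * a))"
        by (simp add: z_def power2_eq_square algebra_simps)
      moreover have "ec (p ^ l) (p ^ t * x) = ec (p ^ (t + e)) x" for x
        using ec_mult_cancel[of "p ^ t" "p ^ (t + e)" x] p0 by (simp add: l(1) power_add mult.assoc)
      ultimately show "f (a * u') * ec (p ^ l) (M * (a * u') + N * (d * (1 + z))) =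
          f a * ec (p ^ l) (M * a + N * d) * ec (p ^ (t + e)) (y * (N * d - M * a) + p ^ t * y\<^sup>2 * (M * a))"
        by (simp add: ec_add)
    qed
    finally show ?thesis .
  qed
  have "of_int (p ^ (t + e)) * S = (\<Sum>y\<in>{0..<p ^ (t + e)}. S)"
    using p0 by simp
  also have "\<dots> = (\<Sum>y\<in>{0..<p ^ (t + e)}. \<Sum>(d, a)\<in>unit_pairs (p ^ k). f a * ec (p ^ l) (M * a + N * d)
      * ec (p ^ (t + e)) (y * (N * d - M * a) + p ^ t * y\<^sup>2 * (M * a)))"
    by (intro sum.cong refl shift)
  also have "\<dots> = (\<Sum>(d, a)\<in>unit_pairs (p ^ k). f a * ec (p ^ l) (M * a + N * d) * W d a)"
    unfolding W_def sum_distrib_left case_prod_unfold by (rule sum.swap)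
  finally have "norm (of_int (p ^ (t + e)) * S) \<le> (\<Sum>(d, a)\<in>unit_pairs (p ^ k). norm (f a * ec (p ^ l) (M * a + N * d) * W d a))"
    unfolding case_prod_unfold by (simp only: norm_sum)
  also have "\<dots> \<le> (\<Sum>(d, a)\<in>unit_pairs (p ^ k). if p ^ t dvd N * d - M * a then of_int (p ^ t) * sqrt (of_int (p ^ e)) else 0)"
  proof (rule sum_mono, clarify)
    fix d a assume da: "(d, a) \<in> unit_pairs (p ^ k)"
    have "norm (W d a) = (if p ^ t dvd N * d - M * a then of_int (p ^ t) * sqrt (of_int (p ^ e)) else 0)"
      unfolding W_def
      by (intro norm_stationary_phase_integral p l card_stationary_points(2)[OF p l(2) l(6) MN da])
    moreover have "norm (f a * ec (p ^ l) (M * a + N * d) * W d a) \<le> 1 * norm (W d a)"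
      unfolding norm_mult norm_ec using f1[of a] by (intro mult_right_mono) auto
    ultimately show "norm (f a * ec (p ^ l) (M * a + N * d) * W d a) \<le>
        (if p ^ t dvd N * d - M * a then of_int (p ^ t) * sqrt (of_int (p ^ e)) else 0)"
      by simp
  qed
  also have "\<dots> = real (card {(d, a) \<in> unit_pairs (p ^ k). p ^ t dvd N * d - M * a}) * (of_int (p ^ t) * sqrt (of_int (p ^ e)))"
    by (simp add: case_prod_unfold sum.If_cases Int_def)
  also have "\<dots> \<le> real (2 * nat (p ^ (k - t))) * (of_int (p ^ t) * sqrt (of_int (p ^ e)))"
    using p0 by (intro mult_right_mono of_nat_mono card_stationary_points(1)[OF p l(2) l(6) MN]) auto
  finally have *: "of_int p ^ (t + e) * norm S \<le> 2 * of_int p ^ (k - t) * (of_int p ^ t * sqrt (of_int p ^ e))"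
    using p0 by (simp add: norm_mult norm_power)
  \<comment> \<open>Squaring turns the half-integral exponents into the identity 2 (k - t) + 2 t + e
    = 2 (t + e) + (k + s).\<close>
  have "(2 * of_int p ^ (k - t) * (of_int p ^ t * sqrt (of_int p ^ e)) :: real) =
      of_int p ^ (t + e) * (2 * sqrt (of_int p ^ (k + s)))"
  proof (rule power2_eq_imp_eq)
    have "(of_int p ^ (k - t))\<^sup>2 * (of_int p ^ t)\<^sup>2 * of_int p ^ e = (of_int p ^ (t + e))\<^sup>2 * (of_int p ^ (k + s) :: real)"
      unfolding power_mult[symmetric] power_add[symmetric] using l by (intro arg_cong[where f = "power (of_int p)"]) auto
    then show "(2 * of_int p ^ (k - t) * (of_int p ^ t * sqrt (of_int p ^ e)))\<^sup>2 =
        ((of_int p ^ (t + e) * (2 * sqrt (of_int p ^ (k + s))))\<^sup>2 :: real)"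
      using p0 by (simp add: power_mult_distrib ac_simps)
  qed (use p0 in auto)
  with * have "of_int p ^ (t + e) * norm S \<le> of_int p ^ (t + e) * (2 * sqrt (of_int p ^ (k + s)))"
    by simp
  then have "norm S \<le> 2 * sqrt (of_int p ^ (k + s))"
    using p0 by (simp add: mult_le_cancel_left_pos del: mult_le_cancel_left)
  then show ?thesis
    by (simp add: S)
qed

section \<open>Assembling the one-dimensional bound at a prime power\<close>

lemma norm_unit_pairs_sum_le:
  assumes "c > 0" "\<And>d a. (d, a) \<in> unit_pairs c \<Longrightarrow> norm (F d a) \<le> B"
  shows "norm (\<Sum>(d, a)\<in>unit_pairs c. F d a) \<le> of_int c * B"
proof (cases "unit_pairs c = {}")
  case False
  then have "B \<ge> 0"
    using assms(2) order_trans[OF norm_ge_zero] by fast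
  have "norm (\<Sum>(d, a)\<in>unit_pairs c. F d a) \<le> real (card (unit_pairs c)) * B"
    using assms(2) by (intro sum_norm_bound) auto
  also have "\<dots> \<le> of_int c * B"
    using card_unit_pairs_le[OF assms(1)] \<open>B \<ge> 0\<close> assms(1) by (intro mult_right_mono) linarith
  finally show ?thesis .
next
  case True
  have "(1, 1) \<in> unit_pairs c \<or> c = 1"
    using assms(1) by (auto simp: unit_pairs_def)
  moreover have "(0, 0) \<in> unit_pairs 1"
    by (simp add: unit_pairs_def)
  ultimately show ?thesis
    using True by auto
qed

lemma norm_ramanujan_sum_le:
  fixes p :: int
  assumes p: "prime p" and MN: "p dvd M \<longleftrightarrow> \<not> p dvd N"
  shows "norm (\<Sum>(d, a)\<in>unit_pairs p. ec p (M * a + N * d)) \<le> 1"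
proof (cases "p dvd M")
  case True
  then have "(\<Sum>(d, a)\<in>unit_pairs p. ec p (M * a + N * d)) = (\<Sum>(d, a)\<in>unit_pairs p. ec p (N * d))"
    by (intro sum.cong refl) (auto intro!: ec_cong simp: cong_iff_dvd_diff)
  then show ?thesis
    using True MN by (simp add: ramanujan_sum_prime[OF p])
next
  case False
  then have "(\<Sum>(d, a)\<in>unit_pairs p. ec p (M * a + N * d)) = (\<Sum>(d, a)\<in>unit_pairs p. ec p (M * a))"
    using MN by (intro sum.cong refl) (auto intro!: ec_cong simp: cong_iff_dvd_diff)
  also have "\<dots> = (\<Sum>(d, a)\<in>unit_pairs p. ec p (M * d))"
    by (rule unit_pairs_swap)
  finally show ?thesis
    using False by (simp add: ramanujan_sum_prime[OF p])
qed

text \<open>The factor v^2 contributes an even exponent, so an odd exponent of p cannot come from it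
  alone.\<close>

lemma prime_dvd_of_odd_multiplicity:
  fixes p :: int
  assumes p: "prime p" and s: "odd s" and m: "m0 * v\<^sup>2 = p ^ s * m'" "\<not> p dvd m'"
  shows "p dvd m0"
proof (rule ccontr)
  assume m0: "\<not> p dvd m0"
  have pe: "prime_elem p" using p by (rule prime_imp_prime_elem)
  have nz: "m0 \<noteq> 0" "v \<noteq> 0" "m' \<noteq> 0" "p \<noteq> 0"
    using m p m0 by auto
  have "multiplicity p (m0 * v\<^sup>2) = 2 * multiplicity p v"
    using multiplicity_prime_elem_times_other[OF pe m0, of "v\<^sup>2"] prime_elem_multiplicity_power_distrib[OF pe nz(2), of 2] by simp
  moreover have "multiplicity p (p ^ s * m') = s"
    using multiplicity_prime_elem_times_other[OF pe m(2), of "p ^ s"] multiplicity_prime_power[OF pe, of s] by (simp add: mult.commute)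
  ultimately show False
    using s m(1) by simp
qed

lemma legendre_power:
  assumes "\<not> p dvd a"
  shows "Legendre a p ^ k = (if even k then 1 else Legendre a p)"
  using legendre_cases[OF assms] by auto

text \<open>As p^s divides n, it divides gcd(m0 n, p^k), so a bound 2 sqrt(p^(k + s)) suffices.
  Every case either reaches it or has p^k | m0 n, where counting the terms is enough.\<close>

lemma norm_local_kloosterman:
  fixes p :: int
  assumes p: "prime p" "p > 2" and k: "k \<ge> 1" and \<mu>: "\<not> p dvd \<mu>" and m: "m = m0 * v\<^sup>2"
  shows "norm (\<Sum>(d, a)\<in>unit_pairs (p ^ k). of_int (Legendre a p) ^ k * ec (p ^ k) (\<mu> * m * a + \<mu> * n * d))
    \<le> 2 * sqrt (of_int (gcd (m0 * n) (p ^ k))) * sqrt (of_int (p ^ k))"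
    (is "norm ?S \<le> _")
proof -
  have p0: "p > 0" "p \<noteq> 0" using p by auto
  have unit: "\<not> p dvd a" if "(d, a) \<in> unit_pairs (p ^ k)" for d a
  proof -
    have "[a * d = 1] (mod p)"
      using that k cong_dvd_modulus[of "a * d" 1 "p ^ k" p] by (auto simp: unit_pairs_def dvd_power)
    then show ?thesis
      using p by (metis cong_dvd_iff dvd_mult2 not_prime_unit)
  qed
  have leg: "norm (of_int (Legendre a p) :: complex) \<le> 1" for a
    by (auto simp: Legendre_def)
  have triv: "norm ?S \<le> of_int (p ^ k) * 1"
    using p0 leg by (intro norm_unit_pairs_sum_le) (auto simp: norm_mult norm_power power_le_one)
  have trivial_case: ?thesis if "p ^ k dvd m0 * n"
  proof -
    have "gcd (m0 * n) (p ^ k) = p ^ k"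
      using that p0 by (simp add: gcd_proj2_iff)
    then have "sqrt (of_int (gcd (m0 * n) (p ^ k))) * sqrt (of_int (p ^ k)) = (of_int (p ^ k) :: real)"
      using p0 by simp
    then have "2 * sqrt (of_int (gcd (m0 * n) (p ^ k))) * sqrt (of_int (p ^ k)) = 2 * (of_int (p ^ k) :: real)"
      by simp
    moreover have "(of_int (p ^ k) :: real) \<ge> 0"
      using p0 by simp
    ultimately show ?thesis
      using triv by linarith
  qed
  \<comment> \<open>The exponent is capped at k, so that the maximum exists also when m and n are
    both 0.\<close>
  define s where "s = Max {i. i \<le> k \<and> p ^ i dvd m \<and> p ^ i dvd n}"
  have fin: "finite {i. i \<le> k \<and> p ^ i dvd m \<and> p ^ i dvd n}"
    by (rule finite_subset[of _ "{..k}"]) auto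
  have "s \<in> {i. i \<le> k \<and> p ^ i dvd m \<and> p ^ i dvd n}"
    unfolding s_def by (rule Max_in[OF fin]) (auto intro: exI[of _ 0])
  then have s: "s \<le> k" "p ^ s dvd m" "p ^ s dvd n"
    by auto
  have s_max: "i \<le> s" if "i \<le> k" "p ^ i dvd m" "p ^ i dvd n" for i
    unfolding s_def using fin that by (intro Max_ge) auto
  show ?thesis
  proof (cases "s = k")
    case True
    then show ?thesis
      using s by (intro trivial_case) auto
  next
    case False
    then have sk: "s < k" using s by simp
    obtain m' n' where m': "m = p ^ s * m'" and n': "n = p ^ s * n'"
      using s by (elim dvdE)
    have not_both: "\<not> (p dvd m' \<and> p dvd n')"
    proof
      assume "p dvd m' \<and> p dvd n'"
      then have "p ^ Suc s dvd m" "p ^ Suc s dvd n"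
        by (auto simp: m' n' mult.commute intro: mult_dvd_mono)
      then show False
        using s_max[of "Suc s"] sk by simp
    qed
    then have MN: "\<not> (p dvd \<mu> * m' \<and> p dvd \<mu> * n')"
      using \<mu> p by (simp add: prime_dvd_mult_iff)
    have "p ^ s dvd gcd (m0 * n) (p ^ k)"
      using s by (intro gcd_greatest) (auto intro: le_imp_power_dvd)
    then have "p ^ s \<le> gcd (m0 * n) (p ^ k)"
      using p0 by (intro zdvd_imp_le) auto
    then have "p ^ s * p ^ k \<le> gcd (m0 * n) (p ^ k) * p ^ k"
      using p0 by (intro mult_right_mono) auto
    then have "sqrt (of_int (p ^ s * p ^ k)) \<le> sqrt (of_int (gcd (m0 * n) (p ^ k) * p ^ k))"
      by (simp only: real_sqrt_le_iff of_int_le_iff)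
    then have suff: "sqrt (of_int (p ^ (k + s))) \<le> sqrt (of_int (gcd (m0 * n) (p ^ k))) * sqrt (of_int (p ^ k))"
      by (simp add: power_add real_sqrt_mult mult.commute)
    have S: "?S = (\<Sum>(d, a)\<in>unit_pairs (p ^ k). of_int (Legendre a p) ^ k * ec (p ^ k) (p ^ s * (\<mu> * m') * a + p ^ s * (\<mu> * n') * d))"
      by (intro sum.cong refl) (simp add: m' n' ac_simps)
    show ?thesis
    proof (cases "s + 2 \<le> k")
      case True
      have "norm ?S \<le> 2 * sqrt (of_int (p ^ (k + s)))"
        unfolding S using p True MN leg
        by (intro norm_kloosterman_prime_power) (auto simp: norm_power power_le_one dest: legendre_cong)
      then show ?thesis
        using suff by linarith
    next
      case False
      then have s1: "k = Suc s" using sk by simp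
      let ?T = "\<Sum>(d, a)\<in>unit_pairs p. of_int (Legendre a p) ^ k * ec p (\<mu> * m' * a + \<mu> * n' * d)"
      have "?S = (\<Sum>(d, a)\<in>unit_pairs (p ^ k). of_int (Legendre a p) ^ k * ec p (\<mu> * m' * a + \<mu> * n' * d))"
        unfolding S
      proof (intro sum.cong refl, clarify)
        fix d a
        show "of_int (Legendre a p) ^ k * ec (p ^ k) (p ^ s * (\<mu> * m') * a + p ^ s * (\<mu> * n') * d) =
            of_int (Legendre a p) ^ k * ec p (\<mu> * m' * a + \<mu> * n' * d)"
          using ec_mult_cancel[of "p ^ s" p "\<mu> * m' * a + \<mu> * n' * d"] p0 by (simp add: s1 algebra_simps)
      qed
      also have "\<dots> = of_int (p ^ (k - 1)) * ?T"
      proof (rule unit_pairs_prime_power)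
        fix d d' a a' assume *: "[d = d'] (mod p)" "[a = a'] (mod p)"
        then have "ec p (\<mu> * m' * a + \<mu> * n' * d) = ec p (\<mu> * m' * a' + \<mu> * n' * d')"
          by (intro ec_cong cong_add cong_mult cong_refl)
        then show "of_int (Legendre a p) ^ k * ec p (\<mu> * m' * a + \<mu> * n' * d) =
            of_int (Legendre a' p) ^ k * ec p (\<mu> * m' * a' + \<mu> * n' * d')"
          using legendre_cong[OF *(2)] by simp
      qed (use p k in auto)
      finally have ST: "norm ?S = of_int (p ^ s) * norm ?T"
        using p0 by (simp add: norm_mult norm_power s1)
      have unit1: "\<not> p dvd a" if "(d, a) \<in> unit_pairs p" for d a
        using that p by (auto simp: unit_pairs_def) (metis cong_dvd_iff dvd_mult2 not_prime_unit)
      have T: "?T = (\<Sum>(d, a)\<in>unit_pairs p. of_int (if even k then 1 else Legendre a p) * ec p (\<mu> * m' * a + \<mu> * n' * d))"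
      proof (intro sum.cong refl, clarify)
        fix d a assume "(d, a) \<in> unit_pairs p"
        then have "Legendre a p ^ k = (if even k then 1 else Legendre a p)"
          using unit1 legendre_power by blast
        then show "of_int (Legendre a p) ^ k * ec p (\<mu> * m' * a + \<mu> * n' * d) =
            of_int (if even k then 1 else Legendre a p) * ec p (\<mu> * m' * a + \<mu> * n' * d)"
          by (simp flip: of_int_power)
      qed
      have nontrivial: ?thesis if "norm ?T \<le> 2 * sqrt (of_int p)"
      proof -
        have "of_int (p ^ s) * norm ?T \<le> of_int (p ^ s) * (2 * sqrt (of_int p))"
          using that p0 by (intro mult_left_mono) auto
        also have "of_int (p ^ s) * (2 * sqrt (of_int p)) = 2 * sqrt (of_int (p ^ (k + s)))"
        proof -
          have "p ^ (k + s) = (p ^ s)\<^sup>2 * p"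
            by (simp add: s1 power_add power2_eq_square)
          then show ?thesis
            using p0 by (simp add: real_sqrt_mult)
        qed
        finally show ?thesis
          using ST suff by linarith
      qed
      show ?thesis
      proof (cases "even k")
        case False
        then show ?thesis
          using norm_salie[OF p MN] T by (intro nontrivial) simp
      next
        case True
        show ?thesis
        proof (cases "p dvd \<mu> * m' \<longleftrightarrow> \<not> p dvd \<mu> * n'")
          case ex: True
          have "sqrt (of_int p) \<ge> 1"
            using p by simp
          moreover have "norm ?T \<le> 1"
            using norm_ramanujan_sum_le[OF p(1) ex] T True by simp
          ultimately show ?thesis
            by (intro nontrivial) linarith
        next
          \<comment> \<open>Here p divides neither m' nor n', so s = k - 1 is the exact exponent of
            p in m and is odd. Hence p | m0, and together with p^s | n this gives p^k | m0
            n.\<close>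
          case False
          then have "\<not> p dvd m'"
            using MN by auto
          moreover have "odd s"
            using True s1 by simp
          ultimately have "p dvd m0"
            using prime_dvd_of_odd_multiplicity[OF p(1), of s m0 v m'] m m' by simp
          then have "p * p ^ s dvd m0 * n"
            using s by (intro mult_dvd_mono)
          then show ?thesis
            by (intro trivial_case) (simp add: s1)
        qed
      qed
    qed
  qed
qed

section \<open>Coordinates and duality\<close>

context even_lattice
begin

abbreviation lbasis :: "nat \<Rightarrow> 'v" where
  "lbasis i \<equiv> some_basis ! i"

text \<open>Coordinates are indexed by position instead of by basis vector, to match the rows of the
  Gram matrix.\<close>

definition lcomb :: "(nat \<Rightarrow> rat) \<Rightarrow> 'v" where
  "lcomb r = (\<Sum>i<lattice_rank. scale (r i) (lbasis i))"

lemma lattice_basis_some_basis: "lattice_basis L some_basis"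
  unfolding some_basis_def using free by (rule someI_ex)

lemma sum_some_basis: "(\<Sum>b\<in>set some_basis. f b) = (\<Sum>i<lattice_rank. f (lbasis i))"
  using lattice_basis_some_basis
  by (intro sum.reindex_bij_betw[symmetric] bij_betw_nth) (auto simp: lattice_basis_def lattice_rank_def)

lemma ex_reindex_some_basis: "\<exists>r'. \<forall>i<lattice_rank. r' (lbasis i) = r i"
proof -
  have "inj_on lbasis {..<lattice_rank}"
    using lattice_basis_some_basis by (auto simp: lattice_basis_def lattice_rank_def inj_on_nth)
  then show ?thesis
    by (intro exI[of _ "\<lambda>b. r (the_inv_into {..<lattice_rank} lbasis b)"]) (simp add: the_inv_into_f_f)
qed

lemma lcomb_surj: "\<exists>r. x = lcomb r"
proof -
  have "x \<in> span (set some_basis)"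
    using lattice_basis_some_basis by (simp add: lattice_basis_def)
  then obtain u where "x = (\<Sum>b\<in>set some_basis. scale (u b) b)"
    by (auto simp: span_finite)
  then show ?thesis
    by (auto simp: sum_some_basis lcomb_def intro: exI[of _ "\<lambda>i. u (lbasis i)"])
qed

lemma in_lattice_iff: "x \<in> L \<longleftrightarrow> (\<exists>z. x = lcomb (\<lambda>i. of_int (z i)))"
proof -
  have L: "L = range (\<lambda>z :: 'v \<Rightarrow> int. \<Sum>b\<in>set some_basis. scale (of_int (z b)) b)"
    using lattice_basis_some_basis by (simp add: lattice_basis_def)
  show ?thesis
  proof
    assume "x \<in> L"
    then obtain z :: "'v \<Rightarrow> int" where "x = (\<Sum>b\<in>set some_basis. scale (of_int (z b)) b)"
      by (subst (asm) L) blast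
    then show "\<exists>z. x = lcomb (\<lambda>i. of_int (z i))"
      by (auto simp: sum_some_basis lcomb_def intro: exI[of _ "\<lambda>i. z (lbasis i)"])
  next
    assume "\<exists>z. x = lcomb (\<lambda>i. of_int (z i))"
    then obtain z where z: "x = lcomb (\<lambda>i. of_int (z i))" by blast
    obtain z' where "\<forall>i<lattice_rank. z' (lbasis i) = z i"
      using ex_reindex_some_basis by blast
    then have "x = (\<Sum>b\<in>set some_basis. scale (of_int (z' b)) b)"
      by (simp add: z lcomb_def sum_some_basis)
    then show "x \<in> L"
      by (subst L) blast
  qed
qed

lemma lcomb_in_lattice [intro]: "lcomb (\<lambda>i. of_int (z i)) \<in> L"
  by (auto simp: in_lattice_iff)

lemma lcomb_add: "lcomb (\<lambda>i. r i + s i) = lcomb r + lcomb s"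
  by (simp add: lcomb_def scale_left_distrib sum.distrib)

lemma lcomb_diff: "lcomb (\<lambda>i. r i - s i) = lcomb r - lcomb s"
  by (simp add: lcomb_def scale_left_diff_distrib sum_subtractf)

lemma lcomb_scale: "lcomb (\<lambda>i. a * r i) = scale a (lcomb r)"
  by (simp add: lcomb_def scale_sum_right)

lemma lcomb_eq_0: "lcomb r = 0 \<Longrightarrow> i < lattice_rank \<Longrightarrow> r i = 0"
proof -
  assume r: "lcomb r = 0" and i: "i < lattice_rank"
  obtain r' where r': "\<forall>i<lattice_rank. r' (lbasis i) = r i"
    using ex_reindex_some_basis by blast
  then have "(\<Sum>b\<in>set some_basis. scale (r' b) b) = 0"
    using r by (simp add: lcomb_def sum_some_basis)
  then have "r' (lbasis i) = 0"
    using lattice_basis_some_basis i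
    by (intro independentD[of "set some_basis" "set some_basis" r']) (auto simp: lattice_basis_def lattice_rank_def)
  then show "r i = 0"
    using r' i by simp
qed

lemma lcomb_inject: "lcomb r = lcomb s \<Longrightarrow> i < lattice_rank \<Longrightarrow> r i = s i"
  using lcomb_eq_0[of "\<lambda>i. r i - s i" i] by (simp add: lcomb_diff)

lemma lattice_add: "x \<in> L \<Longrightarrow> y \<in> L \<Longrightarrow> x + y \<in> L"
proof -
  assume "x \<in> L" "y \<in> L"
  then obtain z z' where "x = lcomb (\<lambda>i. of_int (z i))" "y = lcomb (\<lambda>i. of_int (z' i))"
    by (auto simp: in_lattice_iff)
  then have "x + y = lcomb (\<lambda>i. of_int (z i + z' i))"
    by (simp add: lcomb_add)
  then show "x + y \<in> L"
    by (simp only: lcomb_in_lattice)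
qed

lemma lattice_scale: "x \<in> L \<Longrightarrow> scale (of_int a) x \<in> L"
proof -
  assume "x \<in> L"
  then obtain z where "x = lcomb (\<lambda>i. of_int (z i))"
    by (auto simp: in_lattice_iff)
  then have "scale (of_int a) x = lcomb (\<lambda>i. of_int (a * z i))"
    by (simp add: lcomb_scale)
  then show "scale (of_int a) x \<in> L"
    by (simp only: lcomb_in_lattice)
qed

lemma lattice_uminus: "x \<in> L \<Longrightarrow> - x \<in> L"
  using lattice_scale[of x "-1"] by simp

lemma lattice_diff: "x \<in> L \<Longrightarrow> y \<in> L \<Longrightarrow> x - y \<in> L"
  using lattice_add[of x "- y"] lattice_uminus[of y] by simp

lemma lattice_0 [simp, intro]: "0 \<in> L"
  using lcomb_in_lattice[of "\<lambda>_. 0"] by (simp add: lcomb_def)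

lemma lbasis_in_lattice: "i < lattice_rank \<Longrightarrow> lbasis i \<in> L"
proof -
  assume i: "i < lattice_rank"
  have "lcomb (\<lambda>j. of_int (if j = i then 1 else 0)) = (\<Sum>j<lattice_rank. if j = i then lbasis i else 0)"
    unfolding lcomb_def by (intro sum.cong) auto
  also have "\<dots> = lbasis i"
    using i by simp
  finally show "lbasis i \<in> L"
    using lcomb_in_lattice by metis
qed

lemma form_add_right: "form x (y + z) = form x y + form x z"
  by (metis form_add_left form_sym)

lemma form_scale_right: "form x (scale a y) = a * form x y"
  by (metis form_scale_left form_sym)

lemma form_0_left [simp]: "form 0 x = 0"
  using form_scale_left[of 0 0 x] by simp

lemma form_0_right [simp]: "form x 0 = 0"
  using form_sym[of x 0] by simp

lemma form_uminus_left: "form (- x) y = - form x y"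
  using form_scale_left[of "-1" x y] by simp

lemma form_uminus_right: "form x (- y) = - form x y"
  using form_scale_right[of x "-1" y] by simp

lemma form_diff_left: "form (x - y) z = form x z - form y z"
  using form_add_left[of x "- y" z] by (simp add: form_uminus_left)

lemma form_diff_right: "form x (y - z) = form x y - form x z"
  using form_add_right[of x y "- z"] by (simp add: form_uminus_right)

lemmas form_bilinear = form_add_left form_add_right form_diff_left form_diff_right
  form_scale_left form_scale_right form_uminus_left form_uminus_right

lemma form_sum_left: "form (\<Sum>i\<in>I. f i) y = (\<Sum>i\<in>I. form (f i) y)"
  by (induction I rule: infinite_finite_induct) (simp_all add: form_add_left)

lemma form_sum_right: "form y (\<Sum>i\<in>I. f i) = (\<Sum>i\<in>I. form y (f i))"
  by (induction I rule: infinite_finite_induct) (simp_all add: form_add_right)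

lemma q_add: "q (x + y) = q x + form x y + q y"
  by (simp add: q_def form_bilinear form_sym[of y x] add_divide_distrib)

lemma q_scale: "q (scale a x) = a\<^sup>2 * q x"
  by (simp add: q_def form_bilinear power2_eq_square)

lemma q_integral: "x \<in> L \<Longrightarrow> q x \<in> \<int>"
  using form_even[of x] by (auto simp: q_def)

lemma lattice_subset_dual: "x \<in> L \<Longrightarrow> x \<in> dual_lattice"
  by (simp add: dual_lattice_def form_integral)

lemma form_dual_integral: "x \<in> dual_lattice \<Longrightarrow> y \<in> L \<Longrightarrow> form x y \<in> \<int>"
  by (simp add: dual_lattice_def)

lemma form_dual_integral': "x \<in> dual_lattice \<Longrightarrow> y \<in> L \<Longrightarrow> form y x \<in> \<int>"
  by (metis form_dual_integral form_sym)

definition gram :: "int mat" where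
  "gram = mat lattice_rank lattice_rank (\<lambda>(i, j). \<lfloor>form (lbasis i) (lbasis j)\<rfloor>)"

lemma lattice_det_eq: "lattice_det = det gram"
  by (simp add: lattice_det_def gram_def)

lemma gram_carrier [simp]: "gram \<in> carrier_mat lattice_rank lattice_rank"
  by (simp add: gram_def)

lemma of_int_gram:
  "i < lattice_rank \<Longrightarrow> j < lattice_rank \<Longrightarrow> of_int (gram $$ (i, j)) = form (lbasis i) (lbasis j)"
  using form_integral[of "lbasis i" "lbasis j"] lbasis_in_lattice
  by (simp add: gram_def of_int_floor)

lemma form_lbasis_lcomb:
  "i < lattice_rank \<Longrightarrow> form (lbasis i) (lcomb r) = (\<Sum>j<lattice_rank. of_int (gram $$ (i, j)) * r j)"
  unfolding lcomb_def by (simp add: form_sum_right form_scale_right of_int_gram mult.commute)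

text \<open>With G the Gram matrix and r the coordinates of x, the vector G r is integral for x in
  the dual lattice, and adj(G) G r = \<Delta> r. This is how denominators are cleared in all later
  sections.\<close>

lemma det_scale_dual:
  assumes x: "x \<in> dual_lattice"
  shows "scale (of_int lattice_det) x \<in> L"
proof -
  let ?n = lattice_rank
  define A where "A = adj_mat gram"
  have A: "A \<in> carrier_mat ?n ?n" "A * gram = det gram \<cdot>\<^sub>m 1\<^sub>m ?n"
    using adj_mat[OF gram_carrier] by (auto simp: A_def)
  obtain r where r: "x = lcomb r" using lcomb_surj by blast
  have A_gram: "(\<Sum>i<?n. A $$ (j, i) * gram $$ (i, k)) = (if j = k then lattice_det else 0)"
    if "j < ?n" "k < ?n" for j k
  proof -
    have "(A * gram) $$ (j, k) = (\<Sum>i<?n. A $$ (j, i) * gram $$ (i, k))"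
      using A(1) that by (simp add: scalar_prod_def gram_def lessThan_atLeast0)
    then show ?thesis
      using that by (cases "j = k") (simp_all add: A(2) lattice_det_eq)
  qed
  have int: "form (lbasis i) x \<in> \<int>" if "i < ?n" for i
    using x lbasis_in_lattice[OF that] by (rule form_dual_integral')
  have coord: "(\<Sum>i<?n. of_int (A $$ (j, i)) * form (lbasis i) x) = of_int lattice_det * r j" if j: "j < ?n" for j
  proof -
    have "(\<Sum>i<?n. of_int (A $$ (j, i)) * form (lbasis i) x) =
        (\<Sum>i<?n. \<Sum>k<?n. of_int (A $$ (j, i) * gram $$ (i, k)) * r k)"
      by (simp add: r form_lbasis_lcomb sum_distrib_left mult.assoc)
    also have "\<dots> = (\<Sum>k<?n. of_int (\<Sum>i<?n. A $$ (j, i) * gram $$ (i, k)) * r k)"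
      by (subst sum.swap) (simp add: sum_distrib_right)
    also have "\<dots> = (\<Sum>k<?n. if k = j then of_int lattice_det * r j else 0)"
      using j by (intro sum.cong) (auto simp: A_gram simp del: of_int_sum)
    finally show ?thesis using j by simp
  qed
  have "\<exists>z :: int. of_int lattice_det * r j = of_int z" if "j < ?n" for j
  proof -
    have "(\<Sum>i<?n. of_int (A $$ (j, i)) * form (lbasis i) x) \<in> \<int>"
      using int by (intro Ints_sum Ints_mult) auto
    then show ?thesis
      unfolding coord[OF that] by (auto elim: Ints_cases)
  qed
  then obtain z :: "nat \<Rightarrow> int" where z: "\<And>j. j < ?n \<Longrightarrow> of_int lattice_det * r j = of_int (z j)"
    by metis
  have "scale (of_int lattice_det) x = lcomb (\<lambda>j. of_int lattice_det * r j)"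
    by (simp add: r lcomb_scale)
  also have "\<dots> = lcomb (\<lambda>j. of_int (z j))"
    unfolding lcomb_def by (intro sum.cong) (simp_all add: z)
  finally show ?thesis by auto
qed

text \<open>An integral kernel vector of the Gram matrix would be a lattice vector orthogonal to
  everything.\<close>

lemma lattice_det_nonzero: "lattice_det \<noteq> 0"
proof
  assume "lattice_det = 0"
  then obtain u where u: "u \<in> carrier_vec lattice_rank" "u \<noteq> 0\<^sub>v lattice_rank" "gram *\<^sub>v u = 0\<^sub>v lattice_rank"
    using det_0_iff_vec_prod_zero[OF gram_carrier] by (auto simp: lattice_det_eq)
  define x where "x = lcomb (\<lambda>i. of_int (u $ i))"
  have "form (lbasis i) x = 0" if "i < lattice_rank" for i
  proof -
    have "(gram *\<^sub>v u) $ i = (\<Sum>j<lattice_rank. gram $$ (i, j) * u $ j)"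
      using u(1) that by (simp add: scalar_prod_def gram_def lessThan_atLeast0)
    then have "(\<Sum>j<lattice_rank. gram $$ (i, j) * u $ j) = 0"
      using u(3) that by simp
    then have "of_int (\<Sum>j<lattice_rank. gram $$ (i, j) * u $ j) = (0 :: rat)"
      by simp
    then show ?thesis
      using that by (simp add: x_def form_lbasis_lcomb)
  qed
  then have "form y x = 0" for y
    using lcomb_surj[of y] by (auto simp: lcomb_def form_sum_left form_scale_left)
  then have "x = 0"
    by (intro form_nondegenerate) (auto simp: x_def form_sym)
  then have "u $ i = 0" if "i < lattice_rank" for i
    using lcomb_eq_0[of "\<lambda>i. of_int (u $ i)" i] that by (simp add: x_def)
  then have "u = 0\<^sub>v lattice_rank"
    using u(1) by (intro eq_vecI) auto
  with u(2) show False by simp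
qed

end

lemma det_cong:
  fixes A B :: "int mat"
  assumes "A \<in> carrier_mat n n" "B \<in> carrier_mat n n"
    and "\<And>i j. i < n \<Longrightarrow> j < n \<Longrightarrow> [A $$ (i, j) = B $$ (i, j)] (mod c)"
  shows "[det A = det B] (mod c)"
  unfolding det_def'[OF assms(1)] det_def'[OF assms(2)]
proof (intro cong_sum cong_mult cong_refl cong_prod)
  fix \<pi> i assume "\<pi> \<in> {\<pi>. \<pi> permutes {0..<n}}" "i \<in> {0..<n}"
  then show "[A $$ (i, \<pi> i) = B $$ (i, \<pi> i)] (mod c)"
    using assms(3)[of i "\<pi> i"] by (auto simp: permutes_in_image)
qed

text \<open>Modulo 2 such a matrix is skew-symmetric, and skew-symmetric matrices of odd size are singular.\<close>

lemma even_det_of_odd_size: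
  fixes A :: "int mat"
  assumes A: "A \<in> carrier_mat n n" and n: "odd n"
    and sym: "\<And>i j. i < n \<Longrightarrow> j < n \<Longrightarrow> A $$ (i, j) = A $$ (j, i)"
    and diag: "\<And>i. i < n \<Longrightarrow> even (A $$ (i, i))"
  shows "even (det A)"
proof -
  define S where "S = mat n n (\<lambda>(i, j). if i < j then A $$ (i, j) else if j < i then - A $$ (i, j) else 0)"
  have S: "S \<in> carrier_mat n n"
    by (simp add: S_def)
  have "transpose_mat S = (- 1) \<cdot>\<^sub>m S"
    using sym by (intro eq_matI) (auto simp: S_def)
  then have "det S = (- 1) ^ n * det S"
    using det_transpose[OF S] S by (metis det_smult carrier_matD(2))
  then have "det S = 0"
    using n by simp
  moreover have "[det A = det S] (mod 2)"
  proof (rule det_cong[OF A S])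
    fix i j assume "i < n" "j < n"
    then show "[A $$ (i, j) = S $$ (i, j)] (mod 2)"
      using diag by (auto simp: S_def cong_iff_dvd_diff linorder_neq_iff)
  qed
  ultimately show ?thesis
    by (simp add: cong_0_iff)
qed

lemma (in even_lattice) even_lattice_det:
  assumes "odd lattice_rank"
  shows "even lattice_det"
  unfolding lattice_det_eq
proof (rule even_det_of_odd_size[OF gram_carrier assms])
  fix i j assume "i < lattice_rank" "j < lattice_rank"
  then show "gram $$ (i, j) = gram $$ (j, i)"
    by (simp add: gram_def form_sym)
next
  fix i assume i: "i < lattice_rank"
  obtain j :: int where "form (lbasis i) (lbasis i) = 2 * of_int j"
    using form_even[OF lbasis_in_lattice[OF i]] by blast
  then have "(of_int (gram $$ (i, i)) :: rat) = of_int (2 * j)"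
    using of_int_gram[OF i i] by simp
  then show "even (gram $$ (i, i))"
    by (simp only: of_int_eq_iff dvd_triv_left)
qed

section \<open>Sums over residue classes of a lattice\<close>

context even_lattice
begin

definition multiples :: "int \<Rightarrow> 'v set" where
  "multiples c = scale (of_int c) ` L"

text \<open>The sum over L / c L exactly as it occurs in \<open>weil_coeff\<close>, with an
  arbitrary representative of each class; it has its intended meaning for functions that are
  \<open>periodic\<close>.\<close>

definition lsum :: "int \<Rightarrow> ('v \<Rightarrow> complex) \<Rightarrow> complex" where
  "lsum c F = (\<Sum>R\<in>L // coset_rel (multiples c). F (SOME r. r \<in> R))"

definition periodic :: "int \<Rightarrow> ('v \<Rightarrow> complex) \<Rightarrow> bool" where
  "periodic c F \<longleftrightarrow> (\<forall>r\<in>L. \<forall>h\<in>L. F (r + scale (of_int c) h) = F r)"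

definition box :: "int \<Rightarrow> (nat \<Rightarrow> int) set" where
  "box c = PiE {..<lattice_rank} (\<lambda>_. {0..<c})"

definition box_point :: "(nat \<Rightarrow> int) \<Rightarrow> 'v" where
  "box_point x = lcomb (\<lambda>i. of_int (x i))"

lemma multiplesI: "h \<in> L \<Longrightarrow> scale (of_int c) h \<in> multiples c"
  by (auto simp: multiples_def)

lemma multiplesE:
  assumes "x \<in> multiples c"
  obtains h where "h \<in> L" "x = scale (of_int c) h"
  using assms by (auto simp: multiples_def)

lemma periodic_diff:
  assumes "periodic c F" "x \<in> L" "y \<in> L" "x - y \<in> multiples c"
  shows "F x = F y"
proof -
  obtain h where h: "h \<in> L" "x - y = scale (of_int c) h"
    using assms(4) by (rule multiplesE)
  then have "x = y + scale (of_int c) h"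
    by (simp add: algebra_simps)
  then show ?thesis
    using assms(1,3) h(1) by (simp add: periodic_def)
qed

lemma multiples_0 [simp]: "0 \<in> multiples c"
  using multiplesI[of 0 c] by simp

lemma multiples_lattice: "x \<in> multiples c \<Longrightarrow> x \<in> L"
  by (elim multiplesE) (simp add: lattice_scale)

lemma multiples_scale:
  assumes "x \<in> multiples c"
  shows "scale (of_int a) x \<in> multiples c"
proof -
  obtain h where h: "h \<in> L" "x = scale (of_int c) h"
    using assms by (rule multiplesE)
  have "scale (of_int a) x = scale (of_int c) (scale (of_int a) h)"
    by (simp add: h mult.commute)
  then show ?thesis
    using multiplesI[OF lattice_scale[OF h(1)], of c a] by (simp only:)
qed

lemma multiples_uminus: "x \<in> multiples c \<Longrightarrow> - x \<in> multiples c"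
  using multiples_scale[of x c "-1"] by simp

lemma multiples_add:
  assumes "x \<in> multiples c" "y \<in> multiples c"
  shows "x + y \<in> multiples c"
proof -
  obtain h where h: "h \<in> L" "x = scale (of_int c) h"
    using assms(1) by (rule multiplesE)
  obtain h' where h': "h' \<in> L" "y = scale (of_int c) h'"
    using assms(2) by (rule multiplesE)
  show ?thesis
    using multiplesI[OF lattice_add[OF h(1) h'(1)], of c] by (simp add: h h' scale_right_distrib)
qed

lemma multiples_mult:
  assumes "c dvd a" "x \<in> L"
  shows "scale (of_int a) x \<in> multiples c"
proof -
  obtain e where "a = c * e" using assms(1) by blast
  then have "scale (of_int a) x = scale (of_int c) (scale (of_int e) x)"
    by simp
  then show ?thesis
    using multiplesI[OF lattice_scale[OF assms(2)], of c e] by (simp only:)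
qed

lemma coset_self: "x \<in> coset_rel (multiples c) `` {x}"
  by (simp add: coset_rel_def)

lemma coset_eq_iff:
  "coset_rel (multiples c) `` {x} = coset_rel (multiples c) `` {y} \<longleftrightarrow> x - y \<in> multiples c"
proof
  assume "coset_rel (multiples c) `` {x} = coset_rel (multiples c) `` {y}"
  moreover note coset_self[of x c]
  ultimately show "x - y \<in> multiples c"
    by (simp add: coset_rel_def)
next
  assume *: "x - y \<in> multiples c"
  show "coset_rel (multiples c) `` {x} = coset_rel (multiples c) `` {y}"
  proof (intro equalityI subsetI)
    fix z assume "z \<in> coset_rel (multiples c) `` {x}"
    then have "(z - x) + (x - y) \<in> multiples c"
      using * by (intro multiples_add) (auto simp: coset_rel_def)
    then show "z \<in> coset_rel (multiples c) `` {y}"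
      by (simp add: coset_rel_def)
  next
    fix z assume "z \<in> coset_rel (multiples c) `` {y}"
    then have "(z - y) + - (x - y) \<in> multiples c"
      using * by (intro multiples_add multiples_uminus) (auto simp: coset_rel_def)
    then show "z \<in> coset_rel (multiples c) `` {x}"
      by (simp add: coset_rel_def)
  qed
qed

lemma box_point_lattice [simp]: "box_point x \<in> L"
  by (auto simp: box_point_def)

lemma finite_box [simp]: "finite (box c)"
  by (auto simp: box_def intro: finite_PiE)

lemma card_box: "card (box c) = nat c ^ lattice_rank"
  by (simp add: box_def card_PiE)

lemma box_point_diff_multiple:
  assumes "box_point x - box_point y \<in> multiples c" "i < lattice_rank"
  shows "[x i = y i] (mod c)"
proof -
  obtain h where h: "h \<in> L" "box_point x - box_point y = scale (of_int c) h"
    using assms(1) by (rule multiplesE)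
  then obtain z where z: "h = lcomb (\<lambda>i. of_int (z i))"
    by (auto simp: in_lattice_iff)
  have "lcomb (\<lambda>i. of_int (x i) - of_int (y i)) = lcomb (\<lambda>i. of_int c * of_int (z i))"
    using h z by (simp add: box_point_def lcomb_diff lcomb_scale)
  then have "(of_int (x i) - of_int (y i) :: rat) = of_int c * of_int (z i)"
    using assms(2) by (rule lcomb_inject)
  then have "(of_int (x i - y i) :: rat) = of_int (c * z i)"
    by simp
  then have "x i - y i = c * z i"
    by (simp only: of_int_eq_iff)
  then show ?thesis
    by (simp add: cong_iff_dvd_diff)
qed

lemma box_point_inj:
  assumes "x \<in> box c" "y \<in> box c" "box_point x - box_point y \<in> multiples c"
  shows "x = y"
proof (rule PiE_ext)
  show "x \<in> PiE {..<lattice_rank} (\<lambda>_. {0..<c})" "y \<in> PiE {..<lattice_rank} (\<lambda>_. {0..<c})"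
    using assms by (auto simp: box_def)
  fix i assume i: "i \<in> {..<lattice_rank}"
  then have "[x i = y i] (mod c)"
    using assms(3) by (intro box_point_diff_multiple) auto
  moreover have "x i \<in> {0..<c}" "y i \<in> {0..<c}"
    using assms i by (auto simp: box_def PiE_def)
  ultimately show "x i = y i"
    by (auto simp: cong_def)
qed

lemma box_point_surj:
  assumes "c > 0" "r \<in> L"
  shows "\<exists>x\<in>box c. r - box_point x \<in> multiples c"
proof -
  obtain z where z: "r = lcomb (\<lambda>i. of_int (z i))"
    using assms(2) in_lattice_iff by auto
  define x where "x = restrict (\<lambda>i. z i mod c) {..<lattice_rank}"
  have x_box: "x \<in> box c"
    using assms(1) by (auto simp: box_def x_def)
  have "r - box_point x = lcomb (\<lambda>i. of_int (z i) - of_int (x i))"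
    by (simp add: z box_point_def lcomb_diff)
  also have "\<dots> = lcomb (\<lambda>i. of_int c * of_int (z i div c))"
    unfolding lcomb_def
  proof (intro sum.cong refl arg_cong2[where f = scale])
    fix i assume "i \<in> {..<lattice_rank}"
    then have "z i - x i = c * (z i div c)"
      by (simp add: x_def minus_mod_eq_mult_div)
    then have "(of_int (z i - x i) :: rat) = of_int (c * (z i div c))"
      by (simp only:)
    then show "(of_int (z i) - of_int (x i) :: rat) = of_int c * of_int (z i div c)"
      by simp
  qed
  also have "\<dots> = scale (of_int c) (lcomb (\<lambda>i. of_int (z i div c)))"
    by (rule lcomb_scale)
  finally have "r - box_point x \<in> multiples c"
    by (simp only: multiplesI lcomb_in_lattice)
  with x_box show ?thesis by blast
qed

text \<open>A family of c^g lattice vectors pairwise incongruent modulo c L meets every class once,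
  the box giving the number of classes. This permits coordinates adapted to the problem: a box, an
  affine image of it, a product of two boxes, coefficients along an orthogonal family.\<close>

lemma lsum_eq:
  assumes c: "c > 0" and F: "periodic c F"
    and X: "finite X" "card X = nat c ^ lattice_rank"
    and \<psi>: "\<And>x. x \<in> X \<Longrightarrow> \<psi> x \<in> L"
    and inj: "\<And>x y. x \<in> X \<Longrightarrow> y \<in> X \<Longrightarrow> \<psi> x - \<psi> y \<in> multiples c \<Longrightarrow> x = y"
  shows "lsum c F = (\<Sum>x\<in>X. F (\<psi> x))"
proof -
  define cl where "cl = (\<lambda>x. coset_rel (multiples c) `` {x})"
  have Q: "L // coset_rel (multiples c) = cl ` L"
    by (auto simp: quotient_def cl_def)
  have cl_eq: "cl x = cl y \<longleftrightarrow> x - y \<in> multiples c" for x y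
    unfolding cl_def by (rule coset_eq_iff)
  have "cl ` L = (cl \<circ> box_point) ` box c"
  proof
    show "cl ` L \<subseteq> (cl \<circ> box_point) ` box c"
    proof
      fix R assume "R \<in> cl ` L"
      then obtain r where r: "r \<in> L" "R = cl r" by blast
      obtain x where "x \<in> box c" "r - box_point x \<in> multiples c"
        using box_point_surj[OF c r(1)] by blast
      then show "R \<in> (cl \<circ> box_point) ` box c"
        using cl_eq r by auto
    qed
  qed auto
  moreover have "inj_on (cl \<circ> box_point) (box c)"
    using box_point_inj by (auto simp: inj_on_def cl_eq)
  ultimately have card_Q: "finite (cl ` L)" "card (cl ` L) = card X"
    using card_image[of "cl \<circ> box_point" "box c"] by (simp_all add: card_box X)
  have inj': "inj_on (cl \<circ> \<psi>) X"
    using inj by (auto simp: inj_on_def cl_eq)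
  have "(cl \<circ> \<psi>) ` X = cl ` L"
  proof (rule card_subset_eq)
    show "(cl \<circ> \<psi>) ` X \<subseteq> cl ` L"
      using \<psi> by auto
    show "card ((cl \<circ> \<psi>) ` X) = card (cl ` L)"
      using card_Q card_image[OF inj'] by simp
  qed (rule card_Q)
  with inj' have bij: "bij_betw (cl \<circ> \<psi>) X (cl ` L)"
    by (simp add: bij_betw_def)
  have "lsum c F = (\<Sum>x\<in>X. F (SOME r. r \<in> (cl \<circ> \<psi>) x))"
    unfolding lsum_def Q by (rule sum.reindex_bij_betw[OF bij, symmetric])
  also have "\<dots> = (\<Sum>x\<in>X. F (\<psi> x))"
  proof (rule sum.cong[OF refl])
    fix x assume x: "x \<in> X"
    have "\<psi> x \<in> (cl \<circ> \<psi>) x"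
      using coset_self by (simp add: cl_def)
    then have "(SOME r. r \<in> (cl \<circ> \<psi>) x) \<in> (cl \<circ> \<psi>) x"
      by (rule someI)
    then have *: "(SOME r. r \<in> (cl \<circ> \<psi>) x) - \<psi> x \<in> multiples c"
      by (simp add: cl_def coset_rel_def)
    then have "(SOME r. r \<in> (cl \<circ> \<psi>) x) \<in> L"
      using lattice_add[OF multiples_lattice[OF *] \<psi>[OF x]] by simp
    then show "F (SOME r. r \<in> (cl \<circ> \<psi>) x) = F (\<psi> x)"
      using periodic_diff[OF F _ \<psi>[OF x] *] by simp
  qed
  finally show ?thesis .
qed

lemma lsum_box: "c > 0 \<Longrightarrow> periodic c F \<Longrightarrow> lsum c F = (\<Sum>x\<in>box c. F (box_point x))"
  by (rule lsum_eq[OF _ _ finite_box card_box box_point_lattice box_point_inj])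

lemma lsum_cong:
  assumes "\<And>r. r \<in> L \<Longrightarrow> F r = G r"
  shows "lsum c F = lsum c G"
  unfolding lsum_def
proof (rule sum.cong[OF refl])
  fix R assume "R \<in> L // coset_rel (multiples c)"
  then obtain x where x: "x \<in> L" "R = coset_rel (multiples c) `` {x}"
    by (auto simp: quotient_def)
  have "x \<in> R"
    unfolding x by (rule coset_self)
  then have "(SOME r. r \<in> R) \<in> R"
    by (rule someI)
  then have *: "(SOME r. r \<in> R) - x \<in> multiples c"
    by (simp add: x coset_rel_def)
  then have "(SOME r. r \<in> R) \<in> L"
    using lattice_add[OF multiples_lattice[OF *] x(1)] by simp
  then show "F (SOME r. r \<in> R) = G (SOME r. r \<in> R)"
    by (rule assms)
qed

lemma lsum_mult_left: "lsum c (\<lambda>r. a * F r) = a * lsum c F"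
  by (simp add: lsum_def sum_distrib_left)

lemma coprime_multiples_cancel:
  assumes "coprime u c" "x \<in> L" "scale (of_int u) x \<in> multiples c"
  shows "x \<in> multiples c"
proof -
  obtain u' where "[u * u' = 1] (mod c)"
    using cong_solve_coprime_int[OF assms(1)] by blast
  then have "[1 = u' * u] (mod c)"
    by (simp add: cong_sym mult.commute)
  then have "c dvd 1 - u' * u"
    by (simp add: cong_iff_dvd_diff)
  then have "scale (of_int (1 - u' * u)) x \<in> multiples c"
    using assms(2) by (rule multiples_mult)
  then have "scale (of_int u') (scale (of_int u) x) + scale (of_int (1 - u' * u)) x \<in> multiples c"
    by (rule multiples_add[OF multiples_scale[OF assms(3)]])
  then show ?thesis
    by (simp add: scale_left_diff_distrib)
qed

lemma periodic_affine:
  assumes F: "periodic c F" and h: "h \<in> L"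
  shows "periodic c (\<lambda>r. F (scale (of_int u) r + h))"
  unfolding periodic_def
proof (intro ballI)
  fix r t assume "r \<in> L" "t \<in> L"
  then have "scale (of_int u) r + h \<in> L" "scale (of_int u) t \<in> L"
    using h lattice_add lattice_scale by blast+
  then have "F (scale (of_int u) r + h + scale (of_int c) (scale (of_int u) t)) = F (scale (of_int u) r + h)"
    using F unfolding periodic_def by blast
  then show "F (scale (of_int u) (r + scale (of_int c) t) + h) = F (scale (of_int u) r + h)"
    by (simp only: scale_right_distrib scale_scale ac_simps)
qed

lemma lsum_affine:
  assumes c: "c > 0" and F: "periodic c F" and u: "coprime u c" and h: "h \<in> L"
  shows "lsum c (\<lambda>r. F (scale (of_int u) r + h)) = lsum c F"
proof -
  have "lsum c (\<lambda>r. F (scale (of_int u) r + h)) = (\<Sum>x\<in>box c. F (scale (of_int u) (box_point x) + h))"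
    by (rule lsum_box[OF c periodic_affine[OF F h]])
  also have "\<dots> = lsum c F"
  proof (rule lsum_eq[OF c F, symmetric])
    fix x y assume xy: "x \<in> box c" "y \<in> box c"
      "scale (of_int u) (box_point x) + h - (scale (of_int u) (box_point y) + h) \<in> multiples c"
    then have "scale (of_int u) (box_point x - box_point y) \<in> multiples c"
      by (simp add: scale_right_diff_distrib)
    then have "box_point x - box_point y \<in> multiples c"
      by (rule coprime_multiples_cancel[OF u lattice_diff[OF box_point_lattice box_point_lattice]])
    then show "x = y"
      using xy by (intro box_point_inj)
  next
    fix x show "scale (of_int u) (box_point x) + h \<in> L"
      using h by (intro lattice_add lattice_scale box_point_lattice)
  qed (simp_all add: card_box)
  finally show ?thesis .
qed

lemma lsum_shift:
  assumes "c > 0" "periodic c F" "h \<in> L"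
  shows "lsum c (\<lambda>r. F (r + h)) = lsum c F"
  using lsum_affine[of c F 1 h] assms by simp

lemma periodic_mult: "periodic c F \<Longrightarrow> periodic c G \<Longrightarrow> periodic c (\<lambda>r. F r * G r)"
  by (simp add: periodic_def)

lemma periodic_dvd:
  assumes "periodic c F" "c dvd c'"
  shows "periodic c' F"
  unfolding periodic_def
proof (intro ballI)
  fix r h assume rh: "r \<in> L" "h \<in> L"
  obtain e where "c' = c * e" using assms(2) by blast
  then have "scale (of_int c') h = scale (of_int c) (scale (of_int e) h)"
    by simp
  moreover have "F (r + scale (of_int c) (scale (of_int e) h)) = F r"
    using assms(1) rh(1) lattice_scale[OF rh(2)] unfolding periodic_def by blast
  ultimately show "F (r + scale (of_int c') h) = F r"
    by (simp only:)
qed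

lemma lsum_crt:
  assumes c: "c1 > 0" "c2 > 0" "coprime c1 c2" and F: "periodic c1 F" and G: "periodic c2 G"
  shows "lsum (c1 * c2) (\<lambda>r. F r * G r) = lsum c1 F * lsum c2 G"
proof -
  obtain e2 where e2: "[c2 * e2 = 1] (mod c1)"
    using cong_solve_coprime_int[of c2 c1] c(3) coprime_commute by blast
  obtain e1 where e1: "[c1 * e1 = 1] (mod c2)"
    using cong_solve_coprime_int[OF c(3)] by blast
  \<comment> \<open>The coefficients c2 e2 and c1 e1 are the idempotents of the Chinese remainder
    theorem, so the value at (x, y) is congruent to the point of x modulo c1 and to that of y modulo
    c2.\<close>
  define \<psi> where "\<psi> = (\<lambda>(x, y). scale (of_int (c2 * e2)) (box_point x) + scale (of_int (c1 * e1)) (box_point y))"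
  have \<psi>_in: "\<psi> z \<in> L" for z
    unfolding \<psi>_def case_prod_unfold by (rule lattice_add; rule lattice_scale, rule box_point_lattice)
  have \<psi>1: "\<psi> (x, y) - box_point x \<in> multiples c1" for x y
  proof -
    have "scale (of_int (c2 * e2 - 1)) (box_point x) + scale (of_int (c1 * e1)) (box_point y) \<in> multiples c1"
      using e2 by (intro multiples_add multiples_mult) (auto simp: cong_iff_dvd_diff)
    then show ?thesis
      by (simp add: \<psi>_def scale_left_diff_distrib algebra_simps)
  qed
  have \<psi>2: "\<psi> (x, y) - box_point y \<in> multiples c2" for x y
  proof -
    have "scale (of_int (c1 * e1 - 1)) (box_point y) + scale (of_int (c2 * e2)) (box_point x) \<in> multiples c2"
      using e1 by (intro multiples_add multiples_mult) (auto simp: cong_iff_dvd_diff)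
    then show ?thesis
      by (simp add: \<psi>_def scale_left_diff_distrib algebra_simps)
  qed
  have "lsum (c1 * c2) (\<lambda>r. F r * G r) = (\<Sum>z\<in>box c1 \<times> box c2. F (\<psi> z) * G (\<psi> z))"
  proof (rule lsum_eq)
    show "periodic (c1 * c2) (\<lambda>r. F r * G r)"
      by (intro periodic_mult periodic_dvd[OF F] periodic_dvd[OF G]) auto
    show "card (box c1 \<times> box c2) = nat (c1 * c2) ^ lattice_rank"
      using c by (simp add: card_cartesian_product card_box nat_mult_distrib power_mult_distrib)
    fix z z' assume z: "z \<in> box c1 \<times> box c2" "z' \<in> box c1 \<times> box c2" and d: "\<psi> z - \<psi> z' \<in> multiples (c1 * c2)"
    obtain x y x' y' where [simp]: "z = (x, y)" "z' = (x', y')" by fastforce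
    obtain h where h: "h \<in> L" "\<psi> z - \<psi> z' = scale (of_int (c1 * c2)) h"
      using d by (rule multiplesE)
    have d1: "\<psi> z - \<psi> z' \<in> multiples c1" and d2: "\<psi> z - \<psi> z' \<in> multiples c2"
      unfolding h(2) by (rule multiples_mult[OF _ h(1)], simp)+
    have "(\<psi> z - \<psi> z') + - (\<psi> (x, y) - box_point x) + (\<psi> (x', y') - box_point x') \<in> multiples c1"
      by (intro multiples_add multiples_uminus d1 \<psi>1)
    then have "x = x'"
      using z by (intro box_point_inj[of x c1]) auto
    moreover have "(\<psi> z - \<psi> z') + - (\<psi> (x, y) - box_point y) + (\<psi> (x', y') - box_point y') \<in> multiples c2"
      by (intro multiples_add multiples_uminus d2 \<psi>2)
    then have "y = y'"
      using z by (intro box_point_inj[of y c2]) auto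
    ultimately show "z = z'" by simp
  qed (use c \<psi>_in in auto)
  also have "\<dots> = (\<Sum>z\<in>box c1 \<times> box c2. F (box_point (fst z)) * G (box_point (snd z)))"
  proof (rule sum.cong[OF refl])
    fix z
    have "F (\<psi> z) = F (box_point (fst z))"
      using \<psi>1[of "fst z" "snd z"] by (intro periodic_diff[OF F \<psi>_in box_point_lattice]) simp
    moreover have "G (\<psi> z) = G (box_point (snd z))"
      using \<psi>2[of "fst z" "snd z"] by (intro periodic_diff[OF G \<psi>_in box_point_lattice]) simp
    ultimately show "F (\<psi> z) * G (\<psi> z) = F (box_point (fst z)) * G (box_point (snd z))"
      by simp
  qed
  also have "\<dots> = lsum c1 F * lsum c2 G"
    unfolding lsum_box[OF c(1) F] lsum_box[OF c(2) G]
    by (simp add: sum_product sum.cartesian_product case_prod_unfold)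
  finally show ?thesis .
qed

end

section \<open>Orthogonal bases and the signature\<close>

context even_lattice
begin

text \<open>On L the values of q are integers, so the floor only changes the type. The last
  condition makes each b anisotropic and q b an admissible coefficient of a Gauss sum modulo powers
  of p.\<close>

definition orthogonal_family :: "int \<Rightarrow> 'v set \<Rightarrow> bool" where
  "orthogonal_family p B \<longleftrightarrow> finite B \<and> B \<subseteq> L \<and> (\<forall>b\<in>B. \<forall>b'\<in>B. b \<noteq> b' \<longrightarrow> form b b' = 0)
     \<and> (\<forall>b\<in>B. \<not> p dvd \<lfloor>q b\<rfloor>)"

lemma lattice_sum: "(\<And>i. i \<in> I \<Longrightarrow> f i \<in> L) \<Longrightarrow> (\<Sum>i\<in>I. f i) \<in> L"
  by (induction I rule: infinite_finite_induct) (simp_all add: lattice_add)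

lemma of_int_floor_q: "x \<in> L \<Longrightarrow> of_int \<lfloor>q x\<rfloor> = q x"
  using q_integral by (simp add: of_int_floor)

lemma orthogonal_family_form_nonzero:
  assumes "orthogonal_family p B" "b \<in> B"
  shows "form b b \<noteq> 0"
  using assms by (auto simp: orthogonal_family_def q_def)

lemma orthogonal_family_coefficient:
  assumes B: "orthogonal_family p B" and C: "C \<subseteq> B" "b \<in> C"
  shows "form (\<Sum>b\<in>C. scale (u b) b) b = u b * form b b"
proof -
  have "finite C"
    using B C finite_subset by (auto simp: orthogonal_family_def)
  have "form (\<Sum>b\<in>C. scale (u b) b) b = (\<Sum>b'\<in>C. if b' = b then u b * form b b else 0)"
    unfolding form_sum_left
  proof (rule sum.cong[OF refl])
    fix b' assume "b' \<in> C"
    then have "b' \<noteq> b \<Longrightarrow> form b' b = 0"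
      using B C unfolding orthogonal_family_def by blast
    then show "form (scale (u b') b') b = (if b' = b then u b * form b b else 0)"
      by (auto simp: form_scale_left)
  qed
  then show ?thesis
    using \<open>finite C\<close> C by simp
qed

lemma orthogonal_family_independent:
  assumes B: "orthogonal_family p B"
  shows "independent B"
proof (rule independent_if_scalars_zero)
  show "finite B" using B by (simp add: orthogonal_family_def)
  fix u b assume "(\<Sum>b\<in>B. scale (u b) b) = 0" "b \<in> B"
  then have "u b * form b b = 0"
    using orthogonal_family_coefficient[OF B, of B b u] by simp
  then show "u b = 0"
    using orthogonal_family_form_nonzero[OF B \<open>b \<in> B\<close>] by simp
qed

lemma card_independent_le: "independent B \<Longrightarrow> card B \<le> lattice_rank"
proof -
  have *: "span (set some_basis) = UNIV" "card (set some_basis) = lattice_rank"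
    using lattice_basis_some_basis by (auto simp: lattice_basis_def lattice_rank_def distinct_card)
  assume "independent B"
  then show ?thesis
    using independent_span_bound[of "set some_basis" B] * by simp
qed

lemma dim_le_rank: "dim W \<le> lattice_rank"
proof -
  have *: "span (set some_basis) = UNIV" "card (set some_basis) = lattice_rank"
    using lattice_basis_some_basis by (auto simp: lattice_basis_def lattice_rank_def distinct_card)
  then show ?thesis
    using dim_le_card[of W "set some_basis"] by simp
qed

lemma card_spanning_independent:
  assumes "independent B" "span B = UNIV"
  shows "card B = lattice_rank"
proof -
  have *: "independent (set some_basis)" "span (set some_basis) = UNIV" "card (set some_basis) = lattice_rank"
    using lattice_basis_some_basis by (auto simp: lattice_basis_def lattice_rank_def distinct_card)
  have "dim UNIV = card B"
    using dim_eq_card[of B UNIV] assms by simp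
  moreover have "dim UNIV = card (set some_basis)"
    using dim_eq_card[of "set some_basis" UNIV] * by simp
  ultimately show ?thesis using * by simp
qed

lemma ex_maximal_orthogonal_family:
  "\<exists>B. orthogonal_family p B \<and> (\<forall>B'. orthogonal_family p B' \<longrightarrow> card B' \<le> card B)"
proof -
  have "orthogonal_family p {}"
    by (simp add: orthogonal_family_def)
  moreover have "card B < Suc lattice_rank" if "orthogonal_family p B" for B
    using card_independent_le[OF orthogonal_family_independent[OF that]] by simp
  ultimately show ?thesis
    using ex_has_greatest_nat[of "orthogonal_family p" "{}" card "Suc lattice_rank"] by blast
qed

text \<open>The vector x / p lies in the dual lattice, so \<Delta> x / p lies in L; so does x, and
  \<Delta> is prime to p, hence Bezout gives x / p. In effect the form is nondegenerate modulo
  p.\<close>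

lemma divide_prime_in_lattice:
  assumes p: "prime p" "\<not> p dvd lattice_det" and x: "x \<in> L"
    and dvd: "\<And>y. y \<in> L \<Longrightarrow> form x y / of_int p \<in> \<int>"
  shows "scale (1 / of_int p) x \<in> L"
proof -
  have "scale (1 / of_int p) x \<in> dual_lattice"
    using dvd by (simp add: dual_lattice_def form_scale_left)
  then have d: "scale (of_int lattice_det) (scale (1 / of_int p) x) \<in> L"
    by (rule det_scale_dual)
  have "coprime lattice_det p"
    using prime_imp_coprime[OF p] by (simp add: coprime_commute)
  then obtain u where "[lattice_det * u = 1] (mod p)"
    using cong_solve_coprime_int by blast
  then have "p dvd 1 - lattice_det * u"
    by (simp add: cong_iff_dvd_diff dvd_diff_commute)
  then obtain e where "1 - lattice_det * u = p * e" by blast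
  then have "1 = lattice_det * u + p * e" by simp
  then have "of_int 1 = (of_int (lattice_det * u + p * e) :: rat)"
    by (simp only:)
  then have "1 / of_int p = (of_int u * of_int lattice_det / of_int p + of_int e :: rat)"
    using p by (auto simp: field_simps)
  then have "scale (1 / of_int p) x = scale (of_int u * of_int lattice_det / of_int p + of_int e) x"
    by (simp only:)
  also have "\<dots> = scale (of_int u) (scale (of_int lattice_det) (scale (1 / of_int p) x)) + scale (of_int e) x"
    by (simp add: scale_left_distrib)
  also have "\<dots> \<in> L"
    by (rule lattice_add[OF lattice_scale[OF d] lattice_scale[OF x]])
  finally show ?thesis .
qed

lemma infinitely_divisible_eq_0:
  assumes p: "p > 1" and x: "\<And>n. \<exists>y\<in>L. x = scale (of_int p ^ n) y"
  shows "x = 0"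
proof -
  have "x \<in> L" using x[of 0] by auto
  then obtain z where z: "x = lcomb (\<lambda>i. of_int (z i))"
    by (auto simp: in_lattice_iff)
  have "z i = 0" if i: "i < lattice_rank" for i
  proof (rule ccontr)
    assume nz: "z i \<noteq> 0"
    \<comment> \<open>With this exponent p^n already exceeds |z i|, so it cannot divide the nonzero
      number z i.\<close>
    define n where "n = nat \<bar>z i\<bar>"
    obtain y where y: "y \<in> L" "x = scale (of_int p ^ n) y"
      using x[of n] by blast
    obtain z' where z': "y = lcomb (\<lambda>i. of_int (z' i))"
      using y(1) by (auto simp: in_lattice_iff)
    have "lcomb (\<lambda>i. of_int (z i)) = lcomb (\<lambda>i. of_int p ^ n * of_int (z' i))"
      using y(2) z z' by (simp add: lcomb_scale)
    then have "(of_int (z i) :: rat) = of_int p ^ n * of_int (z' i)"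
      using i by (rule lcomb_inject)
    then have "(of_int (z i) :: rat) = of_int (p ^ n * z' i)"
      by simp
    then have "p ^ n dvd z i"
      by (simp only: of_int_eq_iff dvd_triv_left)
    then have "p ^ n \<le> \<bar>z i\<bar>"
      using dvd_imp_le_int[OF nz, of "p ^ n"] p by (simp add: power_abs)
    moreover have "int n < p ^ n"
    proof -
      have "n < 2 ^ n" by (rule less_exp)
      then have "int n < int (2 ^ n)"
        by (simp only: of_nat_less_iff)
      then have "int n < 2 ^ n"
        by simp
      also have "(2::int) ^ n \<le> p ^ n"
        using p by (intro power_mono) auto
      finally show ?thesis .
    qed
    ultimately show False
      by (simp add: n_def)
  qed
  then show ?thesis
    unfolding z lcomb_def by simp
qed

text \<open>Let M be the orthogonal complement in L of an orthogonal family B of maximal size.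
  Maximality makes q divisible by p on M, and by polarisation so is the form. A multiple of L by
  some P prime to p lies in M plus the span of B, so p divides the pairing of M with all of L, and M
  is p-divisible. Hence M = 0 and B spans.\<close>

lemma ex_orthogonal_basis:
  assumes p: "prime p" "p > 2" "\<not> p dvd lattice_det"
  shows "\<exists>B. orthogonal_family p B \<and> span B = UNIV"
proof -
  obtain B where B: "orthogonal_family p B"
    and max: "\<And>B'. orthogonal_family p B' \<Longrightarrow> card B' \<le> card B"
    using ex_maximal_orthogonal_family by blast
  have Bfin: "finite B" and BL: "B \<subseteq> L" and Bq: "\<And>b. b \<in> B \<Longrightarrow> \<not> p dvd \<lfloor>q b\<rfloor>"
    using B by (auto simp: orthogonal_family_def)
  define M where "M = {x \<in> L. \<forall>b\<in>B. form x b = 0}"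
  have M_dvd: "p dvd \<lfloor>q x\<rfloor>" if x: "x \<in> M" for x
  proof (rule ccontr)
    assume *: "\<not> p dvd \<lfloor>q x\<rfloor>"
    then have "x \<notin> B"
      using x by (auto simp: M_def q_def)
    moreover have "orthogonal_family p (insert x B)"
      using * B x form_sym by (auto simp: orthogonal_family_def M_def)
    ultimately show False
      using max[of "insert x B"] Bfin by simp
  qed
  have M_form: "form x y / of_int p \<in> \<int>" if "x \<in> M" "y \<in> M" for x y
  proof -
    have "x + y \<in> M" and xyL: "x \<in> L" "y \<in> L" "x + y \<in> L"
      using that by (auto simp: M_def form_add_left lattice_add)
    then have "p dvd \<lfloor>q (x + y)\<rfloor> - \<lfloor>q x\<rfloor> - \<lfloor>q y\<rfloor>"
      using that M_dvd by (intro dvd_diff) auto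
    then obtain e where "\<lfloor>q (x + y)\<rfloor> - \<lfloor>q x\<rfloor> - \<lfloor>q y\<rfloor> = p * e" by blast
    then have "(of_int (\<lfloor>q (x + y)\<rfloor> - \<lfloor>q x\<rfloor> - \<lfloor>q y\<rfloor>) :: rat) = of_int (p * e)"
      by (simp only:)
    then have "q (x + y) - q x - q y = of_int p * of_int e"
      by (simp add: of_int_floor_q xyL)
    then have "form x y = of_int p * of_int e"
      by (simp add: q_add)
    then show ?thesis
      using p by simp
  qed
  \<comment> \<open>P is the product of the values form b b = 2 q b and is prime to p because p is
    odd. It clears the denominators of the orthogonal projection onto the span of B;
    \<open>proj\<close> is P times that projection.\<close>
  define P where "P = (\<Prod>b\<in>B. 2 * \<lfloor>q b\<rfloor>)"
  define Pb where "Pb = (\<lambda>b. \<Prod>b'\<in>B - {b}. 2 * \<lfloor>q b'\<rfloor>)"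
  have P_eq: "of_int P = of_int (Pb b) * form b b" if "b \<in> B" for b
  proof -
    have "P = 2 * \<lfloor>q b\<rfloor> * Pb b"
      unfolding P_def Pb_def using Bfin that by (rule prod.remove)
    then have "(of_int P :: rat) = of_int (Pb b) * (2 * of_int \<lfloor>q b\<rfloor>)"
      by simp
    also have "2 * of_int \<lfloor>q b\<rfloor> = form b b"
      using that BL of_int_floor_q[of b] by (auto simp: q_def)
    finally show ?thesis .
  qed
  have P_coprime: "\<not> p dvd P"
  proof
    assume "p dvd P"
    then have "\<exists>b\<in>B. p dvd 2 * \<lfloor>q b\<rfloor>"
      unfolding P_def by (simp only: prime_dvd_prod_iff[OF Bfin p(1)])
    then obtain b where "b \<in> B" "p dvd 2 * \<lfloor>q b\<rfloor>" ..
    then have "p dvd 2"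
      using Bq[of b] p(1) by (simp add: prime_dvd_mult_iff)
    then show False
      using p zdvd_imp_le[of p 2] by auto
  qed
  define proj where "proj = (\<lambda>y. \<Sum>b\<in>B. scale (of_int (Pb b) * form y b) b)"
  have proj_L: "proj y \<in> L" if y: "y \<in> L" for y
  proof -
    have "scale (of_int (Pb b) * form y b) b \<in> L" if b: "b \<in> B" for b
    proof -
      have "b \<in> L"
        using b BL by blast
      then obtain e where "form y b = of_int e"
        using form_integral[OF y] by (metis Ints_cases)
      then have "scale (of_int (Pb b) * form y b) b = scale (of_int (Pb b * e)) b"
        by simp
      then show ?thesis
        using lattice_scale[OF \<open>b \<in> L\<close>] by (simp only:)
    qed
    then show ?thesis
      unfolding proj_def by (rule lattice_sum)
  qed
  have residue: "scale (of_int P) y - proj y \<in> M" if y: "y \<in> L" for y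
  proof -
    have "form (scale (of_int P) y - proj y) b = 0" if b: "b \<in> B" for b
      using orthogonal_family_coefficient[OF B order_refl b, of "\<lambda>b. of_int (Pb b) * form y b"] P_eq[OF b]
      by (simp add: form_diff_left form_scale_left proj_def)
    then show ?thesis
      using y proj_L by (auto simp: M_def intro: lattice_diff lattice_scale)
  qed
  have M_step: "\<exists>x'\<in>M. x = scale (of_int p) x'" if x: "x \<in> M" for x
  proof -
    have xL: "x \<in> L" using x by (simp add: M_def)
    have "form x y / of_int p \<in> \<int>" if y: "y \<in> L" for y
    proof -
      have "form x (proj y) = 0"
        using x by (simp add: proj_def form_sum_right form_scale_right M_def)
      then have "form x (scale (of_int P) y - proj y) = of_int P * form x y"
        by (simp add: form_diff_right form_scale_right)
      then have *: "of_int P * form x y / of_int p \<in> \<int>"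
        using M_form[OF x residue[OF y]] by simp
      obtain e where e: "form x y = of_int e"
        using form_integral[OF xL y] by (auto elim: Ints_cases)
      obtain f where "of_int P * form x y / of_int p = (of_int f :: rat)"
        using * by (rule Ints_cases)
      then have "(of_int (P * e) :: rat) = of_int (p * f)"
        using p by (simp add: e field_simps)
      then have "p dvd P * e"
        by (simp only: of_int_eq_iff dvd_triv_left)
      then have "p dvd e"
        using p P_coprime by (simp add: prime_dvd_mult_iff)
      then obtain j where "e = p * j" ..
      then have "form x y / of_int p = of_int j"
        using p(2) by (simp add: e)
      then show ?thesis
        by (simp only: Ints_of_int)
    qed
    then have "scale (1 / of_int p) x \<in> L"
      by (rule divide_prime_in_lattice[OF p(1) p(3) xL])
    then have "scale (1 / of_int p) x \<in> M"
      using x by (auto simp: M_def form_scale_left)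
    moreover have "x = scale (of_int p) (scale (1 / of_int p) x)"
      using p by simp
    ultimately show ?thesis by (rule bexI[rotated])
  qed
  have M_power: "\<exists>x'\<in>M. x = scale (of_int p ^ n) x'" if x: "x \<in> M" for x n
  proof (induction n)
    case 0
    show ?case using x by (intro bexI[of _ x]) simp_all
  next
    case (Suc n)
    then obtain x' where x': "x' \<in> M" "x = scale (of_int p ^ n) x'" by (rule bexE)
    obtain x'' where x'': "x'' \<in> M" "x' = scale (of_int p) x''"
      using M_step[OF x'(1)] by (rule bexE)
    have "x = scale (of_int p ^ Suc n) x''"
      by (simp add: x' x'' mult.commute)
    then show ?case using x''(1) by (rule bexI)
  qed
  have M_0: "x = 0" if "x \<in> M" for x
  proof (rule infinitely_divisible_eq_0)
    show "\<exists>y\<in>L. x = scale (of_int p ^ n) y" for n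
      using M_power[OF that, of n] by (auto simp: M_def)
  qed (use p in simp)
  have "y \<in> span B" if y: "y \<in> L" for y
  proof -
    have "scale (of_int P) y = proj y"
      using M_0[OF residue[OF y]] by simp
    moreover have "P \<noteq> 0"
      using P_coprime by auto
    ultimately have "scale (1 / of_int P) (proj y) = y"
      by (simp flip: \<open>scale (of_int P) y = proj y\<close>)
    moreover have "proj y \<in> span B"
      unfolding proj_def by (intro span_sum span_scale span_base)
    ultimately show ?thesis
      using span_scale[of "proj y" B "1 / of_int P"] by simp
  qed
  then have "set some_basis \<subseteq> span B"
    using lbasis_in_lattice by (auto simp: in_set_conv_nth lattice_rank_def)
  then have "span (set some_basis) \<subseteq> span B"
    by (simp add: span_minimal)
  moreover have "span (set some_basis) = UNIV"
    using lattice_basis_some_basis by (simp add: lattice_basis_def)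
  ultimately show ?thesis
    using B by blast
qed

lemma form_span_self:
  assumes B: "orthogonal_family p B" and C: "C \<subseteq> B" and x: "x \<in> span C"
  shows "\<exists>u. x = (\<Sum>b\<in>C. scale (u b) b) \<and> form x x = (\<Sum>b\<in>C. (u b)\<^sup>2 * form b b)"
proof -
  have "finite C"
    using B C finite_subset by (auto simp: orthogonal_family_def)
  then obtain u where u: "x = (\<Sum>b\<in>C. scale (u b) b)"
    using x by (auto simp: span_finite)
  have "form x x = (\<Sum>b\<in>C. u b * form x b)"
    unfolding u by (subst form_sum_right) (simp add: form_scale_right)
  also have "\<dots> = (\<Sum>b\<in>C. (u b)\<^sup>2 * form b b)"
  proof (rule sum.cong[OF refl])
    fix b assume "b \<in> C"
    then show "u b * form x b = (u b)\<^sup>2 * form b b"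
      unfolding u using orthogonal_family_coefficient[OF B C, of b u] by (simp add: power2_eq_square)
  qed
  finally show ?thesis using u by blast
qed

text \<open>The normalising power of c has exponent half of \<open>sig_pos + sig_neg\<close>, while
  lattice sums have size c^(g / 2); this inequality lets the former absorb the latter. An orthogonal
  basis over the rationals comes from \<open>ex_orthogonal_basis\<close> at an auxiliary prime too
  large to divide \<Delta>, and its vectors are sorted by the sign of form b b.\<close>

lemma rank_le_signature: "lattice_rank \<le> sig_pos + sig_neg"
proof -
  obtain n :: nat where n: "prime n" "n > nat \<bar>lattice_det\<bar> + 2"
    using bigger_prime by blast
  define p where "p = int n"
  have p: "prime p" "p > 2" "p > \<bar>lattice_det\<bar>"
    using n by (auto simp: p_def)
  then have "\<not> p dvd lattice_det"
    using lattice_det_nonzero dvd_imp_le_int[of lattice_det p] by auto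
  then obtain B where B: "orthogonal_family p B" and span_B: "span B = UNIV"
    using ex_orthogonal_basis p by blast
  have Bfin: "finite B" using B by (simp add: orthogonal_family_def)
  define P where "P = {b \<in> B. form b b > 0}"
  define N where "N = {b \<in> B. form b b < 0}"
  have sub: "P \<subseteq> B" "N \<subseteq> B" by (auto simp: P_def N_def)
  have fin: "finite P" "finite N" using sub Bfin finite_subset by auto
  have ind: "independent P" "independent N"
    using independent_mono[OF orthogonal_family_independent[OF B]] sub by auto
  \<comment> \<open>\<open>Max\<close> is informative only on a finite set; the rank bounds all the
    dimensions.\<close>
  have fin_dims: "finite {dim W | W. subspace W \<and> Q W}" for Q
    by (rule finite_subset[of _ "{..lattice_rank}"]) (use dim_le_rank in auto)
  have "card P \<le> sig_pos"
    unfolding sig_pos_def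
  proof (rule Max_ge[OF fin_dims])
    have "form x x > 0" if x: "x \<in> span P" "x \<noteq> 0" for x
    proof -
      obtain u where u: "x = (\<Sum>b\<in>P. scale (u b) b)" "form x x = (\<Sum>b\<in>P. (u b)\<^sup>2 * form b b)"
        using form_span_self[OF B sub(1) x(1)] by blast
      have "\<exists>b\<in>P. u b \<noteq> 0"
      proof (rule ccontr)
        assume "\<not> (\<exists>b\<in>P. u b \<noteq> 0)"
        then have "x = 0"
          by (simp add: u(1))
        with x(2) show False by simp
      qed
      then obtain b where b: "b \<in> P" "u b \<noteq> 0" by blast
      have "(u b)\<^sup>2 * form b b \<le> (\<Sum>b\<in>P. (u b)\<^sup>2 * form b b)"
        using fin b by (intro member_le_sum) (auto simp: P_def)
      moreover have "(u b)\<^sup>2 * form b b > 0"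
        using b by (simp add: P_def)
      ultimately show ?thesis
        using u(2) by simp
    qed
    then show "card P \<in> {dim W | W. subspace W \<and> (\<forall>x\<in>W. x \<noteq> 0 \<longrightarrow> form x x > 0)}"
      using dim_span_eq_card_independent[OF ind(1)] subspace_span
      by (intro CollectI exI[of _ "span P"] conjI allI ballI impI) simp_all
  qed
  moreover have "card N \<le> sig_neg"
    unfolding sig_neg_def
  proof (rule Max_ge[OF fin_dims])
    have "form x x < 0" if x: "x \<in> span N" "x \<noteq> 0" for x
    proof -
      obtain u where u: "x = (\<Sum>b\<in>N. scale (u b) b)" "form x x = (\<Sum>b\<in>N. (u b)\<^sup>2 * form b b)"
        using form_span_self[OF B sub(2) x(1)] by blast
      have "\<exists>b\<in>N. u b \<noteq> 0"
      proof (rule ccontr)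
        assume "\<not> (\<exists>b\<in>N. u b \<noteq> 0)"
        then have "x = 0"
          by (simp add: u(1))
        with x(2) show False by simp
      qed
      then obtain b where b: "b \<in> N" "u b \<noteq> 0" by blast
      have "- ((u b)\<^sup>2 * form b b) \<le> (\<Sum>b\<in>N. - ((u b)\<^sup>2 * form b b))"
        using fin b by (intro member_le_sum) (auto simp: N_def mult_nonneg_nonpos)
      moreover have "(u b)\<^sup>2 * form b b < 0"
        using b by (simp add: N_def mult_pos_neg)
      ultimately show ?thesis
        using u(2) by (simp add: sum_negf)
    qed
    then show "card N \<in> {dim W | W. subspace W \<and> (\<forall>x\<in>W. x \<noteq> 0 \<longrightarrow> form x x < 0)}"
      using dim_span_eq_card_independent[OF ind(2)] subspace_span
      by (intro CollectI exI[of _ "span N"] conjI allI ballI impI) simp_all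
  qed
  moreover have "card P + card N = lattice_rank"
  proof -
    have "B = P \<union> N" "P \<inter> N = {}"
      using orthogonal_family_form_nonzero[OF B] by (auto simp: P_def N_def linorder_neq_iff)
    then have "card B = card P + card N"
      using fin by (simp add: card_Un_disjoint)
    then show ?thesis
      using card_spanning_independent[OF orthogonal_family_independent[OF B] span_B] by simp
  qed
  ultimately show ?thesis by linarith
qed

end

section \<open>Lattice Gauss sums\<close>

context even_lattice
begin

text \<open>Shifting by a vector h at which the linear function is not integral multiplies the sum
  by a number other than 1.\<close>

lemma lsum_linear:
  assumes c: "c > 0" and per: "periodic c (\<lambda>r. ee (\<phi> r))"
    and add: "\<And>x y. \<phi> (x + y) = \<phi> x + \<phi> y"
  shows "lsum c (\<lambda>r. ee (\<phi> r)) = (if \<forall>h\<in>L. \<phi> h \<in> \<int> then of_int c ^ lattice_rank else 0)"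
proof (cases "\<forall>h\<in>L. \<phi> h \<in> \<int>")
  case True
  have "lsum c (\<lambda>r. ee (\<phi> r)) = lsum c (\<lambda>r. 1)"
    by (rule lsum_cong) (use True in \<open>simp add: ee_eq_1_iff\<close>)
  also have "\<dots> = of_int c ^ lattice_rank"
    using c by (subst lsum_box) (simp_all add: periodic_def card_box)
  finally show ?thesis using True by simp
next
  case False
  then obtain h where h: "h \<in> L" "\<phi> h \<notin> \<int>" by blast
  have "lsum c (\<lambda>r. ee (\<phi> r)) = lsum c (\<lambda>r. ee (\<phi> (r + h)))"
    by (rule lsum_shift[OF c per h(1), symmetric])
  also have "\<dots> = ee (\<phi> h) * lsum c (\<lambda>r. ee (\<phi> r))"
    by (simp only: add ee_add lsum_mult_left[symmetric] mult.commute)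
  finally have "lsum c (\<lambda>r. ee (\<phi> r)) = 0 \<or> ee (\<phi> h) = 1"
    by simp
  then have "lsum c (\<lambda>r. ee (\<phi> r)) = 0"
    using h(2) by (simp add: ee_eq_1_iff)
  then show ?thesis
    using False by (simp only: if_False)
qed

text \<open>The condition decouples into the coordinates, each of which has at most |\<Delta>|
  solutions by \<open>card_kernel\<close>.\<close>

lemma card_box_kernel:
  assumes "c > 0"
  shows "card {x \<in> box c. scale (of_int lattice_det) (box_point x) \<in> multiples c} \<le> nat \<bar>lattice_det\<bar> ^ lattice_rank"
proof -
  define K where "K = {y \<in> {0..<c}. c dvd lattice_det * y}"
  have "finite K"
    unfolding K_def by (rule finite_subset[of _ "{0..<c}"]) auto
  have "{x \<in> box c. scale (of_int lattice_det) (box_point x) \<in> multiples c} \<subseteq> PiE {..<lattice_rank} (\<lambda>_. K)"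
  proof
    fix x assume x: "x \<in> {x \<in> box c. scale (of_int lattice_det) (box_point x) \<in> multiples c}"
    have "scale (of_int lattice_det) (box_point x) = box_point (\<lambda>i. lattice_det * x i) - box_point (\<lambda>_. 0)"
      by (simp add: box_point_def lcomb_scale) (simp add: lcomb_def)
    then have "box_point (\<lambda>i. lattice_det * x i) - box_point (\<lambda>_. 0) \<in> multiples c"
      using x by simp
    then have "[lattice_det * x i = 0] (mod c)" if "i < lattice_rank" for i
      using that by (rule box_point_diff_multiple)
    then have "x i \<in> K" if "i < lattice_rank" for i
      using x that by (auto simp: K_def cong_0_iff box_def PiE_iff)
    then show "x \<in> PiE {..<lattice_rank} (\<lambda>_. K)"
      using x by (auto simp: box_def PiE_iff)
  qed
  then have "card {x \<in> box c. scale (of_int lattice_det) (box_point x) \<in> multiples c} \<le> card (PiE {..<lattice_rank} (\<lambda>_. K))"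
    using \<open>finite K\<close> by (intro card_mono finite_PiE) auto
  also have "\<dots> = card K ^ lattice_rank"
    by (simp add: card_PiE)
  also have "\<dots> \<le> nat \<bar>lattice_det\<bar> ^ lattice_rank"
    unfolding K_def by (intro power_mono card_kernel assms lattice_det_nonzero) simp
  finally show ?thesis .
qed

lemma det_form_dual_integral: "x \<in> dual_lattice \<Longrightarrow> y \<in> dual_lattice \<Longrightarrow> of_int lattice_det * form x y \<in> \<int>"
  using form_dual_integral[of x "scale (of_int lattice_det) y"] det_scale_dual[of y] by (simp add: form_scale_right)

lemma det_q_dual_integral: "x \<in> dual_lattice \<Longrightarrow> 2 * of_int lattice_det * q x \<in> \<int>"
  using det_form_dual_integral[of x x] by (simp add: q_def)

lemma dual_add: "x \<in> dual_lattice \<Longrightarrow> y \<in> dual_lattice \<Longrightarrow> x + y \<in> dual_lattice"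
  by (simp add: dual_lattice_def form_add_left)

lemma dual_scale: "x \<in> dual_lattice \<Longrightarrow> scale (of_int a) x \<in> dual_lattice"
  by (simp add: dual_lattice_def form_scale_left)

text \<open>The power of sqrt |\<Delta>| with exponent g comes from a single lattice sum, the other
  factor sqrt |\<Delta>| from the squarefree part e of c, which divides \<Delta>. The rest bounds
  the surviving residues: 2 ^ omega(\<Delta>) sign choices times twice a gcd that is at most 8
  |\<Delta>|.\<close>

definition smooth_const :: real where
  "smooth_const = sqrt (of_int \<bar>lattice_det\<bar>) ^ lattice_rank * sqrt (of_int \<bar>lattice_det\<bar>)
    * 2 ^ card (prime_factors lattice_det) * 16 * of_int \<bar>lattice_det\<bar>"

lemma smooth_const_nonneg: "smooth_const \<ge> 0"
  by (simp add: smooth_const_def)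

lemma cnj_lsum: "cnj (lsum c F) = lsum c (\<lambda>r. cnj (F r))"
  by (simp add: lsum_def cnj_sum)

section \<open>Evaluation at primes not dividing the discriminant\<close>

definition qsum :: "int \<Rightarrow> int \<Rightarrow> complex" where
  "qsum c x = lsum c (\<lambda>r. ee (of_int x * q r / of_int c))"

lemma periodic_q:
  assumes "c \<noteq> 0"
  shows "periodic c (\<lambda>r. ee (of_int x * q r / of_int c))"
  unfolding periodic_def
proof (intro ballI)
  fix r h assume r: "r \<in> L" and h: "h \<in> L"
  show "ee (of_int x * q (r + scale (of_int c) h) / of_int c) = ee (of_int x * q r / of_int c)"
  proof (rule ee_cong)
    have "of_int x * q (r + scale (of_int c) h) / of_int c - of_int x * q r / of_int c =
        of_int x * (form r h + of_int c * q h)"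
      using assms by (simp add: q_add q_scale form_bilinear field_simps power2_eq_square)
    also have "\<dots> \<in> \<int>"
      by (intro Ints_mult Ints_add Ints_of_int form_integral[OF r h] q_integral[OF h])
    finally show "of_int x * q (r + scale (of_int c) h) / of_int c - of_int x * q r / of_int c \<in> \<int>" .
  qed
qed

lemma q_orthogonal_comb:
  assumes B: "orthogonal_family p B"
  shows "q (\<Sum>b\<in>B. scale (u b) b) = (\<Sum>b\<in>B. (u b)\<^sup>2 * q b)"
proof -
  let ?x = "\<Sum>b\<in>B. scale (u b) b"
  have "form ?x ?x = (\<Sum>b\<in>B. u b * form ?x b)"
    by (subst form_sum_right) (simp only: form_scale_right)
  also have "\<dots> = (\<Sum>b\<in>B. (u b)\<^sup>2 * form b b)"
    by (intro sum.cong refl) (simp add: orthogonal_family_coefficient[OF B order_refl] power2_eq_square)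
  finally show ?thesis
    by (simp add: q_def sum_divide_distrib)
qed

text \<open>Combinations of B with coefficients modulo p^k represent all of L / p^k L although B
  need not generate L: pairing with b recovers the coefficient times 2 q(b), which is prime to p. In
  these coordinates the sum is a product.\<close>

lemma qsum_prime_power:
  assumes p: "prime p" "p > 2" and B: "orthogonal_family p B" "span B = UNIV"
  shows "qsum (p ^ k) x = (\<Prod>b\<in>B. gauss (p ^ k) (x * \<lfloor>q b\<rfloor>) 0)"
proof -
  define c where "c = p ^ k"
  have c: "c > 0" "c \<noteq> 0" using p by (auto simp: c_def)
  have Bfin: "finite B" and BL: "B \<subseteq> L" and Bq: "\<And>b. b \<in> B \<Longrightarrow> \<not> p dvd \<lfloor>q b\<rfloor>"
    using B(1) unfolding orthogonal_family_def by blast+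
  have q_floor: "q b = of_int \<lfloor>q b\<rfloor>" if "b \<in> B" for b
    by (rule of_int_floor_q[OF subsetD[OF BL that], symmetric])
  define \<psi> where "\<psi> = (\<lambda>f :: 'v \<Rightarrow> int. \<Sum>b\<in>B. scale (of_int (f b)) b)"
  have "qsum c x = (\<Sum>f\<in>PiE B (\<lambda>_. {0..<c}). ee (of_int x * q (\<psi> f) / of_int c))"
    unfolding qsum_def
  proof (rule lsum_eq[OF c(1) periodic_q[OF c(2)]])
    show "finite (PiE B (\<lambda>_. {0..<c}))"
      using Bfin by (intro finite_PiE) auto
    show "card (PiE B (\<lambda>_. {0..<c})) = nat c ^ lattice_rank"
      using Bfin card_spanning_independent[OF orthogonal_family_independent[OF B(1)] B(2)]
      by (simp add: card_PiE)
    show "\<psi> f \<in> L" for f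
      unfolding \<psi>_def using BL by (intro lattice_sum lattice_scale) auto
    fix f f' assume f: "f \<in> PiE B (\<lambda>_. {0..<c})" "f' \<in> PiE B (\<lambda>_. {0..<c})" "\<psi> f - \<psi> f' \<in> multiples c"
    obtain h where h: "h \<in> L" "\<psi> f - \<psi> f' = scale (of_int c) h"
      using f(3) by (rule multiplesE)
    show "f = f'"
    proof (rule PiE_ext[OF f(1,2)])
      fix b assume b: "b \<in> B"
      then have bL: "b \<in> L" using BL by blast
      have "form (\<psi> f - \<psi> f') b = of_int (f b - f' b) * form b b"
        unfolding \<psi>_def form_diff_left
        by (simp add: orthogonal_family_coefficient[OF B(1) order_refl b] algebra_simps)
      moreover have "form b b = of_int (2 * \<lfloor>q b\<rfloor>)"
        using q_floor[OF b] by (simp add: q_def)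
      moreover obtain e where "form h b = of_int e"
        using form_integral[OF h(1) bL] by (rule Ints_cases)
      ultimately have "(of_int ((f b - f' b) * (2 * \<lfloor>q b\<rfloor>)) :: rat) = of_int (c * e)"
        unfolding h(2) form_scale_left by simp
      then have "c dvd (f b - f' b) * (2 * \<lfloor>q b\<rfloor>)"
        by (simp only: of_int_eq_iff dvd_triv_left)
      moreover have "coprime c (2 * \<lfloor>q b\<rfloor>)"
      proof -
        have "\<not> p dvd 2" using p zdvd_imp_le[of p 2] by auto
        then have "\<not> p dvd 2 * \<lfloor>q b\<rfloor>"
          using Bq[OF b] p(1) by (simp add: prime_dvd_mult_iff)
        then show ?thesis
          unfolding c_def coprime_power_left_iff using prime_imp_coprime[OF p(1)] by blast
      qed
      ultimately have "c dvd f b - f' b"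
        by (simp add: coprime_dvd_mult_left_iff)
      then have "[f b = f' b] (mod c)"
        by (simp add: cong_iff_dvd_diff)
      moreover have "f b \<in> {0..<c}" "f' b \<in> {0..<c}"
        using f(1,2) b by (auto dest: PiE_mem)
      ultimately show "f b = f' b"
        by (auto simp: cong_def)
    qed
  qed
  also have "\<dots> = (\<Sum>f\<in>PiE B (\<lambda>_. {0..<c}). \<Prod>b\<in>B. ec c (x * \<lfloor>q b\<rfloor> * (f b)\<^sup>2 + 0 * f b))"
  proof (rule sum.cong[OF refl])
    fix f
    have "of_int x * q (\<psi> f) / of_int c = (\<Sum>b\<in>B. of_int (x * \<lfloor>q b\<rfloor> * (f b)\<^sup>2 + 0 * f b) / of_int c)"
      unfolding \<psi>_def q_orthogonal_comb[OF B(1)] sum_distrib_left sum_divide_distrib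
    proof (rule sum.cong[OF refl])
      fix b assume "b \<in> B"
      then show "of_int x * ((of_int (f b))\<^sup>2 * q b) / of_int c = of_int (x * \<lfloor>q b\<rfloor> * (f b)\<^sup>2 + 0 * f b) / of_int c"
        by (subst q_floor) simp_all
    qed
    then show "ee (of_int x * q (\<psi> f) / of_int c) = (\<Prod>b\<in>B. ec c (x * \<lfloor>q b\<rfloor> * (f b)\<^sup>2 + 0 * f b))"
      using Bfin by (simp only: ee_sum ec_def)
  qed
  also have "\<dots> = (\<Prod>b\<in>B. gauss c (x * \<lfloor>q b\<rfloor>) 0)"
    unfolding gauss_def using Bfin by (intro prod_sum_PiE[symmetric]) simp_all
  finally show ?thesis
    by (simp only: c_def)
qed

text \<open>Each of the g Gauss sums contributes the k-th power of the symbol of x. That symbol is 1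
  or -1, so for odd g the product is again its k-th power.\<close>

lemma qsum_prime_power_legendre:
  assumes p: "prime p" "p > 2" "\<not> p dvd lattice_det" and rank: "odd lattice_rank"
  shows "\<exists>\<eta>. norm \<eta> \<le> sqrt (of_int (p ^ k)) ^ lattice_rank \<and>
    (\<forall>x. \<not> p dvd x \<longrightarrow> qsum (p ^ k) x = \<eta> * of_int (Legendre x p) ^ k)"
proof -
  obtain B where B: "orthogonal_family p B" "span B = UNIV"
    using ex_orthogonal_basis[OF p] by blast
  have Bfin: "finite B" and Bq: "\<And>b. b \<in> B \<Longrightarrow> \<not> p dvd \<lfloor>q b\<rfloor>"
    using B(1) unfolding orthogonal_family_def by blast+
  have card_B: "card B = lattice_rank"
    by (rule card_spanning_independent[OF orthogonal_family_independent[OF B(1)] B(2)])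
  define \<eta> where "\<eta> = (\<Prod>b\<in>B. of_int (Legendre \<lfloor>q b\<rfloor> p) ^ k * gauss (p ^ k) 1 0)"
  have odd_p: "odd p"
    using prime_odd_int[of p] p by simp
  have norm_gauss1: "norm (gauss (p ^ k) 1 0) = sqrt (of_int (p ^ k))"
    using odd_p p by (intro norm_gauss) simp_all
  have "norm \<eta> = (\<Prod>b\<in>B. sqrt (of_int (p ^ k)))"
    unfolding \<eta>_def prod_norm[symmetric]
  proof (rule prod.cong[OF refl])
    fix b assume "b \<in> B"
    then have "norm (of_int (Legendre \<lfloor>q b\<rfloor> p) :: complex) = 1"
      using legendre_cases[OF Bq] by fastforce
    then show "norm (of_int (Legendre \<lfloor>q b\<rfloor> p) ^ k * gauss (p ^ k) 1 0) = sqrt (of_int (p ^ k))"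
      by (simp add: norm_mult norm_power norm_gauss1)
  qed
  then have "norm \<eta> \<le> sqrt (of_int (p ^ k)) ^ lattice_rank"
    by (simp add: card_B)
  moreover have "qsum (p ^ k) x = \<eta> * of_int (Legendre x p) ^ k" if x: "\<not> p dvd x" for x
  proof -
    have "qsum (p ^ k) x = (\<Prod>b\<in>B. gauss (p ^ k) (x * \<lfloor>q b\<rfloor>) 0)"
      by (rule qsum_prime_power[OF p(1,2) B])
    also have "\<dots> = (\<Prod>b\<in>B. of_int (Legendre x p) ^ k * (of_int (Legendre \<lfloor>q b\<rfloor> p) ^ k * gauss (p ^ k) 1 0))"
    proof (rule prod.cong[OF refl])
      fix b assume "b \<in> B"
      then have "\<not> p dvd x * \<lfloor>q b\<rfloor>"
        using x Bq p(1) by (simp add: prime_dvd_mult_iff)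
      then show "gauss (p ^ k) (x * \<lfloor>q b\<rfloor>) 0 =
          of_int (Legendre x p) ^ k * (of_int (Legendre \<lfloor>q b\<rfloor> p) ^ k * gauss (p ^ k) 1 0)"
        by (simp add: gauss_prime_power[OF p(1,2)] legendre_mult[OF p(1,2)] power_mult_distrib)
    qed
    also have "\<dots> = (of_int (Legendre x p) ^ k) ^ lattice_rank * \<eta>"
      unfolding prod.distrib \<eta>_def by (simp add: card_B)
    also have "((of_int (Legendre x p) :: complex) ^ k) ^ lattice_rank = of_int (Legendre x p) ^ k"
    proof -
      have "((of_int (Legendre x p) :: complex) ^ k) ^ lattice_rank = of_int ((Legendre x p ^ lattice_rank) ^ k)"
        by (simp add: mult.commute flip: power_mult)
      also have "Legendre x p ^ lattice_rank = Legendre x p"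
        using legendre_power[OF x] rank by simp
      finally show ?thesis by simp
    qed
    finally show ?thesis by (simp only: mult.commute)
  qed
  ultimately show ?thesis by blast
qed

end

section \<open>The phase of a Kloosterman sum\<close>

locale kloosterman_data = even_lattice scale L form
  for scale :: "rat \<Rightarrow> 'v :: ab_group_add \<Rightarrow> 'v" and L :: "'v set" and form :: "'v \<Rightarrow> 'v \<Rightarrow> rat" +
  fixes \<alpha> \<beta> :: 'v and m n :: int
  assumes \<alpha>: "\<alpha> \<in> dual_lattice" and \<beta>: "\<beta> \<in> dual_lattice"
    and m_class: "of_int m / (2 * of_int lattice_det) - q \<alpha> \<in> \<int>"
    and n_class: "of_int n / (2 * of_int lattice_det) - q \<beta> \<in> \<int>"
begin

definition Aval :: "'v \<Rightarrow> rat" where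
  "Aval r = of_int m / (2 * of_int lattice_det) - q (\<alpha> + r)"

definition Dval :: rat where
  "Dval = of_int n / (2 * of_int lattice_det) - q \<beta>"

text \<open>This is X of the overview. Splitting off \<open>Aval\<close> and \<open>Dval\<close>
  shows that a and d have integral coefficients, so that only their residues modulo c
  matter.\<close>

definition phase :: "int \<Rightarrow> int \<Rightarrow> 'v \<Rightarrow> rat" where
  "phase d a r = of_int a * Aval r + form \<beta> r + of_int d * Dval"

definition tsum :: "int \<Rightarrow> int \<Rightarrow> complex" where
  "tsum c w = (\<Sum>(d, a)\<in>unit_pairs c. lsum c (\<lambda>r. ee (of_int w * phase d a r / of_int c)))"

lemma Aval_integral: "r \<in> L \<Longrightarrow> Aval r \<in> \<int>"
proof -
  assume r: "r \<in> L"
  have "Aval r = (of_int m / (2 * of_int lattice_det) - q \<alpha>) - form \<alpha> r - q r"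
    by (simp add: Aval_def q_add)
  also have "\<dots> \<in> \<int>"
    by (rule Ints_diff[OF Ints_diff[OF m_class form_dual_integral[OF \<alpha> r]] q_integral[OF r]])
  finally show ?thesis .
qed

lemma Dval_integral: "Dval \<in> \<int>"
  using n_class by (simp add: Dval_def)

lemma phase_integral: "r \<in> L \<Longrightarrow> phase d a r \<in> \<int>"
  unfolding phase_def
  by (intro Ints_add Ints_mult Ints_of_int Aval_integral Dval_integral form_dual_integral \<beta>)

lemma phase_periodic:
  assumes "c \<noteq> 0"
  shows "periodic c (\<lambda>r. ee (of_int w * phase d a r / of_int c))"
  unfolding periodic_def
proof (intro ballI)
  fix r h assume r: "r \<in> L" and h: "h \<in> L"
  define z where "z = form \<beta> h - of_int a * (form \<alpha> h + form r h + of_int c * q h)"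
  have "phase d a (r + scale (of_int c) h) - phase d a r = of_int c * z"
    by (simp add: z_def phase_def Aval_def q_add q_scale form_bilinear power2_eq_square algebra_simps)
  moreover have "z \<in> \<int>"
    unfolding z_def
    by (intro Ints_diff Ints_add Ints_mult Ints_of_int form_dual_integral[OF \<alpha> h] form_dual_integral[OF \<beta> h]
        form_integral[OF r h] q_integral[OF h])
  ultimately show "ee (of_int w * phase d a (r + scale (of_int c) h) / of_int c) = ee (of_int w * phase d a r / of_int c)"
    by (rule ee_scaled_cong[OF assms])
qed

lemma phase_cong:
  assumes "c \<noteq> 0" "[d = d'] (mod c)" "[a = a'] (mod c)" "r \<in> L"
  shows "ee (of_int w * phase d a r / of_int c) = ee (of_int w * phase d' a' r / of_int c)"
proof -
  obtain i where i: "d - d' = c * i"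
    using assms(2) by (auto simp: cong_iff_dvd_diff elim: dvdE)
  obtain j where j: "a - a' = c * j"
    using assms(3) by (auto simp: cong_iff_dvd_diff elim: dvdE)
  have "phase d a r - phase d' a' r = of_int (a - a') * Aval r + of_int (d - d') * Dval"
    by (simp add: phase_def algebra_simps)
  also have "\<dots> = of_int c * (of_int j * Aval r + of_int i * Dval)"
    unfolding i j by (simp add: algebra_simps)
  finally show ?thesis
    by (rule ee_scaled_cong[OF assms(1)])
      (intro Ints_add Ints_mult Ints_of_int Aval_integral[OF assms(4)] Dval_integral)
qed

lemma lsum_phase_cong:
  assumes "c \<noteq> 0" "[d = d'] (mod c)" "[a = a'] (mod c)"
  shows "lsum c (\<lambda>r. ee (of_int w * phase d a r / of_int c)) = lsum c (\<lambda>r. ee (of_int w * phase d' a' r / of_int c))"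
  by (rule lsum_cong) (rule phase_cong[OF assms])

text \<open>From e1 c1 + e2 c2 = 1 follows 1 / (c1 c2) = e2 / c1 + e1 / c2. Only the twist changes;
  both factors have the same phase.\<close>

lemma tsum_crt:
  assumes c: "c1 > 0" "c2 > 0" "coprime c1 c2" and w: "coprime w (c1 * c2)"
  shows "\<exists>w1 w2. coprime w1 c1 \<and> coprime w2 c2 \<and> tsum (c1 * c2) w = tsum c1 w1 * tsum c2 w2"
proof -
  obtain e1 e2 where e: "e1 * c1 + e2 * c2 = 1"
    using bezout_int[of c1 c2] c(3) unfolding coprime_iff_gcd_eq_1 by metis
  have "e2 * c2 - 1 = - (e1 * c1)" "e1 * c1 - 1 = - (e2 * c2)"
    using e by linarith+
  moreover have "c1 dvd - (e1 * c1)" "c2 dvd - (e2 * c2)"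
    by simp_all
  ultimately have "[e2 * c2 = 1] (mod c1)" "[e1 * c1 = 1] (mod c2)"
    by (simp_all only: cong_iff_dvd_diff)
  then have "coprime e2 c1" "coprime e1 c2"
    using coprime_of_cong_inverse[of c2 e2 c1] coprime_of_cong_inverse[of c1 e1 c2] by (simp_all add: mult.commute)
  then have cop: "coprime (w * e2) c1" "coprime (w * e1) c2"
    using w by auto
  have split: "ee (of_int w * x / of_int (c1 * c2)) =
      ee (of_int (w * e2) * x / of_int c1) * ee (of_int (w * e1) * x / of_int c2)" for x
  proof -
    have "of_int (e1 * c1 + e2 * c2) = (1 :: rat)"
      by (simp only: e of_int_1)
    then have "of_int w * x / of_int (c1 * c2) = of_int w * x * of_int (e1 * c1 + e2 * c2) / of_int (c1 * c2)"
      by (simp only: mult_1_right)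
    also have "\<dots> = of_int (w * e2) * x / of_int c1 + of_int (w * e1) * x / of_int c2"
      using c by (simp add: field_simps)
    finally show ?thesis
      by (simp only: ee_add)
  qed
  have "tsum (c1 * c2) w = (\<Sum>(d, a)\<in>unit_pairs (c1 * c2).
      lsum c1 (\<lambda>r. ee (of_int (w * e2) * phase d a r / of_int c1)) *
      lsum c2 (\<lambda>r. ee (of_int (w * e1) * phase d a r / of_int c2)))"
    unfolding tsum_def split
  proof (rule sum.cong[OF refl], clarify)
    fix d a
    show "lsum (c1 * c2) (\<lambda>r. ee (of_int (w * e2) * phase d a r / of_int c1) * ee (of_int (w * e1) * phase d a r / of_int c2)) =
        lsum c1 (\<lambda>r. ee (of_int (w * e2) * phase d a r / of_int c1)) *
        lsum c2 (\<lambda>r. ee (of_int (w * e1) * phase d a r / of_int c2))"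
      using c(1,2) by (intro lsum_crt[OF c] phase_periodic) simp_all
  qed
  also have "\<dots> = tsum c1 (w * e2) * tsum c2 (w * e1)"
    unfolding tsum_def by (rule unit_pairs_crt[OF c]; rule lsum_phase_cong; use c in simp)
  finally show ?thesis
    using cop by blast
qed

text \<open>Weyl differencing. In the squared modulus the inner sum is a character sum, which
  vanishes unless h pairs with L into multiples of c, because w a is a unit. Then h / c is in the
  dual lattice and \<Delta> h in c L; at most |\<Delta>|^g such h exist, each contributing at most
  c^g. This covers moduli sharing primes with \<Delta>.\<close>

lemma norm_lsum_phase:
  assumes c: "c > 0" and a: "coprime a c" and w: "coprime w c"
  shows "norm (lsum c (\<lambda>r. ee (of_int w * phase d a r / of_int c)))
    \<le> sqrt (of_int (\<bar>lattice_det\<bar> * c) ^ lattice_rank)"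
proof -
  define F where "F = (\<lambda>r. ee (of_int w * phase d a r / of_int c))"
  define S where "S = lsum c F"
  define \<theta> where "\<theta> = (\<lambda>h. ee (of_int w * (form \<beta> h - of_int a * (form \<alpha> h + q h)) / of_int c))"
  define \<phi> where "\<phi> = (\<lambda>h s. - (of_int (w * a) * form s h / of_int c))"
  have F_per: "periodic c F"
    unfolding F_def using c by (intro phase_periodic) simp
  have \<phi>_per: "periodic c (\<lambda>s. ee (\<phi> h s))" if h: "h \<in> L" for h
    unfolding periodic_def
  proof (intro ballI)
    fix r t assume "r \<in> L" "t \<in> L"
    show "ee (\<phi> h (r + scale (of_int c) t)) = ee (\<phi> h r)"
    proof (rule ee_cong)
      have "\<phi> h (r + scale (of_int c) t) - \<phi> h r = - (of_int (w * a) * form t h)"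
        using c by (simp add: \<phi>_def form_bilinear field_simps)
      also have "\<dots> \<in> \<int>"
        using form_integral[OF \<open>t \<in> L\<close> h] by (intro Ints_minus Ints_mult) auto
      finally show "\<phi> h (r + scale (of_int c) t) - \<phi> h r \<in> \<int>" .
    qed
  qed
  have diff: "F (h + s) * cnj (F s) = \<theta> h * ee (\<phi> h s)" for h s
  proof -
    have "of_int w * phase d a (h + s) / of_int c + - (of_int w * phase d a s / of_int c) =
        of_int w * (form \<beta> h - of_int a * (form \<alpha> h + q h)) / of_int c + \<phi> h s"
      using c by (simp add: phase_def Aval_def q_add \<phi>_def form_bilinear form_sym[of h s] field_simps)
    then show ?thesis
      unfolding F_def \<theta>_def cnj_ee ee_add[symmetric] by (simp only:)
  qed
  have kernel: "scale (of_int lattice_det) h \<in> multiples c" if h: "h \<in> L" and int: "\<forall>s\<in>L. \<phi> h s \<in> \<int>" for h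
  proof -
    have "form (scale (1 / of_int c) h) s \<in> \<int>" if s: "s \<in> L" for s
    proof -
      obtain e where e: "form s h = of_int e"
        using form_integral[OF s h] by (rule Ints_cases)
      obtain f where "\<phi> h s = of_int f"
        using int s by (metis Ints_cases)
      then have "(of_int (w * a * e) :: rat) = of_int (c * (- f))"
        using c by (simp add: \<phi>_def e field_simps)
      then have "c dvd w * a * e"
        by (simp only: of_int_eq_iff dvd_triv_left)
      moreover have "coprime c (w * a)"
        using a w by (simp add: coprime_commute)
      ultimately have "c dvd e"
        by (simp add: coprime_dvd_mult_right_iff)
      then obtain j where "e = c * j" ..
      then have "form (scale (1 / of_int c) h) s = of_int j"
        using c by (simp add: form_scale_left form_sym[of h s] e)
      then show ?thesis by simp
    qed
    then have "scale (1 / of_int c) h \<in> dual_lattice"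
      by (simp add: dual_lattice_def)
    then have "scale (of_int c) (scale (of_int lattice_det) (scale (1 / of_int c) h)) \<in> multiples c"
      by (intro multiplesI det_scale_dual)
    moreover have "scale (of_int c) (scale (of_int lattice_det) (scale (1 / of_int c) h)) = scale (of_int lattice_det) h"
      using c by simp
    ultimately show ?thesis by (simp only:)
  qed
  have S_box: "S = (\<Sum>x\<in>box c. F (box_point x))"
    unfolding S_def by (rule lsum_box[OF c F_per])
  have "of_real ((norm S)\<^sup>2) = S * cnj S"
    by (rule complex_norm_square)
  also have "\<dots> = (\<Sum>y\<in>box c. S * cnj (F (box_point y)))"
    by (simp add: S_box cnj_sum sum_distrib_left)
  also have "\<dots> = (\<Sum>y\<in>box c. \<Sum>x\<in>box c. F (box_point x + box_point y) * cnj (F (box_point y)))"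
  proof (rule sum.cong[OF refl])
    fix y
    have "S = lsum c (\<lambda>r. F (r + box_point y))"
      unfolding S_def by (rule lsum_shift[OF c F_per box_point_lattice, symmetric])
    also have "periodic c (\<lambda>r. F (r + box_point y))"
      using periodic_affine[OF F_per box_point_lattice, of 1 y] by simp
    then have "lsum c (\<lambda>r. F (r + box_point y)) = (\<Sum>x\<in>box c. F (box_point x + box_point y))"
      by (rule lsum_box[OF c])
    finally show "S * cnj (F (box_point y)) = (\<Sum>x\<in>box c. F (box_point x + box_point y) * cnj (F (box_point y)))"
      by (simp add: sum_distrib_right)
  qed
  also have "\<dots> = (\<Sum>x\<in>box c. \<theta> (box_point x) * (\<Sum>y\<in>box c. ee (\<phi> (box_point x) (box_point y))))"
    unfolding diff by (subst sum.swap) (simp add: sum_distrib_left)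
  also have "\<dots> = (\<Sum>x\<in>box c. \<theta> (box_point x) * (if \<forall>s\<in>L. \<phi> (box_point x) s \<in> \<int> then of_int c ^ lattice_rank else 0))"
  proof (rule sum.cong[OF refl])
    fix x
    have "(\<Sum>y\<in>box c. ee (\<phi> (box_point x) (box_point y))) = lsum c (\<lambda>s. ee (\<phi> (box_point x) s))"
      by (rule lsum_box[OF c \<phi>_per[OF box_point_lattice], symmetric])
    also have "\<dots> = (if \<forall>s\<in>L. \<phi> (box_point x) s \<in> \<int> then of_int c ^ lattice_rank else 0)"
      by (rule lsum_linear[OF c \<phi>_per[OF box_point_lattice]]) (simp add: \<phi>_def form_add_left algebra_simps add_divide_distrib)
    finally show "\<theta> (box_point x) * (\<Sum>y\<in>box c. ee (\<phi> (box_point x) (box_point y))) =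
        \<theta> (box_point x) * (if \<forall>s\<in>L. \<phi> (box_point x) s \<in> \<int> then of_int c ^ lattice_rank else 0)"
      by simp
  qed
  finally have "(norm S)\<^sup>2 = norm (\<Sum>x\<in>box c. \<theta> (box_point x) * (if \<forall>s\<in>L. \<phi> (box_point x) s \<in> \<int> then of_int c ^ lattice_rank else 0))"
    by (metis abs_of_nonneg norm_of_real zero_le_power2)
  also have "\<dots> \<le> (\<Sum>x\<in>box c. norm (\<theta> (box_point x) * (if \<forall>s\<in>L. \<phi> (box_point x) s \<in> \<int> then of_int c ^ lattice_rank else 0)))"
    by (rule norm_sum)
  also have "\<dots> \<le> (\<Sum>x\<in>box c. if scale (of_int lattice_det) (box_point x) \<in> multiples c then of_int c ^ lattice_rank else 0)"
  proof (rule sum_mono)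
    fix x
    show "norm (\<theta> (box_point x) * (if \<forall>s\<in>L. \<phi> (box_point x) s \<in> \<int> then of_int c ^ lattice_rank else 0))
        \<le> (if scale (of_int lattice_det) (box_point x) \<in> multiples c then of_int c ^ lattice_rank else 0)"
      using kernel[OF box_point_lattice, of x] c by (auto simp: norm_mult norm_power \<theta>_def)
  qed
  also have "\<dots> = real (card {x \<in> box c. scale (of_int lattice_det) (box_point x) \<in> multiples c}) * of_int c ^ lattice_rank"
    by (simp add: sum.If_cases Int_def)
  also have "\<dots> \<le> real (nat \<bar>lattice_det\<bar> ^ lattice_rank) * of_int c ^ lattice_rank"
    using c by (intro mult_right_mono of_nat_mono card_box_kernel) simp_all
  also have "\<dots> = of_int (\<bar>lattice_det\<bar> * c) ^ lattice_rank"
    by (simp add: power_mult_distrib)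
  finally show ?thesis
    unfolding S_def F_def by (rule real_le_rsqrt)
qed

text \<open>Away from the discriminant the classes of \<open>\<alpha>\<close> and \<open>\<beta>\<close> have representatives in \<open>L\<close>,
  namely their multiples by an integer \<open>t\<close> with \<open>2 \<Delta> dvd t\<close> and \<open>t \<equiv> 1 (mod c)\<close>; then the
  square can be completed inside \<open>L\<close>.\<close>

lemma lsum_phase_coprime:
  assumes c: "c > 0" and cop: "coprime (2 * lattice_det) c"
  shows "\<exists>\<mu> \<kappa>. coprime \<mu> c \<and> (\<forall>w d a. [a * d = 1] (mod c) \<longrightarrow>
    lsum c (\<lambda>r. ee (of_int w * phase d a r / of_int c)) =
      ee (of_int w * \<kappa>) * ec c (w * (\<mu> * m * a + \<mu> * n * d)) * qsum c (- (w * a)))"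
proof -
  let ?D = "lattice_det"
  obtain s where s: "[2 * ?D * s = 1] (mod c)"
    using cong_solve_coprime_int[OF cop] by blast
  define t where "t = 2 * ?D * s"
  \<comment> \<open>This is t^2 / (2 \<Delta>): multiplying the phase by t^2, which is 1 modulo c,
    replaces the fractions m / (2 \<Delta>) and n / (2 \<Delta>) by the integers \<mu> m and \<mu>
    n.\<close>
  define \<mu> where "\<mu> = 2 * ?D * s\<^sup>2"
  define \<alpha>' where "\<alpha>' = scale (of_int t) \<alpha>"
  define \<beta>' where "\<beta>' = scale (of_int t) \<beta>"
  define \<kappa> where "\<kappa> = - (form \<alpha>' \<beta>' / of_int c)"
  have "scale (of_int (2 * s)) (scale (of_int ?D) \<alpha>) \<in> L" "scale (of_int (2 * s)) (scale (of_int ?D) \<beta>) \<in> L"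
    by (intro lattice_scale det_scale_dual \<alpha> \<beta>)+
  then have in_L: "\<alpha>' \<in> L" "\<beta>' \<in> L"
    by (simp_all add: \<alpha>'_def \<beta>'_def t_def ac_simps)
  have t1: "[t\<^sup>2 = 1] (mod c)"
    using cong_pow[OF s, of 2] by (simp add: t_def)
  have cop_t: "coprime t c"
    using coprime_of_cong_inverse(2)[of 1 t c] s by (simp add: t_def)
  then have cop_\<mu>: "coprime \<mu> c"
    by (simp add: t_def \<mu>_def power2_eq_square)
  have mu_eq: "of_int (t\<^sup>2) * (of_int x / (2 * of_int ?D)) = (of_int (\<mu> * x) :: rat)" for x
    using lattice_det_nonzero by (simp add: t_def \<mu>_def power2_eq_square field_simps)
  have "lsum c (\<lambda>r. ee (of_int w * phase d a r / of_int c)) =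
      ee (of_int w * \<kappa>) * ec c (w * (\<mu> * m * a + \<mu> * n * d)) * qsum c (- (w * a))"
    if ad: "[a * d = 1] (mod c)" for w d a
  proof -
    \<comment> \<open>Put \<rho> = \<alpha>' + t r. As a d = 1 modulo c, a q(\<rho>) minus the
      pairing of \<rho> and \<beta>' equals a q(\<rho> - d \<beta>') up to d q(\<beta>'), which
      cancels in the phase; \<kappa> remains from the pairing of \<alpha>' and \<beta>'. Finally
      \<rho> - d \<beta>' = t r + h.\<close>
    define h where "h = \<alpha>' - scale (of_int d) \<beta>'"
    have hL: "h \<in> L"
      unfolding h_def by (intro lattice_diff lattice_scale in_L)
    have key: "ee (of_int w * phase d a r / of_int c) =
        (ee (of_int w * \<kappa>) * ec c (w * (\<mu> * m * a + \<mu> * n * d))) *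
        ee (of_int (- (w * a)) * q (scale (of_int t) r + h) / of_int c)" if r: "r \<in> L" for r
    proof -
      define \<rho> where "\<rho> = \<alpha>' + scale (of_int t) r"
      have \<rho>L: "\<rho> \<in> L"
        unfolding \<rho>_def by (intro lattice_add lattice_scale in_L r)
      define Y where "Y = of_int (\<mu> * m * a + \<mu> * n * d) - form \<alpha>' \<beta>' - of_int a * q (scale (of_int t) r + h)"
      obtain i where i: "t\<^sup>2 - 1 = c * i"
        using t1 unfolding cong_iff_dvd_diff by (rule dvdE)
      have "of_int (t\<^sup>2) * phase d a r - phase d a r = of_int (t\<^sup>2 - 1) * phase d a r"
        by (simp add: algebra_simps)
      also have "\<dots> = of_int c * (of_int i * phase d a r)"
        unfolding i by simp
      finally have 1: "ee (of_int w * (of_int (t\<^sup>2) * phase d a r) / of_int c) = ee (of_int w * phase d a r / of_int c)"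
        using c by (intro ee_scaled_cong) (auto intro: Ints_mult phase_integral[OF r])
      have q_t: "of_int (t\<^sup>2) * q (\<alpha> + r) = q \<rho>" "of_int (t\<^sup>2) * q \<beta> = q \<beta>'"
        "of_int (t\<^sup>2) * form \<beta> r = form \<beta>' (scale (of_int t) r)"
        by (simp_all add: \<rho>_def \<alpha>'_def \<beta>'_def q_scale form_bilinear power2_eq_square flip: scale_right_distrib)
      have t2_phase: "of_int (t\<^sup>2) * phase d a r =
          of_int a * (of_int (\<mu> * m) - q \<rho>) + form \<beta>' (scale (of_int t) r) + of_int d * (of_int (\<mu> * n) - q \<beta>')"
        unfolding phase_def Aval_def Dval_def mu_eq[symmetric] q_t[symmetric]
        by (simp add: algebra_simps)
      have q_h: "q (scale (of_int t) r + h) = q \<rho> - of_int d * form \<rho> \<beta>' + of_int d ^ 2 * q \<beta>'"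
      proof -
        have "scale (of_int t) r + h = \<rho> + scale (- of_int d) \<beta>'"
          by (simp add: h_def \<rho>_def)
        then show ?thesis
          by (simp only: q_add q_scale form_scale_right) simp
      qed
      obtain j where j: "a * d - 1 = c * j"
        using ad unfolding cong_iff_dvd_diff by (rule dvdE)
      have "of_int (t\<^sup>2) * phase d a r - Y = of_int (a * d - 1) * (of_int d * q \<beta>' - form \<rho> \<beta>')"
        unfolding t2_phase Y_def q_h
        by (simp add: \<rho>_def form_bilinear form_sym[of \<beta>'] algebra_simps power2_eq_square)
      also have "\<dots> = of_int c * (of_int j * (of_int d * q \<beta>' - form \<rho> \<beta>'))"
        unfolding j by simp
      finally have 2: "ee (of_int w * (of_int (t\<^sup>2) * phase d a r) / of_int c) = ee (of_int w * Y / of_int c)"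
        using c by (intro ee_scaled_cong)
          (auto intro!: Ints_mult Ints_diff q_integral form_integral in_L \<rho>L)
      have "of_int w * Y / of_int c = of_int w * \<kappa> + of_int (w * (\<mu> * m * a + \<mu> * n * d)) / of_int c
          + of_int (- (w * a)) * q (scale (of_int t) r + h) / of_int c"
        by (simp add: Y_def \<kappa>_def algebra_simps add_divide_distrib diff_divide_distrib)
      then show ?thesis
        using 1 2 by (simp only: ee_add ec_def)
    qed
    have "lsum c (\<lambda>r. ee (of_int w * phase d a r / of_int c)) =
        (ee (of_int w * \<kappa>) * ec c (w * (\<mu> * m * a + \<mu> * n * d))) *
        lsum c (\<lambda>r. ee (of_int (- (w * a)) * q (scale (of_int t) r + h) / of_int c))"
      unfolding lsum_mult_left[symmetric] by (rule lsum_cong) (rule key)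
    also have "lsum c (\<lambda>r. ee (of_int (- (w * a)) * q (scale (of_int t) r + h) / of_int c)) = qsum c (- (w * a))"
      unfolding qsum_def
      by (rule lsum_affine[where F = "\<lambda>r. ee (of_int (- (w * a)) * q r / of_int c)", OF c periodic_q cop_t hL])
        (use c in simp)
    finally show ?thesis .
  qed
  with cop_\<mu> show ?thesis by blast
qed

text \<open>The lattice contributes only the constant \<epsilon>, of modulus at most p^(g k / 2),
  and the Legendre symbol of a. The unit w \<mu> becomes the multiplier in
  \<open>norm_local_kloosterman\<close>.\<close>

lemma norm_tsum_prime_power:
  assumes p: "prime p" "p > 2" "\<not> p dvd lattice_det" and rank: "odd lattice_rank"
    and k: "k \<ge> 1" and w: "\<not> p dvd w" and m: "m = m0 * v\<^sup>2"
  shows "norm (tsum (p ^ k) w) \<le> 2 * sqrt (of_int (gcd (m0 * n) (p ^ k))) * sqrt (of_int (p ^ k)) ^ (lattice_rank + 1)"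
proof -
  define c where "c = p ^ k"
  have c: "c > 0" using p by (simp add: c_def)
  have "\<not> p dvd 2" using p zdvd_imp_le[of p 2] by auto
  then have "\<not> p dvd 2 * lattice_det"
    using p by (simp add: prime_dvd_mult_iff)
  then have "coprime (2 * lattice_det) c"
    unfolding c_def using coprime_prime_power_iff[of p k] p(1) k by simp
  then obtain \<mu> \<kappa> where \<mu>: "coprime \<mu> c"
    and lsum_eq: "\<And>w d a. [a * d = 1] (mod c) \<Longrightarrow> lsum c (\<lambda>r. ee (of_int w * phase d a r / of_int c)) =
      ee (of_int w * \<kappa>) * ec c (w * (\<mu> * m * a + \<mu> * n * d)) * qsum c (- (w * a))"
    using lsum_phase_coprime[OF c] by blast
  obtain \<eta> where \<eta>: "norm \<eta> \<le> sqrt (of_int c) ^ lattice_rank"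
    and qsum_eq: "\<And>x. \<not> p dvd x \<Longrightarrow> qsum c x = \<eta> * of_int (Legendre x p) ^ k"
    using qsum_prime_power_legendre[OF p rank, of k] unfolding c_def by blast
  define \<epsilon> :: complex where "\<epsilon> = ee (of_int w * \<kappa>) * \<eta> * of_int (Legendre (- w) p) ^ k"
  have \<mu>p: "\<not> p dvd w * \<mu>"
    using \<mu> w p(1) k coprime_prime_power_iff[of p k \<mu>] by (simp add: c_def prime_dvd_mult_iff)
  have "tsum c w = (\<Sum>(d, a)\<in>unit_pairs c. \<epsilon> * (of_int (Legendre a p) ^ k * ec c ((w * \<mu>) * m * a + (w * \<mu>) * n * d)))"
    unfolding tsum_def
  proof (rule sum.cong[OF refl], clarify)
    fix d a assume da: "(d, a) \<in> unit_pairs c"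
    then have ad: "[a * d = 1] (mod c)"
      by (simp add: unit_pairs_def)
    then have "coprime a c"
      by (rule coprime_of_cong_inverse)
    then have "\<not> p dvd a"
      using coprime_prime_power_iff[of p k a] p(1) k by (simp add: c_def)
    then have "\<not> p dvd - (w * a)"
      using w p(1) by (simp add: prime_dvd_mult_iff)
    then have "qsum c (- (w * a)) = \<eta> * (of_int (Legendre (- w) p) ^ k * of_int (Legendre a p) ^ k)"
      using qsum_eq legendre_mult[OF p(1,2), of "- w" a] by (simp add: power_mult_distrib)
    moreover have "w * (\<mu> * m * a + \<mu> * n * d) = (w * \<mu>) * m * a + (w * \<mu>) * n * d"
      by (simp add: algebra_simps)
    ultimately show "lsum c (\<lambda>r. ee (of_int w * phase d a r / of_int c)) =
        \<epsilon> * (of_int (Legendre a p) ^ k * ec c ((w * \<mu>) * m * a + (w * \<mu>) * n * d))"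
      unfolding lsum_eq[OF ad] \<epsilon>_def by (simp only: mult.assoc mult.left_commute mult.commute)
  qed
  also have "\<dots> = \<epsilon> * (\<Sum>(d, a)\<in>unit_pairs c. of_int (Legendre a p) ^ k * ec c ((w * \<mu>) * m * a + (w * \<mu>) * n * d))"
    by (simp add: sum_distrib_left case_prod_unfold)
  finally have "norm (tsum c w) = norm \<epsilon> * norm (\<Sum>(d, a)\<in>unit_pairs c. of_int (Legendre a p) ^ k * ec c ((w * \<mu>) * m * a + (w * \<mu>) * n * d))"
    by (simp only: norm_mult)
  also have "\<dots> \<le> sqrt (of_int c) ^ lattice_rank * (2 * sqrt (of_int (gcd (m0 * n) c)) * sqrt (of_int c))"
  proof (rule mult_mono)
    have "norm (of_int (Legendre (- w) p) :: complex) \<le> 1"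
      by (auto simp: Legendre_def)
    then have "norm (of_int (Legendre (- w) p) ^ k :: complex) \<le> 1"
      by (simp add: norm_power power_le_one)
    then have "norm \<eta> * norm (of_int (Legendre (- w) p) ^ k :: complex) \<le> norm \<eta> * 1"
      by (intro mult_left_mono) auto
    then show "norm \<epsilon> \<le> sqrt (of_int c) ^ lattice_rank"
      using \<eta> by (simp add: \<epsilon>_def norm_mult)
    show "norm (\<Sum>(d, a)\<in>unit_pairs c. of_int (Legendre a p) ^ k * ec c ((w * \<mu>) * m * a + (w * \<mu>) * n * d))
        \<le> 2 * sqrt (of_int (gcd (m0 * n) c)) * sqrt (of_int c)"
      unfolding c_def by (rule norm_local_kloosterman[OF p(1,2) k \<mu>p m])
  qed (use c in auto)
  finally show ?thesis
    by (simp add: c_def ac_simps)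
qed

end

section \<open>Moduli composed of primes dividing the discriminant\<close>

text \<open>The smaller of the exact powers of p in x - y and x + y divides 2 y and hence 2. So
  removing it from one factor is made up for by doubling the other. The doubling is needed for p =
  2: 8 divides (3 - 1) (3 + 1).\<close>

lemma prime_power_dvd_double_cases:
  fixes x y :: int
  assumes p: "prime p" and dvd: "p ^ k dvd (x - y) * (x + y)" and y: "k > 0 \<Longrightarrow> \<not> p dvd y"
  shows "p ^ k dvd 2 * (x - y) \<or> p ^ k dvd 2 * (x + y)"
proof (cases "k = 0 \<or> x - y = 0 \<or> x + y = 0")
  case True
  then show ?thesis by (elim disjE) simp_all
next
  case False
  then have nz: "x - y \<noteq> 0" "x + y \<noteq> 0" and "\<not> p dvd y"
    using y by auto
  have np: "\<not> is_unit p"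
    using p not_prime_unit by blast
  obtain x' where x': "x - y = p ^ multiplicity p (x - y) * x'" "\<not> p dvd x'"
    using multiplicity_decompose'[OF nz(1) np] by blast
  obtain y' where y': "x + y = p ^ multiplicity p (x + y) * y'" "\<not> p dvd y'"
    using multiplicity_decompose'[OF nz(2) np] by blast
  define i where "i = multiplicity p (x - y)"
  define l where "l = multiplicity p (x + y)"
  have half: "p ^ j dvd 2" if "p ^ j dvd x - y" "p ^ j dvd x + y" for j
  proof -
    have "p ^ j dvd (x + y) - (x - y)"
      by (rule dvd_diff[OF that(2,1)])
    then have "p ^ j dvd 2 * y" by simp
    moreover have "coprime (p ^ j) y"
      using prime_imp_coprime[OF p \<open>\<not> p dvd y\<close>] by (simp add: coprime_power_left_iff)
    ultimately show ?thesis
      by (simp add: coprime_dvd_mult_left_iff)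
  qed
  show ?thesis
  proof (cases "i \<le> l")
    case True
    have "p ^ i dvd x - y" "p ^ i dvd x + y"
      using True by (auto simp: i_def l_def multiplicity_dvd multiplicity_dvd')
    then have "p ^ i * (x + y) dvd 2 * (x + y)"
      by (intro mult_dvd_mono[OF half dvd_refl])
    moreover have "p ^ k dvd p ^ i * (x + y)"
    proof -
      have "x - y = p ^ i * x'"
        using x'(1) by (simp only: i_def)
      then have "p ^ k dvd (p ^ i * x') * (x + y)"
        using dvd by (simp only:)
      then have "p ^ k dvd x' * (p ^ i * (x + y))"
        by (simp only: mult.assoc mult.left_commute)
      moreover have "coprime (p ^ k) x'"
        using prime_imp_coprime[OF p x'(2)] by (simp add: coprime_power_left_iff)
      ultimately show ?thesis
        by (simp add: coprime_dvd_mult_right_iff)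
    qed
    ultimately show ?thesis
      using dvd_trans by blast
  next
    case False
    have "p ^ l dvd x - y" "p ^ l dvd x + y"
      using False by (auto simp: i_def l_def multiplicity_dvd multiplicity_dvd')
    then have "p ^ l * (x - y) dvd 2 * (x - y)"
      by (intro mult_dvd_mono[OF half dvd_refl])
    moreover have "p ^ k dvd p ^ l * (x - y)"
    proof -
      have "x + y = p ^ l * y'"
        using y'(1) by (simp only: l_def)
      then have "p ^ k dvd (x - y) * (p ^ l * y')"
        using dvd by (simp only:)
      then have "p ^ k dvd y' * (p ^ l * (x - y))"
        by (simp only: ac_simps)
      moreover have "coprime (p ^ k) y'"
        using prime_imp_coprime[OF p y'(2)] by (simp add: coprime_power_left_iff)
      ultimately show ?thesis
        by (simp add: coprime_dvd_mult_right_iff)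
    qed
    ultimately show ?thesis
      using dvd_trans by blast
  qed
qed

text \<open>Fix y0 in S. At each prime power exactly dividing N, 2 y is congruent to 2 y0 or to -2
  y0, and \<open>\<sigma> y\<close> records the primes where the first holds. So
  \<open>\<sigma> y\<close> fixes 2 y modulo N, and the quotient of 2 y by N, which is below 2 h,
  then fixes y.\<close>

lemma card_square_roots_smooth:
  fixes N h D :: int
  assumes N: "N > 0" and D: "D \<noteq> 0" and smooth: "\<And>p. prime p \<Longrightarrow> p dvd N \<Longrightarrow> p dvd D"
    and h: "h > 0" and S: "S \<subseteq> {0..<h * N}"
    and cop: "\<And>y. y \<in> S \<Longrightarrow> coprime y N"
    and sq: "\<And>x y. x \<in> S \<Longrightarrow> y \<in> S \<Longrightarrow> N dvd x\<^sup>2 - y\<^sup>2"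
  shows "card S \<le> 2 ^ card (prime_factors D) * nat (2 * h)"
proof (cases "S = {}")
  case False
  then obtain y0 where y0: "y0 \<in> S" by blast
  define P where "P = prime_factors D"
  define \<sigma> where "\<sigma> = (\<lambda>y. {p \<in> P. p ^ multiplicity p N dvd 2 * (y - y0)})"
  have Pfin: "finite P" by (simp add: P_def)
  have other: "p ^ multiplicity p N dvd 2 * (y + y0)"
    if y: "y \<in> S" and p: "prime p" and "\<not> p ^ multiplicity p N dvd 2 * (y - y0)" for y p
  proof -
    have "p ^ multiplicity p N dvd (y - y0) * (y + y0)"
      using dvd_trans[OF multiplicity_dvd sq[OF y y0]] by (simp add: power2_eq_square algebra_simps)
    moreover have "\<not> p dvd y0" if "multiplicity p N > 0"
    proof
      assume "p dvd y0"
      moreover have "p dvd N"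
        using that not_dvd_imp_multiplicity_0 by fastforce
      ultimately show False
        using coprime_common_divisor[OF cop[OF y0]] p not_prime_unit by blast
    qed
    ultimately have "p ^ multiplicity p N dvd 2 * (y - y0) \<or> p ^ multiplicity p N dvd 2 * (y + y0)"
      by (rule prime_power_dvd_double_cases[OF p])
    then show ?thesis
      using that(3) by blast
  qed
  have "inj_on (\<lambda>y. (\<sigma> y, 2 * y div N)) S"
  proof (rule inj_onI)
    fix y y' assume y: "y \<in> S" "y' \<in> S" and eq: "(\<sigma> y, 2 * y div N) = (\<sigma> y', 2 * y' div N)"
    have "p ^ multiplicity p N dvd 2 * (y - y')" if p: "prime p" for p
    proof (cases "p dvd N")
      case True
      then have pP: "p \<in> P"
        using smooth[OF p] p D by (simp add: P_def prime_factors_dvd)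
      show ?thesis
      proof (cases "p \<in> \<sigma> y")
        case True
        then have "p ^ multiplicity p N dvd 2 * (y - y0)" "p ^ multiplicity p N dvd 2 * (y' - y0)"
          using eq by (auto simp: \<sigma>_def)
        then have "p ^ multiplicity p N dvd 2 * (y - y0) - 2 * (y' - y0)"
          by (rule dvd_diff)
        then show ?thesis by (simp add: algebra_simps)
      next
        case False
        then have "\<not> p ^ multiplicity p N dvd 2 * (y - y0)" "\<not> p ^ multiplicity p N dvd 2 * (y' - y0)"
          using eq pP by (auto simp: \<sigma>_def)
        then have "p ^ multiplicity p N dvd 2 * (y + y0)" "p ^ multiplicity p N dvd 2 * (y' + y0)"
          using other y p by blast+
        then have "p ^ multiplicity p N dvd 2 * (y + y0) - 2 * (y' + y0)"
          by (rule dvd_diff)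
        then show ?thesis by (simp add: algebra_simps)
      qed
    next
      case False
      then show ?thesis by (simp add: not_dvd_imp_multiplicity_0)
    qed
    have "N dvd 2 * (y - y')"
    proof (cases "y = y'")
      case False
      show ?thesis
      proof (rule multiplicity_le_imp_dvd)
        fix p :: int assume p: "prime p"
        then have "p ^ multiplicity p N dvd 2 * (y - y')"
          by fact
        then show "multiplicity p N \<le> multiplicity p (2 * (y - y'))"
          using False p not_prime_unit by (intro multiplicity_geI) auto
      qed (use N in simp)
    qed simp
    then have "2 * y mod N = 2 * y' mod N"
      by (simp add: mod_eq_dvd_iff right_diff_distrib)
    moreover have "2 * y div N = 2 * y' div N"
      using eq by simp
    ultimately have "2 * y = 2 * y'"
      by (metis mult_div_mod_eq)
    then show "y = y'" by simp
  qed
  moreover have "(\<lambda>y. (\<sigma> y, 2 * y div N)) ` S \<subseteq> Pow P \<times> {0..<2 * h}"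
  proof clarify
    fix y assume "y \<in> S"
    then have "0 \<le> y" "y < h * N" using S by auto
    then have "0 \<le> 2 * y div N" "2 * y < (2 * h) * N"
      using N by (auto simp: pos_imp_zdiv_nonneg_iff)
    moreover have "2 * y div N * N \<le> 2 * y"
      using mult_div_mod_eq[of N "2 * y"] pos_mod_sign[OF N, of "2 * y"] mult.commute[of N "2 * y div N"] by linarith
    ultimately have "2 * y div N * N < (2 * h) * N"
      by linarith
    then have "2 * y div N < 2 * h"
      using N by (simp add: mult_less_cancel_right_pos del: mult_less_cancel_right)
    then show "\<sigma> y \<in> Pow P \<and> 2 * y div N \<in> {0..<2 * h}"
      using \<open>0 \<le> 2 * y div N\<close> by (auto simp: \<sigma>_def)
  qed
  ultimately have "card S \<le> card (Pow P \<times> {0..<2 * h})"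
    using Pfin by (intro card_inj_on_le[of "\<lambda>y. (\<sigma> y, 2 * y div N)"]) auto
  then show ?thesis
    using Pfin by (simp add: card_cartesian_product card_Pow P_def)
qed simp

lemma squarefree_smooth_dvd:
  fixes f D :: int
  assumes "squarefree f" "D \<noteq> 0" "\<And>p. prime p \<Longrightarrow> p dvd f \<Longrightarrow> p dvd D"
  shows "f dvd D"
proof (rule multiplicity_le_imp_dvd)
  show nz: "f \<noteq> 0" using assms(1) by auto
  fix p :: int assume p: "prime p"
  show "multiplicity p f \<le> multiplicity p D"
  proof (cases "p dvd f")
    case True
    then have "multiplicity p f \<le> 1"
      using assms(1) nz p by (simp add: squarefree_factorial_semiring'')
    moreover have "p ^ 1 dvd D"
      using assms(3)[OF p True] by simp
    then have "1 \<le> multiplicity p D"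
      using assms(2) p not_prime_unit by (intro multiplicity_geI) auto
    ultimately show ?thesis by linarith
  qed (simp add: not_dvd_imp_multiplicity_0)
qed

lemma ex_squarefree_times_square:
  fixes c :: int
  assumes "c > 0"
  shows "\<exists>e s. c = e * s\<^sup>2 \<and> squarefree e \<and> e > 0 \<and> s > 0"
proof -
  define s where "s = \<bar>square_part c\<bar>"
  have s: "s > 0"
    using assms by (simp add: s_def)
  have sd: "s\<^sup>2 dvd c"
    by (simp add: s_def square_part_square_dvd)
  then obtain e where e: "c = s\<^sup>2 * e" ..
  have "e > 0"
    using assms s unfolding e by (simp add: zero_less_mult_iff)
  moreover have "squarefree e"
  proof (rule squarefreeI)
    fix x assume "x\<^sup>2 dvd e"
    then have "(s * x)\<^sup>2 dvd c"
      by (simp add: e power_mult_distrib)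
    then have "s * x dvd square_part c"
      by (simp add: dvd_square_part_iff)
    then have "s * x dvd s * 1"
      by (simp add: s_def)
    then show "x dvd 1"
      using s by (subst (asm) dvd_mult_cancel_left) auto
  qed
  ultimately show ?thesis
    using s e by (auto simp: mult.commute)
qed

text \<open>One squarefree number covers both kinds of fundamental discriminant: D itself, or D /
  4.\<close>

lemma fundamental_discriminant_squarefree:
  assumes "fundamental_discriminant D"
  shows "\<exists>f. squarefree f \<and> D dvd 4 * f \<and> D \<noteq> 0"
proof -
  consider "squarefree D" | "4 dvd D" "squarefree (D div 4)"
    using assms by (auto simp: fundamental_discriminant_def)
  then show ?thesis
  proof cases
    case 1
    then show ?thesis by (intro exI[of _ D]) auto
  next
    case 2
    then show ?thesis by (intro exI[of _ "D div 4"]) auto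
  qed
qed

text \<open>A prime of s divides D and so not v, hence v drops out of the gcd. What remains divides
  8 gcd(s, f), and gcd(s, f) is squarefree with all its primes dividing D.\<close>

lemma gcd_smooth_fundamental:
  fixes s D m0 f v :: int
  assumes s: "s > 0" and D: "D \<noteq> 0" and smooth: "\<And>p. prime p \<Longrightarrow> p dvd s \<Longrightarrow> p dvd D"
    and f: "squarefree f" "m0 dvd 4 * f" and v: "coprime v D"
  shows "gcd s (2 * (m0 * v\<^sup>2)) \<le> 8 * \<bar>D\<bar>"
proof -
  have "coprime s v"
  proof (rule ccontr)
    assume "\<not> coprime s v"
    then have "\<not> is_unit (gcd s v)" "gcd s v \<noteq> 0"
      using s by (simp_all add: coprime_iff_gcd_eq_1)
    then obtain p where "prime p" "p dvd gcd s v"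
      using prime_divisor_exists by blast
    then show False
      using smooth coprime_common_divisor[OF v, of p] not_prime_unit by auto
  qed
  then have "gcd s ((2 * m0) * v\<^sup>2) = gcd s (2 * m0)"
    by (intro gcd_mult_right_right_cancel) simp
  then have "gcd s (2 * (m0 * v\<^sup>2)) = gcd s (2 * m0)"
    by (simp only: mult.assoc)
  also have "\<dots> dvd gcd (8 * s) (8 * f)"
  proof (rule gcd_greatest)
    have "2 * m0 dvd 2 * (4 * f)"
      by (rule mult_dvd_mono[OF dvd_refl f(2)])
    then have "2 * m0 dvd 8 * f"
      by simp
    then show "gcd s (2 * m0) dvd 8 * f"
      by (rule dvd_trans[OF gcd_dvd2])
  qed simp
  also have "gcd (8 * s) (8 * f) = 8 * gcd s f"
    by (simp add: gcd_mult_distrib_int[symmetric])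
  also have "8 * gcd s f dvd 8 * D"
  proof -
    have "squarefree (gcd s f)"
      by (rule squarefree_mono[OF gcd_dvd2 f(1)])
    moreover have "p dvd D" if "prime p" "p dvd gcd s f" for p
      by (rule smooth[OF that(1) dvd_trans[OF that(2) gcd_dvd1]])
    ultimately have "gcd s f dvd D"
      by (rule squarefree_smooth_dvd[OF _ D])
    then show ?thesis
      by (rule mult_dvd_mono[OF dvd_refl])
  qed
  finally have "gcd s (2 * (m0 * v\<^sup>2)) dvd 8 * D" .
  moreover have "8 * D \<noteq> 0"
    using D by simp
  ultimately have "\<bar>gcd s (2 * (m0 * v\<^sup>2))\<bar> \<le> \<bar>8 * D\<bar>"
    by (intro dvd_imp_le_int)
  then show ?thesis
    by (simp add: abs_mult)
qed

context kloosterman_data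
begin

text \<open>With \<open>J\<close> divisible by \<open>2 \<Delta>\<close> and \<open>J\<^sup>2 \<equiv> 0 (mod c)\<close>, the substitution
  \<open>d \<mapsto> d (1 + 2 J)\<close>, \<open>a \<mapsto> a (1 - 2 J)\<close>, \<open>\<alpha> + r - d \<beta> \<mapsto> (1 + J) (\<alpha> + r - d \<beta>)\<close> changes the phase
  only by a linear term.\<close>

lemma phase_shift:
  assumes c: "c = e * s\<^sup>2" "c \<noteq> 0" and ad: "[a * d = 1] (mod c)" and r: "r \<in> L"
    and J_def: "J = 2 * lattice_det * e * s * y"
  shows "ee (of_int w * phase (d * (1 + 2 * J)) (a * (1 - 2 * J))
      (scale (of_int (1 + J)) r + scale (of_int J) (\<alpha> + scale (of_int d) \<beta>)) / of_int c) =
    ee (of_int w * (phase d a r + of_int (2 * e * s * y * (n * d - m * a))) / of_int c)"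
proof -
  define x where "x = \<alpha> + r"
  define x' where "x' = x + scale (of_int d) \<beta>"
  \<comment> \<open>On the dual lattice \<Delta> clears the denominators of the form and 2 \<Delta>
    those of q. F, Q1 and Q2 are the resulting integers; J supplies the factors that produce
    them.\<close>
  define F where "F = of_int lattice_det * form x \<beta>"
  define Q1 where "Q1 = 2 * of_int lattice_det * q x"
  define Q2 where "Q2 = 2 * of_int lattice_det * q x'"
  define r' where "r' = scale (of_int (1 + J)) r + scale (of_int J) (\<alpha> + scale (of_int d) \<beta>)"
  obtain i where i: "a * d - 1 = c * i"
    using ad unfolding cong_iff_dvd_diff by (rule dvdE)
  have dual: "x \<in> dual_lattice" "x' \<in> dual_lattice"
    unfolding x_def x'_def by (intro dual_add dual_scale \<alpha> \<beta> lattice_subset_dual[OF r])+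
  have ints: "F \<in> \<int>" "Q1 \<in> \<int>" "Q2 \<in> \<int>"
    unfolding F_def Q1_def Q2_def by (intro det_form_dual_integral det_q_dual_integral dual \<beta>)+
  have det0: "(of_int lattice_det :: rat) \<noteq> 0"
    using lattice_det_nonzero by simp
  have x_r': "\<alpha> + r' = x + scale (of_int J) x'"
    by (simp add: r'_def x_def x'_def scale_left_distrib scale_right_distrib algebra_simps)
  have q_r': "q (\<alpha> + r') = q x + of_int J * (2 * q x + of_int d * form x \<beta>) + (of_int J)\<^sup>2 * q x'"
  proof -
    have "form x x' = 2 * q x + of_int d * form x \<beta>"
      by (simp add: x'_def form_bilinear q_def)
    then show ?thesis
      unfolding x_r' by (simp add: q_add q_scale form_scale_right)
  qed
  have form_r': "form \<beta> r' = form \<beta> r + of_int J * (form x \<beta> + of_int d * (2 * q \<beta>))"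
    by (simp add: r'_def x_def form_bilinear form_sym[of \<alpha> \<beta>] form_sym[of r \<beta>] q_def algebra_simps)
  define M where "M = (of_int m / (2 * of_int lattice_det) :: rat)"
  define N where "N = (of_int n / (2 * of_int lattice_det) :: rat)"
  have mn: "of_int m = 2 * of_int lattice_det * M" "of_int n = 2 * of_int lattice_det * N"
    using det0 by (simp_all add: M_def N_def)
  have "phase (d * (1 + 2 * J)) (a * (1 - 2 * J)) r' - phase d a r =
      2 * of_int J * (of_int d * N - of_int a * M) - of_int J * form x \<beta> * of_int (a * d - 1)
      + (of_int J)\<^sup>2 * of_int a * (4 * q x + 2 * of_int d * form x \<beta> - q x' + 2 * of_int J * q x')"
    unfolding phase_def Aval_def Dval_def M_def[symmetric] N_def[symmetric] q_r' form_r' x_def[symmetric]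
    by (simp add: algebra_simps power2_eq_square power3_eq_cube)
  \<comment> \<open>This is the linear term that remains. The other two are multiples of c, one
    through a d - 1 and the other through J^2, which contains e^2 s^2.\<close>
  also have "2 * of_int J * (of_int d * N - of_int a * M) = of_int (2 * e * s * y * (n * d - m * a))"
    by (simp add: J_def mn algebra_simps)
  also have "of_int J * form x \<beta> * of_int (a * d - 1) = of_int c * (of_int (2 * e * s * y * i) * F)"
    unfolding i by (simp add: J_def F_def)
  also have "(of_int J)\<^sup>2 * of_int a * (4 * q x + 2 * of_int d * form x \<beta> - q x' + 2 * of_int J * q x') =
      of_int c * (of_int (2 * lattice_det * e * y\<^sup>2 * a) * (4 * Q1 + of_int (4 * d) * F - Q2 + of_int (2 * J) * Q2))"
    unfolding c(1) by (simp add: J_def F_def Q1_def Q2_def power2_eq_square algebra_simps)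
  finally have "phase (d * (1 + 2 * J)) (a * (1 - 2 * J)) r' - (phase d a r + of_int (2 * e * s * y * (n * d - m * a))) =
      of_int c * (of_int (2 * lattice_det * e * y\<^sup>2 * a) * (4 * Q1 + of_int (4 * d) * F - Q2 + of_int (2 * J) * Q2)
        - of_int (2 * e * s * y * i) * F)"
    by (simp add: right_diff_distrib)
  then show ?thesis
    unfolding r'_def
    by (rule ee_scaled_cong[OF c(2)]) (intro Ints_diff Ints_mult Ints_add Ints_of_int Ints_numeral ints)
qed

text \<open>J^2 is a multiple of c, so 1 + 2 J and 1 + J are units and the substitution permutes the
  pairs and L / c L. The identity holds for every y, which prepares the averaging.\<close>

lemma tsum_shift:
  assumes c: "c = e * s\<^sup>2" "c > 0"
  shows "tsum c w = (\<Sum>(d, a)\<in>unit_pairs c. lsum c (\<lambda>r. ee (of_int w * phase d a r / of_int c))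
    * ec c (w * (2 * e * s * (n * d - m * a)) * y))"
proof -
  define J where "J = 2 * lattice_det * e * s * y"
  have c0: "c \<noteq> 0" using c(2) by simp
  have J2: "J\<^sup>2 = c * (4 * lattice_det\<^sup>2 * e * y\<^sup>2)"
    by (simp add: J_def c(1) power2_eq_square)
  have u: "[(1 - 2 * J) * (1 + 2 * J) = 1] (mod c)"
  proof -
    have "(1 - 2 * J) * (1 + 2 * J) - 1 = c * (- 4 * (4 * lattice_det\<^sup>2 * e * y\<^sup>2))"
      using J2 by (simp add: algebra_simps power2_eq_square)
    then show ?thesis
      by (simp only: cong_iff_dvd_diff dvd_triv_left)
  qed
  have "[(1 - J) * (1 + J) = 1] (mod c)"
  proof -
    have "(1 - J) * (1 + J) - 1 = c * (- (4 * lattice_det\<^sup>2 * e * y\<^sup>2))"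
      using J2 by (simp add: algebra_simps power2_eq_square)
    then show ?thesis
      by (simp only: cong_iff_dvd_diff dvd_triv_left)
  qed
  then have cop: "coprime (1 + J) c"
    by (rule coprime_of_cong_inverse(2))
  have "scale (of_int (2 * e * s * y)) (scale (of_int lattice_det) (\<alpha> + scale (of_int d) \<beta>)) \<in> L" for d
    by (intro lattice_scale det_scale_dual dual_add dual_scale \<alpha> \<beta>)
  then have h: "scale (of_int J) (\<alpha> + scale (of_int d) \<beta>) \<in> L" for d
    by (simp add: J_def ac_simps)
  have "tsum c w = (\<Sum>(d, a)\<in>unit_pairs c.
      lsum c (\<lambda>r. ee (of_int w * phase (d * (1 + 2 * J)) (a * (1 - 2 * J)) r / of_int c)))"
    unfolding tsum_def by (rule unit_pairs_scale[OF c(2) u lsum_phase_cong[OF c0], symmetric])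
  also have "\<dots> = (\<Sum>(d, a)\<in>unit_pairs c. lsum c (\<lambda>r. ee (of_int w * phase d a r / of_int c))
    * ec c (w * (2 * e * s * (n * d - m * a)) * y))"
  proof (rule sum.cong[OF refl], clarify)
    fix d a assume "(d, a) \<in> unit_pairs c"
    then have ad: "[a * d = 1] (mod c)"
      by (simp add: unit_pairs_def)
    have "lsum c (\<lambda>r. ee (of_int w * phase (d * (1 + 2 * J)) (a * (1 - 2 * J)) r / of_int c)) =
        lsum c (\<lambda>r. ee (of_int w * phase (d * (1 + 2 * J)) (a * (1 - 2 * J))
          (scale (of_int (1 + J)) r + scale (of_int J) (\<alpha> + scale (of_int d) \<beta>)) / of_int c))"
      by (rule lsum_affine[OF c(2) phase_periodic[OF c0] cop h, symmetric])
    also have "\<dots> = lsum c (\<lambda>r. ec c (w * (2 * e * s * (n * d - m * a)) * y) * ee (of_int w * phase d a r / of_int c))"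
    proof (rule lsum_cong)
      fix r assume r: "r \<in> L"
      define K where "K = 2 * e * s * y * (n * d - m * a)"
      have "w * (2 * e * s * (n * d - m * a)) * y = w * K"
        by (simp add: K_def)
      moreover have "of_int w * (phase d a r + of_int K) / of_int c =
          of_int (w * K) / of_int c + of_int w * phase d a r / of_int c"
        by (simp add: add_divide_distrib distrib_left)
      ultimately show "ee (of_int w * phase (d * (1 + 2 * J)) (a * (1 - 2 * J))
          (scale (of_int (1 + J)) r + scale (of_int J) (\<alpha> + scale (of_int d) \<beta>)) / of_int c) =
          ec c (w * (2 * e * s * (n * d - m * a)) * y) * ee (of_int w * phase d a r / of_int c)"
        unfolding phase_shift[OF c(1) c0 ad r J_def] K_def[symmetric] ec_def by (simp only: ee_add)
    qed
    also have "\<dots> = ec c (w * (2 * e * s * (n * d - m * a)) * y) * lsum c (\<lambda>r. ee (of_int w * phase d a r / of_int c))"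
      by (rule lsum_mult_left)
    also have "\<dots> = lsum c (\<lambda>r. ee (of_int w * phase d a r / of_int c)) * ec c (w * (2 * e * s * (n * d - m * a)) * y)"
      by (rule mult.commute)
    finally show "lsum c (\<lambda>r. ee (of_int w * phase (d * (1 + 2 * J)) (a * (1 - 2 * J)) r / of_int c)) =
        lsum c (\<lambda>r. ee (of_int w * phase d a r / of_int c)) * ec c (w * (2 * e * s * (n * d - m * a)) * y)" .
  qed
  finally show ?thesis .
qed

text \<open>Averaging \<open>tsum_shift\<close> over y modulo c leaves the pairs for which the
  coefficient of y vanishes modulo c.\<close>

lemma tsum_localized:
  assumes c: "c = e * s\<^sup>2" "c > 0"
  shows "tsum c w = (\<Sum>(d, a)\<in>{(d, a) \<in> unit_pairs c. c dvd w * (2 * e * s * (n * d - m * a))}.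
    lsum c (\<lambda>r. ee (of_int w * phase d a r / of_int c)))"
proof -
  define G where "G = (\<lambda>(d, a). lsum c (\<lambda>r. ee (of_int w * phase d a r / of_int c)))"
  define X where "X = (\<lambda>(d, a). w * (2 * e * s * (n * d - m * a)))"
  have "of_int c * tsum c w = (\<Sum>y\<in>{0..<c}. tsum c w)"
    using c(2) by simp
  also have "\<dots> = (\<Sum>y\<in>{0..<c}. \<Sum>z\<in>unit_pairs c. G z * ec c (X z * y))"
  proof (rule sum.cong[OF refl])
    fix y
    show "tsum c w = (\<Sum>z\<in>unit_pairs c. G z * ec c (X z * y))"
      using tsum_shift[OF c, of w y] unfolding G_def X_def case_prod_unfold .
  qed
  also have "\<dots> = (\<Sum>z\<in>unit_pairs c. G z * (\<Sum>y\<in>{0..<c}. ec c (X z * y)))"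
    by (subst sum.swap) (simp only: sum_distrib_left)
  also have "\<dots> = (\<Sum>z\<in>unit_pairs c. if c dvd X z then of_int c * G z else 0)"
    unfolding sum_ec_linear[OF c(2)] by (intro sum.cong refl) simp
  also have "\<dots> = (\<Sum>z\<in>{z \<in> unit_pairs c. c dvd X z}. of_int c * G z)"
    by (rule sum.inter_filter[symmetric]) simp
  also have "\<dots> = of_int c * (\<Sum>z\<in>{z \<in> unit_pairs c. c dvd X z}. G z)"
    by (simp only: sum_distrib_left)
  finally have "tsum c w = (\<Sum>z\<in>{z \<in> unit_pairs c. c dvd X z}. G z)"
    using c(2) by simp
  also have "{z \<in> unit_pairs c. c dvd X z} = {(d, a) \<in> unit_pairs c. c dvd w * (2 * e * s * (n * d - m * a))}"
    by (auto simp: X_def)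
  finally show ?thesis
    by (simp only: G_def)
qed

text \<open>For a surviving pair d modulo s lies in Y, whose size is bounded in terms of \<Delta>,
  and a residue modulo s has e s lifts modulo c. Since e | \<Delta>, e s is at most sqrt(|\<Delta>|
  c). With lattice sums of size c^(g / 2) the total is of order c^((g + 1) / 2).\<close>

lemma norm_tsum_smooth:
  assumes c: "c > 0" and smooth: "\<And>p. prime p \<Longrightarrow> p dvd c \<Longrightarrow> p dvd lattice_det"
    and w: "coprime w c" and m: "m = m0 * v\<^sup>2" and v: "coprime v lattice_det"
    and f: "squarefree f" "m0 dvd 4 * f"
  shows "norm (tsum c w) \<le> smooth_const * sqrt (of_int c) ^ (lattice_rank + 1)"
proof -
  obtain e s where es: "c = e * s\<^sup>2" "squarefree e" "e > 0" "s > 0"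
    using ex_squarefree_times_square[OF c] by blast
  have e_dvd: "e dvd lattice_det"
  proof (rule squarefree_smooth_dvd[OF es(2) lattice_det_nonzero])
    fix p :: int assume "prime p" "p dvd e"
    then show "p dvd lattice_det"
      by (intro smooth) (simp_all add: es(1))
  qed
  have smooth_s: "p dvd lattice_det" if "prime p" "p dvd s" for p
    using that by (intro smooth) (simp_all add: es(1) power2_eq_square)
  have cop_s: "coprime x s" if "coprime x c" for x
    using that by (simp add: es(1))
  define D where "D = {(d, a) \<in> unit_pairs c. c dvd w * (2 * e * s * (n * d - m * a))}"
  define Y where "Y = {y \<in> {0..<s}. coprime y s \<and> s dvd 2 * (n * y\<^sup>2 - m)}"
  define h where "h = gcd s (2 * m)"
  have h: "h > 0" "h \<le> 8 * \<bar>lattice_det\<bar>"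
    using es(4) gcd_smooth_fundamental[OF es(4) lattice_det_nonzero smooth_s f v] by (simp_all add: h_def m)
  obtain N where N: "s = h * N"
    unfolding h_def using gcd_dvd1[of s "2 * m"] by (rule dvdE)
  have N0: "N > 0"
    using es(4) h(1) unfolding N by (simp add: zero_less_mult_iff)
  have card_Y: "card Y \<le> 2 ^ card (prime_factors lattice_det) * nat (2 * h)"
  proof (rule card_square_roots_smooth[OF N0 lattice_det_nonzero _ h(1)])
    show "p dvd lattice_det" if "prime p" "p dvd N" for p
      using that by (intro smooth_s) (simp_all add: N)
    show "Y \<subseteq> {0..<h * N}"
      by (auto simp: Y_def N)
    show "coprime y N" if "y \<in> Y" for y
      using that by (simp add: Y_def N)
    fix x y assume "x \<in> Y" "y \<in> Y"
    then have x: "s dvd 2 * (n * x\<^sup>2 - m)" and y: "s dvd 2 * (n * y\<^sup>2 - m)"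
      by (simp_all add: Y_def)
    \<comment> \<open>Crossing the two congruences eliminates n, whose common factors with s are not
      controlled, and leaves 2 m (x^2 - y^2); division by h = gcd(s, 2 m) then gives N | x^2 -
      y^2.\<close>
    have "s dvd (2 * (n * x\<^sup>2 - m)) * y\<^sup>2 - (2 * (n * y\<^sup>2 - m)) * x\<^sup>2"
      by (rule dvd_diff[OF dvd_mult2[OF x] dvd_mult2[OF y]])
    also have "(2 * (n * x\<^sup>2 - m)) * y\<^sup>2 - (2 * (n * y\<^sup>2 - m)) * x\<^sup>2 = (2 * m) * (x\<^sup>2 - y\<^sup>2)"
      by (simp add: algebra_simps)
    finally have "s dvd (2 * m) * (x\<^sup>2 - y\<^sup>2)" .
    moreover obtain b where b: "2 * m = h * b"
      unfolding h_def using gcd_dvd2[of s "2 * m"] by (rule dvdE)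
    ultimately have "h * N dvd h * (b * (x\<^sup>2 - y\<^sup>2))"
      by (simp add: N mult.assoc)
    then have "N dvd b * (x\<^sup>2 - y\<^sup>2)"
      using h(1) by simp
    moreover have "coprime N b"
    proof -
      have "gcd (h * N) (h * b) = h"
        unfolding N[symmetric] b[symmetric] by (simp add: h_def)
      then have "h * gcd N b = h * 1"
        using h(1) gcd_mult_distrib_int[of h N b] by simp
      then show ?thesis
        using h(1) by (simp add: coprime_iff_gcd_eq_1)
    qed
    ultimately show "N dvd x\<^sup>2 - y\<^sup>2"
      by (simp add: coprime_dvd_mult_right_iff)
  qed
  have "card D = card (fst ` D)"
    by (rule card_image[symmetric], rule inj_on_subset[OF inj_on_fst_unit_pairs[of c]]) (auto simp: D_def)
  also have "\<dots> \<le> card {d \<in> {0..<s * (e * s)}. d mod s \<in> Y}"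
  proof (rule card_mono)
    show "fst ` D \<subseteq> {d \<in> {0..<s * (e * s)}. d mod s \<in> Y}"
    proof
      fix d assume "d \<in> fst ` D"
      then obtain a where da: "(d, a) \<in> unit_pairs c" "c dvd w * (2 * e * s * (n * d - m * a))"
        by (auto simp: D_def)
      have ad: "[a * d = 1] (mod s)"
        using da(1) cong_dvd_modulus[of "a * d" 1 c s] by (simp add: unit_pairs_def es(1))
      have d_range: "0 \<le> d" "d < c"
        using da(1) by (auto simp: unit_pairs_def)
      have "c = (e * s) * s" "w * (2 * e * s * (n * d - m * a)) = (e * s) * (w * (2 * (n * d - m * a)))"
        by (simp_all add: es(1) power2_eq_square)
      then have "(e * s) * s dvd (e * s) * (w * (2 * (n * d - m * a)))"
        using da(2) by simp
      then have "s dvd w * (2 * (n * d - m * a))"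
        using es(3,4) by simp
      then have "s dvd 2 * (n * d - m * a)"
        using cop_s[OF w] by (simp add: coprime_commute coprime_dvd_mult_right_iff)
      then have "s dvd 2 * (n * d - m * a) * d + 2 * m * (a * d - 1)"
        using ad unfolding cong_iff_dvd_diff by (rule dvd_add[OF dvd_mult2 dvd_mult])
      also have "2 * (n * d - m * a) * d + 2 * m * (a * d - 1) = 2 * (n * d\<^sup>2 - m)"
        by (simp add: algebra_simps power2_eq_square)
      finally have 1: "s dvd 2 * (n * d\<^sup>2 - m)" .
      have "[d mod s = d] (mod s)" by simp
      then have "[2 * (n * (d mod s)\<^sup>2 - m) = 2 * (n * d\<^sup>2 - m)] (mod s)"
        by (intro cong_mult cong_diff cong_pow cong_refl)
      then have "s dvd 2 * (n * (d mod s)\<^sup>2 - m)"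
        using 1 cong_dvd_iff by blast
      moreover have "coprime (d mod s) s"
        using coprime_of_cong_inverse(2)[OF ad] es(4) by simp
      ultimately have "d mod s \<in> Y"
        using es(4) by (simp add: Y_def)
      then show "d \<in> {d \<in> {0..<s * (e * s)}. d mod s \<in> Y}"
        using d_range by (simp add: es(1) power2_eq_square ac_simps)
    qed
  qed (rule finite_subset[of _ "{0..<s * (e * s)}"], auto)
  also have "\<dots> \<le> card Y * nat (e * s)"
    using es(3,4) by (intro card_residues_lift finite_subset[of Y "{0..<s}"]) (auto simp: Y_def)
  also have "\<dots> \<le> 2 ^ card (prime_factors lattice_det) * nat (2 * h) * nat (e * s)"
    by (intro mult_right_mono card_Y) simp
  finally have "real (card D) \<le> real (2 ^ card (prime_factors lattice_det) * nat (2 * h) * nat (e * s))"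
    by (simp only: of_nat_le_iff)
  also have "\<dots> = 2 ^ card (prime_factors lattice_det) * (2 * of_int h) * (of_int e * of_int s)"
    using h(1) es(3,4) by simp
  also have "\<dots> \<le> 2 ^ card (prime_factors lattice_det) * (16 * of_int \<bar>lattice_det\<bar>) * (sqrt (of_int \<bar>lattice_det\<bar>) * sqrt (of_int c))"
  proof -
    have "2 * h \<le> 16 * \<bar>lattice_det\<bar>"
      using h(2) by simp
    then have "of_int (2 * h) \<le> (of_int (16 * \<bar>lattice_det\<bar>) :: real)"
      by (simp only: of_int_le_iff)
    then have A: "2 * of_int h \<le> 16 * (of_int \<bar>lattice_det\<bar> :: real)"
      by simp
    have "\<bar>e\<bar> \<le> \<bar>lattice_det\<bar>"
      by (rule dvd_imp_le_int[OF lattice_det_nonzero e_dvd])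
    then have "e \<le> \<bar>lattice_det\<bar>"
      using es(3) by simp
    then have "of_int e \<le> (of_int \<bar>lattice_det\<bar> :: real)"
      by (simp only: of_int_le_iff)
    then have "sqrt (of_int e) * sqrt (of_int c) \<le> sqrt (of_int \<bar>lattice_det\<bar>) * sqrt (of_int c)"
      using c by (intro mult_right_mono) simp_all
    moreover have "sqrt (of_int e) * sqrt (of_int c) = of_int e * of_int s"
    proof -
      have "sqrt (of_int c) = sqrt (of_int e) * of_int s"
        using es(4) by (simp add: es(1) real_sqrt_mult)
      then show ?thesis
        using es(3) by simp
    qed
    ultimately have B: "of_int e * of_int s \<le> sqrt (of_int \<bar>lattice_det\<bar>) * sqrt (of_int c)"
      by (simp only:)
    show ?thesis
      by (rule mult_mono[OF mult_left_mono[OF A] B]) (use es in simp_all)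
  qed
  finally have card_D: "real (card D) \<le> 2 ^ card (prime_factors lattice_det) * (16 * of_int \<bar>lattice_det\<bar>)
      * (sqrt (of_int \<bar>lattice_det\<bar>) * sqrt (of_int c))" .
  have "norm (tsum c w) \<le> real (card D) * sqrt (of_int (\<bar>lattice_det\<bar> * c) ^ lattice_rank)"
    unfolding tsum_localized[OF es(1) c] D_def[symmetric]
  proof (rule sum_norm_bound)
    fix z assume "z \<in> D"
    then obtain d a where z: "z = (d, a)" and "(d, a) \<in> unit_pairs c"
      by (auto simp: D_def)
    then have "coprime a c"
      using coprime_of_cong_inverse(1)[of a d c] by (simp add: unit_pairs_def)
    then show "norm (case z of (d, a) \<Rightarrow> lsum c (\<lambda>r. ee (of_int w * phase d a r / of_int c)))
        \<le> sqrt (of_int (\<bar>lattice_det\<bar> * c) ^ lattice_rank)"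
      unfolding z prod.case by (rule norm_lsum_phase[OF c _ w])
  qed
  also have "\<dots> \<le> (2 ^ card (prime_factors lattice_det) * (16 * of_int \<bar>lattice_det\<bar>)
      * (sqrt (of_int \<bar>lattice_det\<bar>) * sqrt (of_int c))) * sqrt (of_int (\<bar>lattice_det\<bar> * c) ^ lattice_rank)"
    using c by (intro mult_right_mono card_D) simp
  also have "sqrt (of_int (\<bar>lattice_det\<bar> * c) ^ lattice_rank) =
      sqrt (of_int \<bar>lattice_det\<bar>) ^ lattice_rank * sqrt (of_int c) ^ lattice_rank"
    by (simp add: real_sqrt_power real_sqrt_mult power_mult_distrib)
  finally show ?thesis
    by (simp add: smooth_const_def ac_simps)
qed

end

section \<open>The bound\<close>

lemma gcd_mult_le:
  fixes x c1 c2 :: int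
  assumes "coprime c1 c2" "c1 > 0" "c2 > 0"
  shows "gcd x c1 * gcd x c2 \<le> gcd x (c1 * c2)"
proof -
  have "coprime (gcd x c1) (gcd x c2)"
    using assms(1) by (rule coprime_divisors[rotated 2]) simp_all
  then have "gcd x c1 * gcd x c2 dvd x"
    by (intro divides_mult) simp_all
  moreover have "gcd x c1 * gcd x c2 dvd c1 * c2"
    by (rule mult_dvd_mono) simp_all
  ultimately have "gcd x c1 * gcd x c2 dvd gcd x (c1 * c2)"
    by (rule gcd_greatest)
  moreover have "gcd x (c1 * c2) > 0"
    using assms by simp
  ultimately show ?thesis
    by (rule zdvd_imp_le)
qed

lemma num_prime_divisors_mult:
  assumes p: "prime p" "k \<ge> 1" "\<not> p dvd c" and c: "c > 0"
  shows "num_prime_divisors c + 1 \<le> num_prime_divisors (p ^ k * c)"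
proof -
  have fin: "finite {q. prime q \<and> q dvd N}" if "N > 0" for N :: nat
    by (rule finite_subset[OF _ finite_divisors_nat[OF that]]) blast
  have "card (insert p {q. prime q \<and> q dvd c}) \<le> card {q. prime q \<and> q dvd p ^ k * c}"
  proof (rule card_mono)
    show "finite {q. prime q \<and> q dvd p ^ k * c}"
      using p c prime_gt_0_nat by (intro fin) simp
    show "insert p {q. prime q \<and> q dvd c} \<subseteq> {q. prime q \<and> q dvd p ^ k * c}"
      using p by (auto intro: dvd_mult dvd_mult2 dvd_power)
  qed
  then show ?thesis
    using p fin[OF c] by (simp add: num_prime_divisors_def)
qed

text \<open>Each step of the induction removes the full power of one prime not dividing \<Delta>.
  Its factor 2 is paid for by the growth of omega, and the gcds combine by
  \<open>gcd_mult_le\<close>. The part left at the end has only primes dividing \<Delta>, so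
  \<open>smooth_const\<close> enters once.\<close>

lemma (in kloosterman_data) norm_tsum_le:
  assumes rank: "odd lattice_rank" and m: "m = m0 * v\<^sup>2" and v: "coprime v lattice_det"
    and f: "squarefree f" "m0 dvd 4 * f" and c: "c > 0" and w: "coprime w (int c)"
  shows "norm (tsum (int c) w) \<le> smooth_const * 2 ^ num_prime_divisors c
    * sqrt (of_int (gcd (m0 * n) (int c))) * sqrt (real c) ^ (lattice_rank + 1)"
  using c w
proof (induction c arbitrary: w rule: less_induct)
  case (less c)
  show ?case
  proof (cases "\<forall>p. prime p \<longrightarrow> p dvd int c \<longrightarrow> p dvd lattice_det")
    case True
    have "norm (tsum (int c) w) \<le> smooth_const * sqrt (of_int (int c)) ^ (lattice_rank + 1)"
      by (rule norm_tsum_smooth[OF _ _ less.prems(2) m v f]) (use True less.prems(1) in simp_all)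
    also have "\<dots> = smooth_const * sqrt (real c) ^ (lattice_rank + 1) * (1 * 1)"
      by simp
    also have "\<dots> \<le> smooth_const * sqrt (real c) ^ (lattice_rank + 1) *
        (2 ^ num_prime_divisors c * sqrt (of_int (gcd (m0 * n) (int c))))"
    proof (rule mult_left_mono)
      have "gcd (m0 * n) (int c) > 0"
        using less.prems(1) by simp
      then have "1 \<le> gcd (m0 * n) (int c)"
        by linarith
      then have "(1::real) \<le> of_int (gcd (m0 * n) (int c))"
        by (simp only: of_int_1_le_iff)
      then have "1 \<le> sqrt (of_int (gcd (m0 * n) (int c)))"
        by (simp only: real_sqrt_ge_1_iff)
      moreover have "(1::real) \<le> 2 ^ num_prime_divisors c"
        by simp
      ultimately show "1 * 1 \<le> 2 ^ num_prime_divisors c * sqrt (of_int (gcd (m0 * n) (int c)))"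
        by (intro mult_mono) simp_all
    qed (simp add: smooth_const_nonneg)
    finally show ?thesis
      by (simp only: ac_simps)
  next
    case False
    then obtain p where p: "prime p" "p dvd int c" "\<not> p dvd lattice_det" by blast
    have "p \<noteq> 2"
      using p(3) even_lattice_det[OF rank] by blast
    then have p2: "p > 2"
      using prime_ge_2_int[OF p(1)] by linarith
    define p' where "p' = nat p"
    have p': "p = int p'" "prime p'"
      using p(1) p2 by (simp_all add: p'_def prime_nat_iff_prime)
    define k where "k = multiplicity p' c"
    have "\<not> is_unit p'" using p'(2) not_prime_unit by blast
    then obtain c' where c': "c = p' ^ k * c'" "\<not> p' dvd c'"
      unfolding k_def using multiplicity_decompose'[of c p'] less.prems(1) by blast
    have "p' dvd c"
      using p(2) unfolding p'(1) by simp
    then have k: "k \<ge> 1"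
      using c' by (cases k) auto
    have c'0: "c' > 0"
      using c'(1) less.prems(1) by (cases c') auto
    have p'1: "p' > 1"
      using p'(2) by (rule prime_gt_1_nat)
    have "p' ^ k > 1"
      using p'1 k by (intro one_less_power) simp_all
    then have c'_less: "c' < c"
      using c'0 unfolding c'(1) by simp
    have ic: "int c = p ^ k * int c'"
      by (simp add: c'(1) p'(1))
    have pk: "p ^ k > 0" using p2 by simp
    have "coprime p' c'"
      using p'(2) c'(2) by (rule prime_imp_coprime)
    then have cop: "coprime (p ^ k) (int c')"
      unfolding p'(1) by simp
    obtain w1 w2 where w1: "coprime w1 (p ^ k)" and w2: "coprime w2 (int c')"
      and split: "tsum (p ^ k * int c') w = tsum (p ^ k) w1 * tsum (int c') w2"
      using tsum_crt[OF pk _ cop, of w] c'0 less.prems(2) unfolding ic by auto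
    have w1p: "\<not> p dvd w1"
      using w1 coprime_prime_power_iff[OF p(1), of k w1] k by simp
    define A where "A = sqrt (of_int (gcd (m0 * n) (p ^ k)))"
    define B where "B = sqrt (of_int (gcd (m0 * n) (int c')))"
    define X where "X = sqrt (of_int (p ^ k)) ^ (lattice_rank + 1)"
    define Y where "Y = sqrt (real c') ^ (lattice_rank + 1)"
    have nonneg: "A \<ge> 0" "B \<ge> 0" "X \<ge> 0" "Y \<ge> 0"
      using p2 by (simp_all add: A_def B_def X_def Y_def)
    have "norm (tsum (int c) w) = norm (tsum (p ^ k) w1) * norm (tsum (int c') w2)"
      unfolding ic split by (rule norm_mult)
    also have "\<dots> \<le> (2 * A * X) * (smooth_const * 2 ^ num_prime_divisors c' * B * Y)"
    proof (rule mult_mono)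
      show "norm (tsum (p ^ k) w1) \<le> 2 * A * X"
        unfolding A_def X_def by (rule norm_tsum_prime_power[OF p(1) p2 p(3) rank k w1p m])
      show "norm (tsum (int c') w2) \<le> smooth_const * 2 ^ num_prime_divisors c' * B * Y"
        unfolding B_def Y_def by (rule less.IH[OF c'_less c'0 w2])
    qed (use nonneg in simp_all)
    also have "\<dots> = smooth_const * (2 ^ (num_prime_divisors c' + 1) * ((A * B) * (X * Y)))"
      by simp
    also have "\<dots> \<le> smooth_const * (2 ^ num_prime_divisors c
        * (sqrt (of_int (gcd (m0 * n) (int c))) * (sqrt (real c) ^ (lattice_rank + 1))))"
    proof (rule mult_left_mono[OF _ smooth_const_nonneg], rule mult_mono)
      have "num_prime_divisors c' + 1 \<le> num_prime_divisors c"
        unfolding c'(1) by (rule num_prime_divisors_mult[OF p'(2) k c'(2) c'0])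
      then show "(2::real) ^ (num_prime_divisors c' + 1) \<le> 2 ^ num_prime_divisors c"
        by (intro power_increasing) simp_all
      have "A * B = sqrt (of_int (gcd (m0 * n) (p ^ k) * gcd (m0 * n) (int c')))"
        by (simp add: A_def B_def real_sqrt_mult)
      also have "\<dots> \<le> sqrt (of_int (gcd (m0 * n) (int c)))"
        unfolding ic real_sqrt_le_iff of_int_le_iff using c'0 by (intro gcd_mult_le cop pk) simp
      finally have AB: "A * B \<le> sqrt (of_int (gcd (m0 * n) (int c)))" .
      have "real c = of_int (p ^ k) * real c'"
        by (simp add: c'(1) p'(1))
      then have XY: "X * Y = sqrt (real c) ^ (lattice_rank + 1)"
        by (simp only: X_def Y_def real_sqrt_mult power_mult_distrib)
      show "(A * B) * (X * Y) \<le> sqrt (of_int (gcd (m0 * n) (int c))) * (sqrt (real c) ^ (lattice_rank + 1))"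
        unfolding XY using AB by (rule mult_right_mono) simp
    qed (use nonneg in simp_all)
    finally show ?thesis
      by (simp only: ac_simps)
  qed
qed

section \<open>From the Weil representation coefficients to \<open>tsum\<close>\<close>

lemma e_frac_of_rat: "e_frac (of_int c) (of_rat x) = ee (x / of_int c)"
  by (simp add: e_frac_def ee_def of_rat_divide)

lemma e_frac_of_int: "e_frac (of_int c) (of_int x) = ee (of_int x / of_int c)"
  using e_frac_of_rat[of c "of_int x"] by simp

definition (in even_lattice) weil_factor :: "nat \<Rightarrow> complex" where
  "weil_factor c = i_pow ((real sig_neg - real sig_pos) / 2)
     / of_real (real_of_int (int c) powr ((real sig_pos + real sig_neg) / 2)
                * sqrt (real (card (dual_lattice // coset_rel L))))"

lemma (in even_lattice) norm_weil_factor: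
  assumes "c \<ge> 1"
  shows "norm (weil_factor c) * sqrt (real c) ^ lattice_rank \<le> 1"
proof (cases "card (dual_lattice // coset_rel L) = 0")
  \<comment> \<open>A cardinality 0 makes the denominator and hence the quotient 0. Otherwise its
    square root is at least 1 and can only decrease the modulus.\<close>
  case True
  then show ?thesis by (simp add: weil_factor_def)
next
  case False
  define den where "den = real c powr ((real sig_pos + real sig_neg) / 2) * sqrt (real (card (dual_lattice // coset_rel L)))"
  have "sqrt (real c) ^ lattice_rank = real c powr (real lattice_rank / 2)"
    using assms by (simp add: powr_half_sqrt[symmetric] powr_power mult.commute)
  also have "\<dots> \<le> real c powr ((real sig_pos + real sig_neg) / 2)"
    using assms rank_le_signature by (intro powr_mono) simp_all
  also have "\<dots> \<le> den"
  proof -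
    have "1 \<le> sqrt (real (card (dual_lattice // coset_rel L)))"
      using False by simp
    then have "real c powr ((real sig_pos + real sig_neg) / 2) * 1 \<le> den"
      unfolding den_def by (intro mult_left_mono) simp_all
    then show ?thesis by simp
  qed
  finally have le: "sqrt (real c) ^ lattice_rank \<le> den" .
  have "den > 0"
    unfolding den_def using assms False by simp
  have "weil_factor c = i_pow ((real sig_neg - real sig_pos) / 2) / of_real den"
    unfolding weil_factor_def den_def by simp
  then have "norm (weil_factor c) = 1 / den"
    using \<open>den > 0\<close> by (simp add: norm_divide i_pow_def)
  then have "norm (weil_factor c) * sqrt (real c) ^ lattice_rank = sqrt (real c) ^ lattice_rank / den"
    by simp
  also have "\<dots> \<le> 1"
    using le \<open>den > 0\<close> by (simp only: divide_le_eq_1_pos)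
  finally show ?thesis .
qed

context kloosterman_data
begin

text \<open>Conjugation reverses the exponent of the Weil coefficient, which joined with that of m a
  + n d is the phase; only the pairing of \<beta> and \<alpha> over c splits off, a unimodular
  factor independent of a, d and r.\<close>

lemma weil_summand:
  assumes "c \<ge> 1"
  shows "cnj (weil_coeff \<alpha> \<beta> (a, b, int c, d)) * e_frac (of_int (2 * lattice_det * int c)) (of_int (m * a + n * d)) =
    cnj (weil_factor c) * ee (form \<beta> \<alpha> / of_int (int c)) * lsum (int c) (\<lambda>r. ee (of_int 1 * phase d a r / of_int (int c)))"
proof -
  define C where "C = int c"
  have C: "C > 0" using assms by (simp add: C_def)
  define E where "E = (\<lambda>r. of_int a * q (\<alpha> + r) - form \<beta> (\<alpha> + r) + of_int d * q \<beta>)"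
  have weil: "weil_coeff \<alpha> \<beta> (a, b, C, d) = weil_factor c * lsum C (\<lambda>r. ee (E r / of_int C))"
    unfolding weil_coeff_def weil_factor_def lsum_def multiples_def prod.case Let_def e_frac_of_rat E_def
    by (simp add: C_def)
  have key: "ee (of_int (m * a + n * d) / of_int (2 * lattice_det * C)) * cnj (ee (E r / of_int C)) =
      ee (form \<beta> \<alpha> / of_int C) * ee (of_int 1 * phase d a r / of_int C)" for r
  proof -
    have "of_int (m * a + n * d) / of_int (2 * lattice_det * C) =
        (of_int a * (of_int m / (2 * of_int lattice_det)) + of_int d * (of_int n / (2 * of_int lattice_det))) / (of_int C :: rat)"
      using C lattice_det_nonzero by (simp add: field_simps)
    then have "of_int (m * a + n * d) / of_int (2 * lattice_det * C) + - (E r / of_int C) =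
        form \<beta> \<alpha> / of_int C + of_int 1 * phase d a r / of_int C"
      by (simp add: E_def phase_def Aval_def Dval_def form_add_right add_divide_distrib diff_divide_distrib algebra_simps)
    then show ?thesis
      by (simp only: cnj_ee ee_add[symmetric])
  qed
  have "cnj (weil_coeff \<alpha> \<beta> (a, b, C, d)) * e_frac (of_int (2 * lattice_det * C)) (of_int (m * a + n * d)) =
      cnj (weil_factor c) * (ee (of_int (m * a + n * d) / of_int (2 * lattice_det * C)) * lsum C (\<lambda>r. cnj (ee (E r / of_int C))))"
    unfolding weil e_frac_of_int complex_cnj_mult cnj_lsum by (simp only: ac_simps)
  also have "\<dots> = cnj (weil_factor c) * (ee (form \<beta> \<alpha> / of_int C) * lsum C (\<lambda>r. ee (of_int 1 * phase d a r / of_int C)))"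
    unfolding lsum_mult_left[symmetric] key ..
  finally show ?thesis
    unfolding C_def by (simp only: mult.assoc)
qed

text \<open>The matrix picked by \<open>SOME\<close> enters only through a modulo c, the inverse of
  d, so the sum over totatives becomes one over \<open>unit_pairs\<close>.\<close>

lemma norm_kloosterman_le:
  assumes c: "c \<ge> 1"
  shows "norm (kloosterman k \<alpha> \<beta> m n c) * sqrt (real c) ^ lattice_rank \<le> norm (tsum (int c) 1)"
proof -
  define ab where "ab = (\<lambda>d. SOME (a, b). a * int d - b * int c = (1 :: int))"
  define G where "G = (\<lambda>d a. lsum (int c) (\<lambda>r. ee (of_int 1 * phase d a r / of_int (int c))))"
  have c0: "int c \<noteq> 0" using c by simp
  have ab: "[fst (ab d) * int d = 1] (mod int c)" if "d \<in> totatives c" for d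
  proof -
    have "coprime (int d) (int c)"
      using that by (simp add: totatives_def)
    then obtain a where "[int d * a = 1] (mod int c)"
      using cong_solve_coprime_int by blast
    then have "int c dvd a * int d - 1"
      by (simp add: cong_iff_dvd_diff mult.commute)
    then obtain b where "a * int d - 1 = int c * b" ..
    then have "a * int d - b * int c = 1"
      by (simp add: algebra_simps)
    then have "\<exists>x. case x of (a, b) \<Rightarrow> a * int d - b * int c = 1"
      by (intro exI[of _ "(a, b)"]) simp
    then have "case ab d of (a, b) \<Rightarrow> a * int d - b * int c = 1"
      unfolding ab_def by (rule someI_ex)
    then have "fst (ab d) * int d - 1 = snd (ab d) * int c"
      by (simp add: case_prod_unfold)
    then show ?thesis
      by (simp add: cong_iff_dvd_diff)
  qed
  have "kloosterman k \<alpha> \<beta> m n c = cis (- pi * k / 2) *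
      (\<Sum>d\<in>totatives c. cnj (weil_factor c) * ee (form \<beta> \<alpha> / of_int (int c)) * G (int d) (fst (ab d)))"
    unfolding kloosterman_def
  proof (rule arg_cong[where f = "\<lambda>x. cis (- pi * k / 2) * x"], rule sum.cong[OF refl])
    fix d
    have SOME_eq: "(SOME (a, b). a * int d - b * int c = 1) = ab d"
      by (simp only: ab_def)
    obtain a b where ab_d: "ab d = (a, b)" by fastforce
    show "(let (a, b) = SOME (a, b). a * int d - b * int c = 1
        in cnj (weil_coeff \<alpha> \<beta> (a, b, int c, int d)) * e_frac (of_int (2 * lattice_det * int c)) (of_int (m * a + n * int d))) =
      cnj (weil_factor c) * ee (form \<beta> \<alpha> / of_int (int c)) * G (int d) (fst (ab d))"
      unfolding SOME_eq ab_d Let_def prod.case fst_conv G_def by (rule weil_summand[OF c])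
  qed
  also have "(\<Sum>d\<in>totatives c. cnj (weil_factor c) * ee (form \<beta> \<alpha> / of_int (int c)) * G (int d) (fst (ab d))) =
      cnj (weil_factor c) * ee (form \<beta> \<alpha> / of_int (int c)) * (\<Sum>d\<in>totatives c. G (int d) (fst (ab d)))"
    by (simp only: sum_distrib_left)
  also have "(\<Sum>d\<in>totatives c. G (int d) (fst (ab d))) = (\<Sum>(d, a)\<in>unit_pairs (int c). G d a)"
  proof (rule sum_totatives_eq_unit_pairs[OF _ _ ab])
    show "G d a = G d' a'" if "[d = d'] (mod int c)" "[a = a'] (mod int c)" for d d' a a'
      unfolding G_def by (rule lsum_phase_cong[OF c0 that])
  qed (use c in simp_all)
  also have "\<dots> = tsum (int c) 1"
    unfolding tsum_def G_def ..
  finally have "norm (kloosterman k \<alpha> \<beta> m n c) = norm (weil_factor c) * norm (tsum (int c) 1)"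
    by (simp add: norm_mult)
  then have "norm (kloosterman k \<alpha> \<beta> m n c) * sqrt (real c) ^ lattice_rank =
      (norm (weil_factor c) * sqrt (real c) ^ lattice_rank) * norm (tsum (int c) 1)"
    by (simp only: ac_simps)
  also have "\<dots> \<le> 1 * norm (tsum (int c) 1)"
    by (intro mult_right_mono norm_weil_factor[OF c]) simp
  finally show ?thesis by simp
qed

lemma norm_kloosterman_bound:
  assumes rank: "odd lattice_rank" and m: "m = m0 * v\<^sup>2" and v: "coprime v lattice_det"
    and f: "squarefree f" "m0 dvd 4 * f" and c: "c \<ge> 1"
  shows "norm (kloosterman k \<alpha> \<beta> m n c) \<le> smooth_const * 2 ^ num_prime_divisors c
    * sqrt (of_int (gcd (m0 * n) (int c))) * sqrt (real c)"
proof -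
  define X where "X = smooth_const * 2 ^ num_prime_divisors c * sqrt (of_int (gcd (m0 * n) (int c))) * sqrt (real c)"
  have "norm (kloosterman k \<alpha> \<beta> m n c) * sqrt (real c) ^ lattice_rank \<le> norm (tsum (int c) 1)"
    by (rule norm_kloosterman_le[OF c])
  also have "\<dots> \<le> smooth_const * 2 ^ num_prime_divisors c
    * sqrt (of_int (gcd (m0 * n) (int c))) * sqrt (real c) ^ (lattice_rank + 1)"
    using c by (intro norm_tsum_le[OF rank m v f]) simp_all
  also have "\<dots> = X * sqrt (real c) ^ lattice_rank"
    by (simp add: X_def)
  finally have "norm (kloosterman k \<alpha> \<beta> m n c) * sqrt (real c) ^ lattice_rank \<le> X * sqrt (real c) ^ lattice_rank" .
  moreover have "sqrt (real c) ^ lattice_rank > 0"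
    using c by simp
  ultimately have "norm (kloosterman k \<alpha> \<beta> m n c) \<le> X"
    by (rule mult_right_le_imp_le)
  then show ?thesis
    by (simp only: X_def)
qed

end

theorem theorem1p1:
  fixes scale :: "rat \<Rightarrow> 'v :: ab_group_add \<Rightarrow> 'v"
    and L :: "'v set"
    and form :: "'v \<Rightarrow> 'v \<Rightarrow> rat"
    and g :: nat and \<Delta> :: int
  assumes lattice: "even_lattice scale L form"
    and rank: "g = even_lattice.lattice_rank scale L"
    and "odd g"
    and disc: "\<Delta> = even_lattice.lattice_det scale L form"
  shows "\<exists>C :: real.
    \<forall>(k :: real) (\<alpha> :: 'v) (\<beta> :: 'v) (m :: int) (n :: int) (m\<^sub>0 :: int) (v :: int) (c :: nat).
      2 * k \<in> \<int> \<longrightarrow>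
      k + (real (even_lattice.sig_neg scale form) - real (even_lattice.sig_pos scale form)) / 2 \<in> \<int> \<longrightarrow>
      \<alpha> \<in> even_lattice.dual_lattice L form \<longrightarrow>
      \<beta> \<in> even_lattice.dual_lattice L form \<longrightarrow>
      of_int m / (2 * of_int \<Delta>) - even_lattice.q form \<alpha> \<in> \<int> \<longrightarrow>
      of_int n / (2 * of_int \<Delta>) - even_lattice.q form \<beta> \<in> \<int> \<longrightarrow>
      m = m\<^sub>0 * v\<^sup>2 \<longrightarrow>
      fundamental_discriminant ((- 1) ^ ((g - 1) div 2) * m\<^sub>0) \<longrightarrow>
      coprime v \<Delta> \<longrightarrow>
      c \<ge> 1 \<longrightarrow>
      norm (even_lattice.kloosterman scale L form k \<alpha> \<beta> m n c)
        \<le> C * 2 ^ num_prime_divisors c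
            * real (num_divisors (nat (gcd v (int c))))
            * sqrt (of_int (gcd (m\<^sub>0 * n) (int c)))
            * sqrt (real c)"
proof -
  interpret even_lattice scale L form by (rule lattice)
  have "norm (kloosterman k \<alpha> \<beta> m n c)
        \<le> smooth_const * 2 ^ num_prime_divisors c
            * real (num_divisors (nat (gcd v (int c))))
            * sqrt (of_int (gcd (m\<^sub>0 * n) (int c)))
            * sqrt (real c)"
    if \<alpha>: "\<alpha> \<in> dual_lattice" and \<beta>: "\<beta> \<in> dual_lattice"
      and mn: "of_int m / (2 * of_int \<Delta>) - q \<alpha> \<in> \<int>" "of_int n / (2 * of_int \<Delta>) - q \<beta> \<in> \<int>"
      and m: "m = m\<^sub>0 * v\<^sup>2" and fund: "fundamental_discriminant ((- 1) ^ ((g - 1) div 2) * m\<^sub>0)"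
      and v: "coprime v \<Delta>" and c: "c \<ge> 1"
    for k \<alpha> \<beta> m n m\<^sub>0 v c
  proof -
    interpret kloosterman_data scale L form \<alpha> \<beta> m n
      by unfold_locales (use \<alpha> \<beta> mn in \<open>simp_all add: disc\<close>)
    obtain f where f: "squarefree f" "(- 1) ^ ((g - 1) div 2) * m\<^sub>0 dvd 4 * f"
      using fundamental_discriminant_squarefree[OF fund] by blast
    \<comment> \<open>The sign in front of \<open>m\<^sub>0\<close> does not affect
      divisibility.\<close>
    have f': "m\<^sub>0 dvd 4 * f"
      using f(2) by (rule dvd_mult_right)
    define T where "T = real (num_divisors (nat (gcd v (int c))))"
    define B where "B = smooth_const * 2 ^ num_prime_divisors c * sqrt (of_int (gcd (m\<^sub>0 * n) (int c))) * sqrt (real c)"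
    have "gcd v (int c) > 0"
      using c by simp
    then have "finite {d. d dvd nat (gcd v (int c))}"
      by (intro finite_divisors_nat) simp
    then have "card {1 :: nat} \<le> card {d. d dvd nat (gcd v (int c))}"
      by (intro card_mono) simp_all
    \<comment> \<open>The divisor 1 makes the divisor count at least 1, so multiplying by T can only
      enlarge the nonnegative bound B.\<close>
    then have "1 \<le> T"
      by (simp add: T_def num_divisors_def)
    have "norm (kloosterman k \<alpha> \<beta> m n c) \<le> B"
      unfolding B_def
    proof (rule norm_kloosterman_bound[OF _ m _ f(1) f' c])
      show "odd lattice_rank" using \<open>odd g\<close> rank by simp
      show "coprime v lattice_det" using v disc by simp
    qed
    also have "B * 1 \<le> B * T"
      using \<open>1 \<le> T\<close> by (rule mult_left_mono) (simp add: B_def smooth_const_nonneg)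
    then have "B \<le> B * T"
      by simp
    finally show ?thesis
      by (simp only: B_def T_def ac_simps)
  qed
  then show ?thesis
    by blast
qed

end
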